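(* For each $n\ge1$ and each $0\le k\le 2d$, the $n$-th eigenvalue $(\boldsymbol\omega,\mathbf A)\mapsto\lambda_n(\boldsymbol\omega,\mathbf A)$ is continuous on $\Omega\times\Sigma_k^{\mathbb C}$.
   Context: Let $d\ge2$ and $[a,b]$ compact. $\Omega$ is the set of triples $\boldsymbol\omega=(P,Q,W)$ of $d\times d$ real symmetric matrix-valued functions in $L^\infty([a,b],\mathbb R^{d\times d})$ with $P(t)\ge\mu_1I_d$, $W(t)\ge\mu_2I_d$ a.e. for some $\mu_1,\mu_2>0$, with the product $L^\infty$ topology. $\mathcal B^{\mathbb C}$ is the quotient of the set of complex $2d\times4d$ matrices $(A\,|\,B)$ with $\operatorname{rank}(A\,|\,B)=2d$, $AB^*=BA^*$ (topology of $\mathbb C^{8d^2}$) by the left action $(A\,|\,B)\mapsto(TA\,|\,TB)$ of $GL(2d,\mathbb C)$, with quotient topology. The problem $(\boldsymbol\omega,\mathbf A)$, $\mathbf A=[A\,|\,B]$, is $-(Py')'+Qy=\lambda Wy$ on $[a,b]$ with $(A\,|\,B)(-y(a)^T,y(b)^T,(Py')(a)^T,(Py')(b)^T)^T=0$; its eigenvalues are real, isolated, bounded below, and are listed as $\lambda_1(\boldsymbol\omega,\mathbf A)\le\lambda_2(\boldsymbol\omega,\mathbf A)\le\cdots$ counted with multiplicity. For $[A\,|\,B]\in\mathcal B^{\mathbb C}$ let $n^0(B)=\dim\ker B$ (independent of the representative). For $0\le k\le2d$, the $k$-th layer is $\Sigma_k^{\mathbb C}=\{[A\,|\,B]\in\mathcal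 B^{\mathbb C}: n^0(B)=k\}$, with the subspace topology, and $\Omega\times\Sigma_k^{\mathbb C}$ has the product topology. *)

theory Defs
  imports "HOL-Analysis.Analysis" "HOL-Probability.Essential_Supremum"
begin

type_synonym 'd rmat = "real^'d^'d"
type_synonym 'd cvec = "complex^'d"
type_synonym 'd cmat2 = "complex^('d + 'd)^('d + 'd)"
type_synonym 'd coef = "(real \<Rightarrow> ('d::finite) rmat) \<times> (real \<Rightarrow> ('d::finite) rmat) \<times> (real \<Rightarrow> ('d::finite) rmat)"
type_synonym 'd bcmat = "'d cmat2 \<times> 'd cmat2"
  \<comment> \<open>a pair (A,B) representing the 2d x 4d matrix (A|B)\<close>
type_synonym 'd bcclass = "'d bcmat set"
  \<comment> \<open>an element [A|B] of the quotient: an orbit under the left GL(2d,C) action\<close>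

definition Linf_dist :: "real \<Rightarrow> real \<Rightarrow> (real \<Rightarrow> ('d::finite) rmat) \<Rightarrow> (real \<Rightarrow> ('d::finite) rmat) \<Rightarrow> ereal" where
  "Linf_dist a b f g = esssup (lebesgue_on {a..b}) (\<lambda>t. ereal (norm (f t - g t)))"

definition Linf :: "real \<Rightarrow> real \<Rightarrow> (real \<Rightarrow> ('d::finite) rmat) set" where
  "Linf a b = {f. f \<in> borel_measurable (lebesgue_on {a..b}) \<and>
                  esssup (lebesgue_on {a..b}) (\<lambda>t. ereal (norm (f t))) < \<infinity>}"

text \<open>The (pseudo)metric L-infinity topology (functions agreeing a.e. are not separated,
  which is immaterial, as everything below is invariant under a.e. modification).\<close>
definition Linf_top :: "real \<Rightarrow> real \<Rightarrow> (real \<Rightarrow> ('d::finite) rmat) topology" where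
  "Linf_top a b = topology_generated_by
     {{g \<in> Linf a b. Linf_dist a b f g < ereal e} | f e. f \<in> Linf a b \<and> e > 0}"

definition Omega :: "real \<Rightarrow> real \<Rightarrow> ('d::finite) coef set" where
  "Omega a b = {(P, Q, W).
      P \<in> Linf a b \<and> Q \<in> Linf a b \<and> W \<in> Linf a b \<and>
      (AE t in lebesgue_on {a..b}. transpose (P t) = P t \<and> transpose (Q t) = Q t \<and>
                                    transpose (W t) = W t) \<and>
      (\<exists>\<mu>1>0. AE t in lebesgue_on {a..b}. \<forall>x::real^'d. \<mu>1 * (x \<bullet> x) \<le> x \<bullet> (P t *v x)) \<and>
      (\<exists>\<mu>2>0. AE t in lebesgue_on {a..b}. \<forall>x::real^'d. \<mu>2 * (x \<bullet> x) \<le> x \<bullet> (W t *v x))}"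

definition Omega_top :: "real \<Rightarrow> real \<Rightarrow> ('d::finite) coef topology" where
  "Omega_top a b = subtopology (prod_topology (Linf_top a b) (prod_topology (Linf_top a b) (Linf_top a b)))
                               (Omega a b)"

definition adjm :: "complex^('n::finite)^('m::finite) \<Rightarrow> complex^'m^'n" where
  "adjm M = (\<chi> i j. cnj (M $ j $ i))"

definition concat_mat :: "('d::finite) cmat2 \<Rightarrow> 'd cmat2 \<Rightarrow> complex^(('d + 'd) + ('d + 'd))^('d + 'd)" where
  "concat_mat A B = (\<chi> i j. case j of Inl j' \<Rightarrow> A $ i $ j' | Inr j' \<Rightarrow> B $ i $ j')"

definition BC_adm :: "('d::finite) bcmat set" where
  "BC_adm = {(A, B). rank (concat_mat A B) = 2 * CARD('d) \<and> A ** adjm B = B ** adjm A}"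

definition BC_rel :: "('d::finite) bcmat rel" where
  "BC_rel = {((A, B), (A', B')). (A, B) \<in> BC_adm \<and> (A', B') \<in> BC_adm \<and>
               (\<exists>T :: 'd cmat2. invertible T \<and> A' = T ** A \<and> B' = T ** B)}"

definition BC_space :: "('d::finite) bcclass set" where
  "BC_space = BC_adm // BC_rel"

definition BC_top :: "('d::finite) bcclass topology" where
  "BC_top = topology (\<lambda>U. U \<subseteq> BC_space \<and> openin (subtopology euclidean BC_adm) (\<Union>U))"

definition n0 :: "('d::finite) cmat2 \<Rightarrow> nat" where
  "n0 B = vec.dim {x :: complex^('d + 'd). B *v x = 0}"

definition Sigma_layer :: "nat \<Rightarrow> ('d::finite) bcclass set" where
  "Sigma_layer k = {c \<in> BC_space. \<exists>A B. (A, B) \<in> c \<and> n0 B = k}"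

definition abs_cont_on :: "real \<Rightarrow> real \<Rightarrow> (real \<Rightarrow> 'a::real_normed_vector) \<Rightarrow> bool" where
  "abs_cont_on a b f \<longleftrightarrow> (\<forall>\<epsilon>>0. \<exists>\<delta>>0. \<forall>D. finite D \<longrightarrow>
      (\<forall>(s,t)\<in>D. a \<le> s \<and> s \<le> t \<and> t \<le> b) \<longrightarrow>
      (\<forall>(s,t)\<in>D. \<forall>(s',t')\<in>D. (s,t) \<noteq> (s',t') \<longrightarrow> t \<le> s' \<or> t' \<le> s) \<longrightarrow>
      (\<Sum>(s,t)\<in>D. t - s) < \<delta> \<longrightarrow> (\<Sum>(s,t)\<in>D. norm (f t - f s)) < \<epsilon>)"

definition cm :: "real^('n::finite)^('m::finite) \<Rightarrow> complex^'n^'m" where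
  "cm M = (\<chi> i j. complex_of_real (M $ i $ j))"

definition bvec :: "('d::finite) cvec \<Rightarrow> 'd cvec \<Rightarrow> complex^('d + 'd)" where
  "bvec x y = (\<chi> i. case i of Inl j \<Rightarrow> x $ j | Inr j \<Rightarrow> y $ j)"

text \<open>y solves -(P y')' + Q y = lambda W y on [a,b] together with the boundary condition
  (A|B)(-y(a), y(b), (Py')(a), (Py')(b)) = 0; u is the (absolutely continuous) quasi-derivative P y'.\<close>
definition is_solution :: "real \<Rightarrow> real \<Rightarrow> ('d::finite) coef \<Rightarrow> ('d::finite) bcclass \<Rightarrow> real \<Rightarrow> (real \<Rightarrow> 'd cvec) \<Rightarrow> bool" where
  "is_solution a b \<omega> c lam y \<longleftrightarrow> (case \<omega> of (P, Q, W) \<Rightarrow>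
     (\<exists>u. abs_cont_on a b y \<and> abs_cont_on a b u \<and>
        (AE t in lebesgue_on {a..b}. \<exists>y' u'.
            (y has_vector_derivative y') (at t) \<and> u t = cm (P t) *v y' \<and>
            (u has_vector_derivative u') (at t) \<and>
            - u' + cm (Q t) *v y t = of_real lam *s (cm (W t) *v y t)) \<and>
        (\<exists>A B. (A, B) \<in> c \<and>
            A *v bvec (- y a) (y b) + B *v bvec (u a) (u b) = 0)))"

definition lin_indep_on :: "real \<Rightarrow> real \<Rightarrow> (real \<Rightarrow> ('d::finite) cvec) set \<Rightarrow> bool" where
  "lin_indep_on a b S \<longleftrightarrow> (\<forall>cf :: (real \<Rightarrow> 'd cvec) \<Rightarrow> complex.
      (\<forall>t\<in>{a..b}. (\<Sum>y\<in>S. cf y *s y t) = 0) \<longrightarrow> (\<forall>y\<in>S. cf y = 0))"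

text \<open>Multiplicity of lambda: dimension of the eigenspace (maximal number of linearly
  independent eigenfunctions on [a,b]); lambda is an eigenvalue iff this is positive.\<close>
definition multiplicity_ev :: "real \<Rightarrow> real \<Rightarrow> ('d::finite) coef \<Rightarrow> ('d::finite) bcclass \<Rightarrow> real \<Rightarrow> nat" where
  "multiplicity_ev a b \<omega> c lam = Sup {card S | S. finite S \<and> lin_indep_on a b S \<and>
                                      (\<forall>y\<in>S. is_solution a b \<omega> c lam y)}"

definition count_ev :: "real \<Rightarrow> real \<Rightarrow> ('d::finite) coef \<Rightarrow> ('d::finite) bcclass \<Rightarrow> real \<Rightarrow> nat" where
  "count_ev a b \<omega> c lam = (\<Sum>\<mu>\<in>{\<mu>. \<mu> \<le> lam \<and> multiplicity_ev a b \<omega> c \<mu> > 0}. multiplicity_ev a b \<omega> c \<mu>)"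

text \<open>n-th eigenvalue (n >= 1), eigenvalues listed nondecreasingly with multiplicity.\<close>
definition eig_n :: "real \<Rightarrow> real \<Rightarrow> nat \<Rightarrow> ('d::finite) coef \<Rightarrow> ('d::finite) bcclass \<Rightarrow> real" where
  "eig_n a b n \<omega> c = Inf {lam. n \<le> count_ev a b \<omega> c lam}"

end

theory Submission
  imports Defs "HOL-Library.Function_Algebras" "HOL-Complex_Analysis.Great_Picard"
    "HOL-Computational_Algebra.Polynomial"
begin

text \<open>A boundary condition \<open>A Y + B U = 0\<close> on \<open>Y = (-y(a), y(b))\<close> and \<open>U = ((Py')(a), (Py')(b))\<close>
  is equivalent to \<open>Y\<close> lying in the range of \<open>B*\<close> together with \<open>U\<close> being determined on that range by a
  symmetric form \<open>\<beta>\<close>. Hence the eigenvalue problem is that of the form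
  \<open>q(y) = \<integral> (P y' \<cdot> y' + Q y \<cdot> y) + \<beta>(Y, Y)\<close> relative to \<open>w(y) = \<integral> W y \<cdot> y\<close>, and at least \<open>n\<close> eigenvalues
  are \<open>\<le> \<lambda>\<close> iff \<open>q \<le> \<lambda> w\<close> on some \<open>n\<close>-dimensional space of admissible functions. On a layer the
  dimension of the range of \<open>B*\<close> is constant, so this range and \<open>\<beta>\<close> depend continuously on \<open>(A, B)\<close>;
  adding a small affine function to each element moves a test space for one problem to a test space for
  a nearby one, at the cost of a small increase of \<open>\<lambda>\<close>, in both directions.

  Lipschitz functions serve as form domain instead of a Sobolev space. Completeness is replaced by
  compactness of sublevel sets in the uniform norm and by regularity of weak solutions.\<close>

section \<open>Pairs of Hermitian forms\<close>

text \<open>\<open>eig_n\<close> is the infimum of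
  \<open>{lam. n \<le> count_ev a b \<omega> c lam}\<close>, so only the inequality
  \<open>n \<le> count_ev\<close> has to survive a perturbation; convergence of single eigenvalues
  or eigenfunctions is never discussed. The fixed problem is once the source and once the target of
  the comparison, so the loss in \<open>lam\<close> must be uniform over a neighbourhood. Hence all
  constants (\<open>cL\<close>, \<open>c1\<close>, \<open>c2\<close>, \<open>K3\<close>) are
  functions of \<open>a\<close>, \<open>b\<close>, \<open>\<mu>\<close>, \<open>C\<close>, and
  \<open>\<mu>\<close>, \<open>C\<close> are fixed before the nearby problem is chosen.

  Lipschitz functions suffice as form domain because an eigenfunction satisfies
  \<open>y' = P^{-1} u\<close> with \<open>u\<close> continuous and \<open>P^{-1}\<close>
  essentially bounded.

  The obstacle behind the restriction to one layer: where the rank of \<open>B\<close> drops in the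
  limit, the inverse of \<open>B*\<close> on its range is no longer uniformly bounded, and then
  neither \<open>\<beta>\<close> nor the map between the ranges is under control. With the rank
  fixed, one complement of the kernel of \<open>B0*\<close> parametrizes the ranges of all nearby
  \<open>B*\<close>.\<close>

context vector_space begin

text \<open>One linear condition costs at most one dimension: a basis \<open>B'\<close> of the
  kernel in \<open>span B\<close>, enlarged by a single vector on which \<open>\<phi>\<close> does
  not vanish, spans \<open>B\<close>. Linearity is assumed on \<open>D\<close> only, since the forms
  are linear only there.\<close>

lemma independent_in_kernel:
  fixes \<phi> :: "'b \<Rightarrow> 'a"
  assumes D: "subspace D" "B \<subseteq> D" and B: "independent B" "finite B" "card B > m"
    and add: "\<And>x y. x \<in> D \<Longrightarrow> y \<in> D \<Longrightarrow> \<phi> (x + y) = \<phi> x + \<phi> y"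
    and sc: "\<And>c x. x \<in> D \<Longrightarrow> \<phi> (scale c x) = c * \<phi> x"
  obtains B' where "B' \<subseteq> span B" "independent B'" "finite B'" "card B' \<ge> m" "\<And>x. x \<in> B' \<Longrightarrow> \<phi> x = 0"
proof -
  let ?V = "{x \<in> span B. \<phi> x = 0}"
  obtain B' where B': "B' \<subseteq> ?V" "independent B'" "?V \<subseteq> span B'"
    using maximal_independent_subset by blast
  have fin: "finite B'" "card B' \<le> card B"
    using independent_span_bound[OF B(2) B'(2)] B'(1) by auto
  have "\<exists>v. B \<subseteq> span (insert v B')"
  proof (cases "\<forall>b\<in>B. \<phi> b = 0")
    case True
    then have "B \<subseteq> ?V" by (auto intro: span_base)
    then have "B \<subseteq> span (insert 0 B')" using B'(3) by (simp add: span_insert_0)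
    then show ?thesis by blast
  next
    case False
    then obtain v where v: "v \<in> B" "\<phi> v \<noteq> 0" by blast
    have "b \<in> span (insert v B')" if b: "b \<in> B" for b
    proof -
      let ?c = "\<phi> b / \<phi> v"
      have "v \<in> D" "b \<in> D" using v b D by auto
      then have "\<phi> (b + scale (- ?c) v) = \<phi> b + (- ?c) * \<phi> v"
        using add[OF _ subspace_scale[OF D(1)]] sc by presburger
      then have "\<phi> (b + scale (- ?c) v) = 0" using v by simp
      moreover have "b + scale (- ?c) v \<in> span B"
        using b v by (intro span_add span_scale span_base) auto
      ultimately have "b + scale (- ?c) v \<in> span B'" using B' by auto
      then have "b + scale (- ?c) v \<in> span (insert v B')" using span_mono[of B' "insert v B'"] by auto
      moreover have "scale ?c v \<in> span (insert v B')" by (intro span_scale span_base) auto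
      ultimately have "(b + scale (- ?c) v) + scale ?c v \<in> span (insert v B')" by (rule span_add)
      then show ?thesis by (simp add: scale_minus_left)
    qed
    then show ?thesis by blast
  qed
  then obtain v where "B \<subseteq> span (insert v B')" by blast
  then have "card B \<le> card (insert v B')"
    using independent_span_bound[of "insert v B'" B] fin B by auto
  also have "\<dots> \<le> Suc (card B')" by (rule card_insert_le_m1) auto
  finally have "card B' \<ge> m" using B by simp
  then show thesis using that B' fin by auto
qed

text \<open>The conditions are imposed one at a time and each removes at most one dimension, so
  fewer conditions than vectors leave a nonzero solution. \<open>B\<close> is arbitrary in the
  induction because it is replaced by a basis of a kernel.\<close>

lemma common_kernel_nonzero:
  fixes \<phi> :: "'i \<Rightarrow> 'b \<Rightarrow> 'a"
  assumes F: "finite F" and D: "subspace D"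
    and add: "\<And>i x y. i \<in> F \<Longrightarrow> x \<in> D \<Longrightarrow> y \<in> D \<Longrightarrow> \<phi> i (x + y) = \<phi> i x + \<phi> i y"
    and sc: "\<And>i c x. i \<in> F \<Longrightarrow> x \<in> D \<Longrightarrow> \<phi> i (scale c x) = c * \<phi> i x"
    and B: "B \<subseteq> D" "independent B" "finite B" "card B > card F"
  shows "\<exists>x\<in>span B. x \<noteq> 0 \<and> (\<forall>i\<in>F. \<phi> i x = 0)"
  using F add sc B
proof (induction F arbitrary: B rule: finite_induct)
  case empty
  then obtain b where b: "b \<in> B" by (metis all_not_in_conv card.empty less_irrefl)
  then have "b \<noteq> 0" using empty.prems dependent_zero by auto
  then show ?case using b span_base by auto
next
  case (insert i F)
  obtain B' where B': "B' \<subseteq> span B" "independent B'" "finite B'" "card B' \<ge> Suc (card F)"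
      "\<And>x. x \<in> B' \<Longrightarrow> \<phi> i x = 0"
    using independent_in_kernel[OF D insert.prems(3) insert.prems(4,5), of "Suc (card F)" "\<phi> i"]
      insert.prems insert.hyps by auto
  have sB: "span B \<subseteq> D" using insert.prems(3) D by (rule span_minimal)
  have "\<exists>x\<in>span B'. x \<noteq> 0 \<and> (\<forall>i\<in>F. \<phi> i x = 0)"
  proof (rule insert.IH)
    show "B' \<subseteq> D" using B' sB by auto
  qed (use B' insert.prems in auto)
  then obtain x where x: "x \<in> span B'" "x \<noteq> 0" "\<forall>i\<in>F. \<phi> i x = 0" by blast
  \<comment> \<open>Membership in \<open>D\<close> is carried through the span induction, because
    \<open>\<phi> i\<close> is linear only there.\<close>
  have "\<phi> i x = 0 \<and> x \<in> D" using x(1)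
  proof (induction rule: span_induct_alt)
    case base
    have "\<phi> i (scale 0 0) = 0" using insert.prems(2)[of i 0 0] subspace_0[OF D] by auto
    then show ?case using subspace_0[OF D] by simp
  next
    case (step c x y)
    have "x \<in> D" using step B' sB by auto
    then show ?case using step B' insert.prems(1)[of i "scale c x" y] insert.prems(2)[of i x c]
        subspace_scale[OF D] subspace_add[OF D] by auto
  qed
  moreover have "x \<in> span B" using x(1) B'(1) span_minimal subspace_span by blast
  ultimately show ?case using x by auto
qed

end

text \<open>\<open>g\<close> is the real part of a Hermitian form, which is recovered as \<open>g x y + \<i> g x (\<i> y)\<close>.\<close>
locale hform = vector_space sc
  for sc :: "complex \<Rightarrow> 'v::ab_group_add \<Rightarrow> 'v" +
  fixes D :: "'v set" and g :: "'v \<Rightarrow> 'v \<Rightarrow> real"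
  assumes subspace_D: "subspace D"
    and sym: "x \<in> D \<Longrightarrow> y \<in> D \<Longrightarrow> g x y = g y x"
    and add_left: "x \<in> D \<Longrightarrow> y \<in> D \<Longrightarrow> z \<in> D \<Longrightarrow> g (x + y) z = g x z + g y z"
    and scale_left: "x \<in> D \<Longrightarrow> y \<in> D \<Longrightarrow> g (sc (of_real r) x) y = r * g x y"
    and rotate: "x \<in> D \<Longrightarrow> y \<in> D \<Longrightarrow> g (sc \<i> x) (sc \<i> y) = g x y"
begin

lemma D_simps [simp]: "0 \<in> D" "x \<in> D \<Longrightarrow> sc c x \<in> D" "x \<in> D \<Longrightarrow> y \<in> D \<Longrightarrow> x + y \<in> D"
  "x \<in> D \<Longrightarrow> y \<in> D \<Longrightarrow> x - y \<in> D" "x \<in> D \<Longrightarrow> - x \<in> D"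
  using subspace_D by (auto intro: subspace_0 subspace_scale subspace_add subspace_diff subspace_neg)

lemma add_right: "x \<in> D \<Longrightarrow> y \<in> D \<Longrightarrow> z \<in> D \<Longrightarrow> g z (x + y) = g z x + g z y"
  using add_left sym by (metis D_simps(3))

lemma scale_right: "x \<in> D \<Longrightarrow> y \<in> D \<Longrightarrow> g x (sc (of_real r) y) = r * g x y"
  using scale_left sym by (metis D_simps(2))

lemma zero [simp]: "x \<in> D \<Longrightarrow> g 0 x = 0" "x \<in> D \<Longrightarrow> g x 0 = 0"
  using scale_left[of x x 0] scale_right[of x x 0] by auto

lemma minus_left: "x \<in> D \<Longrightarrow> y \<in> D \<Longrightarrow> g (- x) y = - g x y"
  using scale_left[of x y "-1"] by simp

lemma minus_right: "x \<in> D \<Longrightarrow> y \<in> D \<Longrightarrow> g x (- y) = - g x y"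
  using scale_right[of x y "-1"] by simp

lemma diff_left: "x \<in> D \<Longrightarrow> y \<in> D \<Longrightarrow> z \<in> D \<Longrightarrow> g (x - y) z = g x z - g y z"
  using add_left[of x "- y" z] minus_left[of y z] by simp

lemma diff_right: "x \<in> D \<Longrightarrow> y \<in> D \<Longrightarrow> z \<in> D \<Longrightarrow> g z (x - y) = g z x - g z y"
  using add_right[of x "- y" z] minus_right[of z y] by simp

lemma rotate_left: "x \<in> D \<Longrightarrow> y \<in> D \<Longrightarrow> g (sc \<i> x) y = - g x (sc \<i> y)"
  using rotate[of "sc \<i> x" y] minus_left[of x "sc \<i> y"] by simp

lemma scale_split: "sc c x = sc (of_real (Re c)) x + sc (of_real (Im c)) (sc \<i> x)"
  by (metis complex_eq mult.commute scale_left_distrib scale_scale)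

lemma cscale_left:
  "x \<in> D \<Longrightarrow> y \<in> D \<Longrightarrow> g (sc c x) y = Re c * g x y + Im c * g (sc \<i> x) y"
  by (subst scale_split) (simp add: add_left scale_left del: scale_scale)

lemma cscale_right:
  "x \<in> D \<Longrightarrow> y \<in> D \<Longrightarrow> g x (sc c y) = Re c * g x y + Im c * g x (sc \<i> y)"
  by (subst scale_split) (simp add: add_right scale_right del: scale_scale)

lemma rotate_self:
  assumes "x \<in> D" shows "g (sc \<i> x) x = 0" "g x (sc \<i> x) = 0"
proof -
  have "g (sc \<i> x) x = - g x (sc \<i> x)" using rotate_left assms by blast
  moreover have "g x (sc \<i> x) = g (sc \<i> x) x" using sym[OF assms, of "sc \<i> x"] assms by simp
  ultimately show "g (sc \<i> x) x = 0" "g x (sc \<i> x) = 0" by linarith+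
qed

lemma cscale_self:
  assumes "x \<in> D" shows "g (sc c x) (sc c x) = (cmod c)\<^sup>2 * g x x"
proof -
  have "sc c x \<in> D" "sc \<i> x \<in> D" using assms by auto
  then have "g (sc c x) (sc c x) = Re c * g x (sc c x) + Im c * g (sc \<i> x) (sc c x)"
    using cscale_left[OF assms] by blast
  also have "g x (sc c x) = Re c * g x x"
    using cscale_right[OF assms assms] rotate_self[OF assms] by simp
  also have "g (sc \<i> x) (sc c x) = Im c * g x x"
    using cscale_right[OF \<open>sc \<i> x \<in> D\<close> assms] rotate_self[OF assms] rotate[OF assms assms] by simp
  finally have "g (sc c x) (sc c x) = ((Re c)\<^sup>2 + (Im c)\<^sup>2) * g x x"
    by (simp add: algebra_simps power2_eq_square)
  then show ?thesis by (simp add: cmod_power2)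
qed

lemma add_self:
  assumes "x \<in> D" "y \<in> D" shows "g (x + y) (x + y) = g x x + 2 * g x y + g y y"
proof -
  have "g y x = g x y" using sym[OF assms] by simp
  then show ?thesis using assms by (simp add: add_left add_right)
qed

lemma orthogonal_span:
  assumes "x \<in> D" "T \<subseteq> D" "\<And>t. t \<in> T \<Longrightarrow> g x t = 0" "\<And>t. t \<in> T \<Longrightarrow> g x (sc \<i> t) = 0" "y \<in> span T"
  shows "g x y = 0"
proof -
  have "g x y = 0 \<and> y \<in> D" using assms(5)
  proof (induction rule: span_induct_alt)
    case base then show ?case using assms by simp
  next
    case (step c t y)
    then have "t \<in> D" using assms by auto
    then show ?case using step assms by (simp add: add_right cscale_right[of x t c] del: scale_scale)
  qed
  then show ?thesis ..
qed

text \<open>Discriminant of the quadratic \<open>g (x + r y) (x + r y)\<close> in \<open>r\<close>.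
  Nonnegativity is asked along this real line only, so that the inequality applies to
  \<open>q - \<rho> w\<close>, which is known to be nonnegative merely on an orthogonal
  complement.\<close>

lemma Cauchy_Schwarz:
  assumes "x \<in> D" "y \<in> D" and pos: "\<And>r. g (x + sc (of_real r) y) (x + sc (of_real r) y) \<ge> 0"
    and y: "g y y \<ge> 0"
  shows "(g x y)\<^sup>2 \<le> g x x * g y y"
proof -
  have *: "g x x + 2 * r * g x y + r\<^sup>2 * g y y \<ge> 0" for r
    using pos[of r] assms by (simp add: add_self scale_left scale_right power2_eq_square algebra_simps)
  show ?thesis
  proof (cases "g y y = 0")
    case True
    have "g x y = 0"
    proof (rule ccontr)
      assume n: "g x y \<noteq> 0"
      \<comment> \<open>Here the quadratic is linear in \<open>r\<close>, and this \<open>r\<close>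
        gives it the value \<open>- 1\<close>.\<close>
      then show False using *[of "- (g x x + 1) / (2 * g x y)"] True by (simp add: field_simps)
    qed
    then show ?thesis using True by simp
  next
    case False
    then have p: "g y y > 0" using y by simp
    have "g x x - (g x y)\<^sup>2 / g y y \<ge> 0"
      using *[of "- g x y / g y y"] p by (simp add: field_simps power2_eq_square)
    then show ?thesis using p by (simp add: field_simps)
  qed
qed

text \<open>Orthogonality to the complex span of \<open>F\<close> amounts to \<open>card F\<close>
  complex-linear conditions: for each \<open>f\<close> the Hermitian product with \<open>f\<close>
  vanishes, whose real and imaginary parts are \<open>g x f\<close> and
  \<open>g x (sc \<i> f)\<close>.\<close>

lemma orthogonal_vector_in_span:
  assumes "finite F" "F \<subseteq> D" "B \<subseteq> D" "independent B" "finite B" "card B > card F"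
  obtains x where "x \<in> span B" "x \<in> D" "x \<noteq> 0" "\<And>t. t \<in> span F \<Longrightarrow> g x t = 0"
proof -
  let ?\<phi> = "\<lambda>f x. Complex (g x f) (g x (sc \<i> f))"
  have "\<exists>x\<in>span B. x \<noteq> 0 \<and> (\<forall>f\<in>F. ?\<phi> f x = 0)"
  proof (rule common_kernel_nonzero[OF assms(1) subspace_D _ _ assms(3-6)])
    fix f x y assume "f \<in> F" "x \<in> D" "y \<in> D"
    then show "?\<phi> f (x + y) = ?\<phi> f x + ?\<phi> f y"
      using assms(2) by (auto simp: complex_eq_iff add_left subsetD)
  next
    fix f c x assume "f \<in> F" "x \<in> D"
    then have "f \<in> D" "x \<in> D" using assms by auto
    then show "?\<phi> f (sc c x) = c * ?\<phi> f x"
      using cscale_left[of x f c] cscale_left[of x "sc \<i> f" c] rotate[of x f] rotate_left[of x f]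
      by (simp add: complex_eq_iff)
  qed
  then obtain x where x: "x \<in> span B" "x \<noteq> 0" "\<forall>f\<in>F. ?\<phi> f x = 0" by blast
  have xD: "x \<in> D" using x(1) span_minimal[OF assms(3) subspace_D] by auto
  have "g x t = 0" if "t \<in> span F" for t
    by (rule orthogonal_span[OF xD assms(2) _ _ that]) (use x in \<open>auto simp: complex_eq_iff\<close>)
  then show thesis using that x xD by blast
qed

text \<open>Gram-Schmidt by induction on \<open>B\<close>: the new vector \<open>b\<close> is first
  made orthogonal to \<open>span B\<close>, then a single complex multiple of it corrects the
  projection of \<open>z\<close>.\<close>

lemma projection:
  assumes pos: "\<And>x. x \<in> D \<Longrightarrow> x \<noteq> 0 \<Longrightarrow> g x x > 0"
    and "finite B" "B \<subseteq> D" "z \<in> D"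
  obtains s where "s \<in> span B" "\<And>t. t \<in> span B \<Longrightarrow> g (z - s) t = 0"
proof -
  have "\<forall>z\<in>D. \<exists>s\<in>span B. \<forall>t\<in>span B. g (z - s) t = 0"
    using assms(2,3)
  proof (induction B rule: finite_induct)
    case empty
    then show ?case by auto
  next
    case (insert b B)
    then have BD: "B \<subseteq> D" "b \<in> D" by auto
    have sB: "span B \<subseteq> D" using BD subspace_D span_minimal by blast
    obtain p where p: "p \<in> span B" "\<forall>t\<in>span B. g (b - p) t = 0" using insert BD by blast
    define b' where "b' = b - p"
    have b'D: "b' \<in> D" using BD p sB unfolding b'_def by auto
    have b'0: "\<forall>t\<in>span B. g b' t = 0" using p b'_def by auto
    have B_ins: "span B \<subseteq> span (insert b B)" by (intro span_mono) auto
    have b'_ins: "b' \<in> span (insert b B)"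
      unfolding b'_def using p B_ins by (intro span_diff) (auto intro: span_base)
    show ?case
    proof
      fix z assume z: "z \<in> D"
      obtain s where s: "s \<in> span B" "\<forall>t\<in>span B. g (z - s) t = 0" using insert BD z by blast
      define z' where "z' = z - s"
      have z'D: "z' \<in> D" using z s sB unfolding z'_def by auto
      \<comment> \<open>\<open>B\<close> may be dependent, so \<open>b'\<close> may vanish; the
        coefficient is then \<open>0\<close>.\<close>
      define c where "c = (if b' = 0 then 0 else
          Complex (g z' b' / g b' b') (g z' (sc \<i> b') / g b' b'))"
      have nz: "g b' b' \<noteq> 0" if "b' \<noteq> 0" using pos[OF b'D that] by simp
      have cb: "sc c b' \<in> D" and ib: "sc \<i> b' \<in> D" using b'D by auto
      have e1: "g (z' - sc c b') b' = 0"
      proof -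
        have "g (z' - sc c b') b' = g z' b' - Re c * g b' b'"
          using diff_left[OF z'D cb b'D] cscale_left[OF b'D b'D, of c] rotate_self[OF b'D] by simp
        also have "\<dots> = 0" using nz z'D by (cases "b' = 0") (auto simp: c_def)
        finally show ?thesis .
      qed
      have e2: "g (z' - sc c b') (sc \<i> b') = 0"
      proof -
        have "g (z' - sc c b') (sc \<i> b') = g z' (sc \<i> b') - Im c * g b' b'"
          using diff_left[OF z'D cb ib] cscale_left[OF b'D ib, of c] rotate[OF b'D b'D]
            rotate_self[OF b'D] by simp
        also have "\<dots> = 0" using nz z'D by (cases "b' = 0") (auto simp: c_def)
        finally show ?thesis .
      qed
      have e3: "g (z' - sc c b') t = 0" if "t \<in> span B" for t
      proof -
        have tD: "t \<in> D" "sc \<i> t \<in> span B" using that sB by (auto intro: span_scale)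
        have "g (sc \<i> b') t = 0" using rotate_left[OF b'D tD(1)] b'0 tD by auto
        moreover have "g b' t = 0" "g z' t = 0" using that s b'0 by (auto simp: z'_def)
        ultimately show ?thesis
          using diff_left[OF z'D cb tD(1)] cscale_left[OF b'D tD(1), of c] by simp
      qed
      have dD: "z' - sc c b' \<in> D" using z'D b'D by auto
      have "g (z' - sc c b') t = 0" if t: "t \<in> span (insert b B)" for t
      proof (rule orthogonal_span[OF dD _ _ _ t])
        show "insert b B \<subseteq> D" using BD by auto
        have b: "b = b' + p" by (simp add: b'_def)
        show "g (z' - sc c b') t = 0" if "t \<in> insert b B" for t
        proof (cases "t = b")
          case True
          have "p \<in> D" using p sB by auto
          then show ?thesis using add_right[OF b'D _ dD, of p] e1 e3[OF p(1)] b True by simp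
        next
          case False
          then show ?thesis using that e3 span_base by auto
        qed
        show "g (z' - sc c b') (sc \<i> t) = 0" if "t \<in> insert b B" for t
        proof (cases "t = b")
          case True
          have "sc \<i> p \<in> span B" using p by (intro span_scale)
          moreover have "sc \<i> p \<in> D" using p sB by auto
          moreover have "sc \<i> t = sc \<i> b' + sc \<i> p"
            unfolding True by (subst b) (rule scale_right_distrib)
          ultimately show ?thesis using add_right[OF ib _ dD, of "sc \<i> p"] e2 e3[of "sc \<i> p"]
            by simp
        next
          case False
          then show ?thesis using that e3 span_base span_scale by auto
        qed
      qed
      moreover have "s + sc c b' \<in> span (insert b B)"
        using s B_ins b'_ins by (intro span_add span_scale) auto
      moreover have "z - (s + sc c b') = z' - sc c b'" by (simp add: z'_def)
      ultimately show "\<exists>s\<in>span (insert b B). \<forall>t\<in>span (insert b B). g (z - s) t = 0"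
        by metis
    qed
  qed
  then show thesis using that assms(4) by blast
qed

end

section \<open>Eigenvalue counting by spaces on which \<open>q \<le> lam w\<close>\<close>

context vector_space begin

lemma independent_Un:
  assumes "finite B" "independent A" "independent B" "span A \<inter> span B \<subseteq> {0}"
  shows "independent (A \<union> B)"
  using assms
proof (induction B rule: finite_induct)
  case empty
  then show ?case by simp
next
  case (insert b B)
  have sub: "span B \<subseteq> span (insert b B)" by (intro span_mono) auto
  have "independent (A \<union> B)"
    using insert sub independent_mono[of "insert b B" B] by blast
  moreover have "b \<notin> span (A \<union> B)"
  proof
    assume "b \<in> span (A \<union> B)"
    then obtain x y where xy: "x \<in> span A" "y \<in> span B" "b = x + y"
      unfolding span_Un by blast
    have "b - y \<in> span (insert b B)"
      using sub xy(2) span_diff[OF span_base[of b "insert b B"], of y] by blast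
    moreover have "b - y \<in> span A" using xy by simp
    ultimately have "b - y = 0" using insert.prems(3) by blast
    then have "b = y" by simp
    then show False using xy insert.prems(2) insert.hyps independent_insert by auto
  qed
  ultimately show ?case using independent_insertI by simp
qed

end

text \<open>The assumption \<open>attainment\<close> stands in for completeness of the form domain: minimizing sequences
  of \<open>q\<close> relative to \<open>w\<close> produce an eigenvector in \<open>D\<close> even though \<open>D\<close> is not complete.\<close>
locale form_pair = vector_space sc + Q: hform sc D q + W: hform sc D w
  for sc :: "complex \<Rightarrow> 'v::ab_group_add \<Rightarrow> 'v" and D q w +
  fixes C0 :: real
  assumes w_pos: "x \<in> D \<Longrightarrow> x \<noteq> 0 \<Longrightarrow> w x x > 0"
    and q_bound: "x \<in> D \<Longrightarrow> q x x \<ge> - C0 * w x x"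
    and compactness: "\<And>y C. (\<And>j. y j \<in> D) \<Longrightarrow> (\<And>j. w (y j) (y j) = 1) \<Longrightarrow> (\<And>j. q (y j) (y j) \<le> C) \<Longrightarrow>
      \<exists>r::nat \<Rightarrow> nat. strict_mono r \<and>
        (\<forall>e>0. \<exists>N. \<forall>i\<ge>N. \<forall>j\<ge>N. w (y (r i) - y (r j)) (y (r i) - y (r j)) < e)"
    and attainment: "\<And>y C \<rho>. (\<And>j::nat. y j \<in> D) \<Longrightarrow> (\<And>j. w (y j) (y j) = 1) \<Longrightarrow> (\<And>j. q (y j) (y j) \<le> C) \<Longrightarrow>
      (\<And>z. z \<in> D \<Longrightarrow> (\<lambda>j. q (y j) z - \<rho> * w (y j) z) \<longlonglongrightarrow> 0) \<Longrightarrow>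
      \<exists>k\<in>D. (\<forall>z\<in>D. q k z = \<rho> * w k z) \<and> \<not> (\<lambda>j. w (y j) k) \<longlonglongrightarrow> 0"
begin

text \<open>The radical of \<open>q - \<mu> w\<close>, that is, the weak form of the eigenvalue
  equation.\<close>

definition eigsp :: "real \<Rightarrow> 'v set" where
  "eigsp \<mu> = {x \<in> D. \<forall>z\<in>D. q x z = \<mu> * w x z}"

definition below :: "real \<Rightarrow> 'v set \<Rightarrow> bool" where
  "below lam B \<longleftrightarrow> B \<subseteq> D \<and> finite B \<and> independent B \<and> (\<forall>x\<in>span B. q x x \<le> lam * w x x)"

lemma w_nonneg: "x \<in> D \<Longrightarrow> w x x \<ge> 0"
  using w_pos[of x] by (cases "x = 0") auto

lemma hform_shift: "hform sc D (\<lambda>x y. q x y - lam * w x y)"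
proof unfold_locales
  show "q x y - lam * w x y = q y x - lam * w y x" if "x \<in> D" "y \<in> D" for x y
    using Q.sym[OF that] W.sym[OF that] by simp
qed (simp_all add: Q.subspace_D Q.add_left W.add_left Q.scale_left W.scale_left Q.rotate W.rotate algebra_simps)

lemma normalize:
  assumes "x \<in> D" "x \<noteq> 0"
  obtains r where "r > 0" "w (sc (of_real r) x) (sc (of_real r) x) = 1"
proof -
  have "w (sc (of_real r) x) (sc (of_real r) x) = r\<^sup>2 * w x x" for r
    using W.cscale_self[OF assms(1), of "of_real r"] by simp
  moreover have "w x x > 0" using w_pos assms by blast
  ultimately show thesis
    by (intro that[of "1 / sqrt (w x x)"]) (simp_all add: power_divide del: of_real_divide)
qed

text \<open>If the dimensions were unbounded, one could select an infinite
  \<open>w\<close>-orthonormal sequence with \<open>q \<le> lam\<close>. Its members have squared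
  mutual distance \<open>2\<close>, which contradicts \<open>compactness\<close>.\<close>

lemma below_card_bounded: "\<exists>M. \<forall>B. below lam B \<longrightarrow> card B \<le> M"
proof (rule ccontr)
  assume "\<not> ?thesis"
  then have ex: "\<exists>B. below lam B \<and> card B > M" for M by (meson not_le)
  define P where "P = (\<lambda>(f::nat\<Rightarrow>'v) n r. r \<in> D \<and> w r r = 1 \<and> q r r \<le> lam \<and> (\<forall>m<n. w r (f m) = 0))"
  have "\<exists>f. \<forall>n. P f n (f n)"
  proof (rule dependent_wellorder_choice)
    show "P f n r = P f' n r" if "\<And>m. m < n \<Longrightarrow> f m = f' m" for r f f' n
      using that unfolding P_def by auto
  next
    fix n f assume "\<And>m. m < n \<Longrightarrow> P f m (f m)"
    then have f: "f ` {..<n} \<subseteq> D" by (auto simp: P_def)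
    obtain B where B: "below lam B" "card B > n" using ex by blast
    then have cd: "card B > card (f ` {..<n})" using card_image_le[of "{..<n}" f] by simp
    obtain x where x: "x \<in> span B" "x \<in> D" "x \<noteq> 0" "\<And>t. t \<in> span (f ` {..<n}) \<Longrightarrow> w x t = 0"
      by (rule W.orthogonal_vector_in_span[OF _ f, of B]) (use B cd in \<open>simp_all add: below_def\<close>)
    obtain r where r: "r > 0" "w (sc (of_real r) x) (sc (of_real r) x) = 1"
      using normalize x by blast
    have "sc (of_real r) x \<in> span B" using x by (intro span_scale)
    then have "q (sc (of_real r) x) (sc (of_real r) x) \<le> lam * 1"
      using B r unfolding below_def by metis
    moreover have "w (sc (of_real r) x) (f m) = 0" if "m < n" for m
      using x(4)[of "f m"] W.scale_left[of x "f m" r] x f that span_base by auto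
    ultimately have "P f n (sc (of_real r) x)" using r x unfolding P_def by simp
    then show "\<exists>r. P f n r" by blast
  qed
  then obtain f where f: "\<And>n. P f n (f n)" by blast
  then have fD: "f j \<in> D" "w (f j) (f j) = 1" "q (f j) (f j) \<le> lam" for j by (auto simp: P_def)
  have orth: "w (f i) (f j) = 0" if "i \<noteq> j" for i j
    using f[of i] f[of j] that W.sym[OF fD(1) fD(1), of i j] unfolding P_def
    by (metis linorder_neqE_nat)
  obtain r :: "nat \<Rightarrow> nat" where r: "strict_mono r"
    "\<forall>e>0. \<exists>N. \<forall>i\<ge>N. \<forall>j\<ge>N. w (f (r i) - f (r j)) (f (r i) - f (r j)) < e"
    using compactness[of f lam, OF fD] by blast
  obtain N where N: "\<forall>i\<ge>N. \<forall>j\<ge>N. w (f (r i) - f (r j)) (f (r i) - f (r j)) < 1"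
    using r(2) by (meson zero_less_one)
  have "r N \<noteq> r (Suc N)" using r(1) by (metis n_not_Suc_n strict_mono_eq)
  then have "w (f (r N) - f (r (Suc N))) (f (r N) - f (r (Suc N))) = 2"
    using orth fD by (simp add: W.diff_left W.diff_right)
  then show False using N[rule_format, of N "Suc N"] by simp
qed

lemma eigsp_subset: "eigsp \<mu> \<subseteq> D" by (auto simp: eigsp_def)

lemma subspace_eigsp: "subspace (eigsp \<mu>)"
proof -
  have "sc c x \<in> eigsp \<mu>" if "x \<in> eigsp \<mu>" for c x
  proof -
    have x: "x \<in> D" "\<And>z. z \<in> D \<Longrightarrow> q x z = \<mu> * w x z" using that by (auto simp: eigsp_def)
    have "q (sc c x) z = \<mu> * w (sc c x) z" if z: "z \<in> D" for z
    proof -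
      have "q (sc \<i> x) z = \<mu> * w (sc \<i> x) z"
        using x(2)[of "sc \<i> z"] Q.rotate_left[OF x(1) z] W.rotate_left[OF x(1) z] z by simp
      then show ?thesis
        unfolding Q.cscale_left[OF x(1) z, of c] W.cscale_left[OF x(1) z, of c] x(2)[OF z]
        by (simp add: distrib_left mult.left_commute)
    qed
    then show ?thesis using x(1) by (auto simp: eigsp_def)
  qed
  then show ?thesis
    by (auto simp: subspace_def eigsp_def Q.add_left W.add_left algebra_simps)
qed

lemma eigsp_orthogonal:
  assumes "x \<in> eigsp \<mu>" "y \<in> eigsp \<nu>" "\<mu> \<noteq> \<nu>"
  shows "w x y = 0"
proof -
  have "x \<in> D" "y \<in> D" using assms eigsp_subset by auto
  then have "\<mu> * w x y = \<nu> * w x y"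
    using assms Q.sym[of x y] W.sym[of x y] by (auto simp: eigsp_def)
  then show ?thesis using assms(3) by simp
qed

text \<open>Finite dimension comes from \<open>below_card_bounded\<close>, as every finite
  independent set of eigenvectors for \<open>\<mu>\<close> satisfies
  \<open>below \<mu>\<close>.\<close>

lemma eigsp_basis:
  obtains B where "B \<subseteq> eigsp \<mu>" "finite B" "independent B" "span B = eigsp \<mu>" "card B = dim (eigsp \<mu>)"
proof -
  obtain B where B: "B \<subseteq> eigsp \<mu>" "independent B" "eigsp \<mu> \<subseteq> span B"
    using maximal_independent_subset by blast
  have sp: "span B = eigsp \<mu>"
    using B span_minimal[OF B(1) subspace_eigsp] by auto
  obtain M where M: "\<forall>B. below \<mu> B \<longrightarrow> card B \<le> M" using below_card_bounded by blast
  have "finite B"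
  proof (rule ccontr)
    assume "infinite B"
    then obtain B' where B': "B' \<subseteq> B" "finite B'" "card B' = Suc M" by (meson infinite_arbitrarily_large)
    have "span B' \<subseteq> eigsp \<mu>" using span_mono[OF B'(1)] sp by auto
    then have "below \<mu> B'"
      unfolding below_def using B' B independent_mono[OF B(2)] span_superset[of B']
      by (auto simp: eigsp_def subset_iff)
    then show False using M B' by auto
  qed
  moreover have "card B = dim (eigsp \<mu>)" using B by (metis basis_card_eq_dim)
  ultimately show thesis using that B sp by blast
qed

text \<open>For an eigenvector \<open>k\<close>, \<open>q k y = \<mu> * w k y\<close>, so
  \<open>w\<close>-orthogonality already implies \<open>q\<close>-orthogonality.\<close>

lemma orthogonal_eigenvectors:
  assumes "B \<subseteq> (\<Union>\<mu>\<in>F. eigsp \<mu>)" "y \<in> D" "\<And>\<mu> k. \<mu> \<in> F \<Longrightarrow> k \<in> eigsp \<mu> \<Longrightarrow> w y k = 0" "t \<in> span B"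
  shows "w y t = 0" "q y t = 0"
proof -
  have BD: "B \<subseteq> D" using assms(1) eigsp_subset by blast
  have 1: "w y k = 0 \<and> w y (sc \<i> k) = 0 \<and> q y k = 0 \<and> q y (sc \<i> k) = 0" if k: "k \<in> B" for k
  proof -
    obtain \<mu> where \<mu>: "\<mu> \<in> F" "k \<in> eigsp \<mu>" using assms(1) k by auto
    then have ik: "sc \<i> k \<in> eigsp \<mu>" using subspace_eigsp subspace_scale by blast
    have D: "k \<in> D" "sc \<i> k \<in> D" using k BD by auto
    show ?thesis using \<mu> ik assms(2,3) D Q.sym[OF assms(2) D(1)] Q.sym[OF assms(2) D(2)]
        W.sym[OF assms(2) D(1)] W.sym[OF assms(2) D(2)] by (auto simp: eigsp_def)
  qed
  show "w y t = 0" by (rule W.orthogonal_span[OF assms(2) BD _ _ assms(4)]) (use 1 in auto)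
  show "q y t = 0" by (rule Q.orthogonal_span[OF assms(2) BD _ _ assms(4)]) (use 1 in auto)
qed

text \<open>Eigenspaces for different values are orthogonal for both forms. So their bases can be
  united, and on the sum \<open>q\<close> splits without mixed terms into parts that are each at
  most \<open>lam * w\<close>.\<close>

lemma eigenvector_family:
  assumes "finite F" "\<And>\<mu>. \<mu> \<in> F \<Longrightarrow> \<mu> \<le> lam"
  shows "\<exists>B. below lam B \<and> B \<subseteq> (\<Union>\<mu>\<in>F. eigsp \<mu>) \<and> card B = (\<Sum>\<mu>\<in>F. dim (eigsp \<mu>)) \<and>
    (\<forall>\<mu>\<in>F. eigsp \<mu> \<subseteq> span B)"
  using assms
proof (induction F rule: finite_induct)
  case empty
  then show ?case by (intro exI[of _ "{}"]) (auto simp: below_def independent_empty)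
next
  case (insert \<nu> F)
  then obtain B where B: "below lam B" "B \<subseteq> (\<Union>\<mu>\<in>F. eigsp \<mu>)" "card B = (\<Sum>\<mu>\<in>F. dim (eigsp \<mu>))"
    "\<forall>\<mu>\<in>F. eigsp \<mu> \<subseteq> span B" by auto
  obtain A where A: "A \<subseteq> eigsp \<nu>" "finite A" "independent A" "span A = eigsp \<nu>" "card A = dim (eigsp \<nu>)"
    by (rule eigsp_basis)
  have BD: "B \<subseteq> D" "finite B" "independent B" "\<And>x. x \<in> span B \<Longrightarrow> q x x \<le> lam * w x x"
    using B by (auto simp: below_def)
  have sBD: "span B \<subseteq> D" using BD(1) Q.subspace_D span_minimal by blast
  have orth: "w k s = 0" "q k s = 0" if "k \<in> eigsp \<nu>" "s \<in> span B" for k s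
  proof -
    have k: "k \<in> D" using that eigsp_subset by auto
    have *: "w k k' = 0" if "\<mu> \<in> F" "k' \<in> eigsp \<mu>" for \<mu> k'
      using eigsp_orthogonal[OF \<open>k \<in> eigsp \<nu>\<close> that(2)] that(1) insert.hyps by auto
    show "w k s = 0" "q k s = 0" using orthogonal_eigenvectors[OF B(2) k * that(2)] by auto
  qed
  have int: "span B \<inter> span A \<subseteq> {0}"
  proof
    fix x assume x: "x \<in> span B \<inter> span A"
    then have "w x x = 0" using orth A by auto
    then show "x \<in> {0}" using w_pos[of x] x sBD by auto
  qed
  have ind: "independent (B \<union> A)"
    using independent_Un[OF A(2) BD(3) A(3) int] .
  have "B \<inter> A = {}"
  proof (rule ccontr)
    assume "B \<inter> A \<noteq> {}"
    then obtain x where "x \<in> B" "x \<in> A" by auto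
    then have "0 \<in> A" using int span_base by blast
    then show False using A(3) dependent_zero by auto
  qed
  then have card: "card (B \<union> A) = (\<Sum>\<mu>\<in>insert \<nu> F. dim (eigsp \<mu>))"
    using insert.hyps A B BD by (simp add: card_Un_disjoint)
  have neg: "q x x \<le> lam * w x x" if xin: "x \<in> span (B \<union> A)" for x
  proof -
    obtain s k where sk: "s \<in> span B" "k \<in> eigsp \<nu>" "x = s + k"
      using xin unfolding span_Un A(4) by auto
    have D: "s \<in> D" "k \<in> D" using sk sBD eigsp_subset by auto
    have 0: "w s k = 0" "q s k = 0" using orth[OF sk(2,1)] Q.sym[OF D] W.sym[OF D] by auto
    have "q k k = \<nu> * w k k" using sk D by (auto simp: eigsp_def)
    also have "\<dots> \<le> lam * w k k" using insert.prems[of \<nu>] w_nonneg[OF D(2)] by (intro mult_right_mono) auto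
    finally show ?thesis using BD(4)[OF sk(1)] unfolding sk(3) Q.add_self[OF D] W.add_self[OF D] 0
      by (simp add: distrib_left)
  qed
  have "below lam (B \<union> A)"
    unfolding below_def using BD A ind neg eigsp_subset[of \<nu>] by auto
  have "span B \<subseteq> span (B \<union> A)" "span A \<subseteq> span (B \<union> A)" by (intro span_mono; simp)+
  then have "\<forall>\<mu>\<in>insert \<nu> F. eigsp \<mu> \<subseteq> span (B \<union> A)" using A(4) B(4) by blast
  moreover have "B \<union> A \<subseteq> (\<Union>\<mu>\<in>insert \<nu> F. eigsp \<mu>)" using A(1) B(2) by blast
  ultimately show ?case
    using card \<open>below lam (B \<union> A)\<close> by blast
qed

text \<open>Otherwise the infimum \<open>\<rho>\<close> of the Rayleigh quotient on the orthogonal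
  complement \<open>E\<close> of \<open>span B0\<close> is at most \<open>lam\<close>. A minimizing
  sequence solves the eigenvalue equation asymptotically, so \<open>attainment\<close> yields an
  eigenvector \<open>k\<close> for \<open>\<rho>\<close> to which the sequence is not asymptotically
  orthogonal. But \<open>k\<close> lies in \<open>span B0\<close>, and every member of the sequence
  is orthogonal to that.\<close>

lemma orthogonal_complement_empty:
  assumes B0: "finite B0" "B0 \<subseteq> (\<Union>\<mu>\<in>F. eigsp \<mu>)" "F \<subseteq> {..lam}" "\<And>\<mu>. \<mu> \<le> lam \<Longrightarrow> eigsp \<mu> \<subseteq> span B0"
    and x: "x \<in> D" "x \<noteq> 0" "\<And>t. t \<in> span B0 \<Longrightarrow> w x t = 0"
  shows "q x x > lam * w x x"
proof (rule ccontr)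
  assume "\<not> ?thesis"
  then have neg: "q x x \<le> lam * w x x" by simp
  define E where "E = {y \<in> D. \<forall>t\<in>span B0. w y t = 0}"
  have B0D: "B0 \<subseteq> D" using B0 eigsp_subset by blast
  have sB0D: "span B0 \<subseteq> D" using B0D Q.subspace_D span_minimal by blast
  have E_add: "y + z \<in> E" if "y \<in> E" "z \<in> E" for y z
    using that sB0D by (auto simp: E_def W.add_left subset_iff)
  have E_sc: "sc (of_real r) y \<in> E" if "y \<in> E" for y r
    using that sB0D by (auto simp: E_def W.scale_left subset_iff)
  have ED: "E \<subseteq> D" by (auto simp: E_def)
  define R where "R = {q y y |y. y \<in> E \<and> w y y = 1}"
  define \<rho> where "\<rho> = Inf R"
  have bdd: "bdd_below R"
  proof (rule bdd_belowI)
    fix v assume "v \<in> R"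
    then show "- C0 \<le> v" using q_bound ED unfolding R_def by force
  qed
  obtain r where r: "r > 0" "w (sc (of_real r) x) (sc (of_real r) x) = 1" using normalize x by blast
  have xE: "sc (of_real r) x \<in> E" using x by (intro E_sc) (auto simp: E_def)
  have qx: "q (sc (of_real r) x) (sc (of_real r) x) = r\<^sup>2 * q x x"
    "w (sc (of_real r) x) (sc (of_real r) x) = r\<^sup>2 * w x x"
    using Q.cscale_self[OF x(1), of "of_real r"] W.cscale_self[OF x(1), of "of_real r"] by simp_all
  have Rx: "r\<^sup>2 * q x x \<in> R" using xE r qx unfolding R_def by force
  have "\<rho> \<le> r\<^sup>2 * q x x" unfolding \<rho>_def by (rule cInf_lower[OF Rx bdd])
  also have "\<dots> \<le> r\<^sup>2 * (lam * w x x)" using neg by (intro mult_left_mono) auto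
  also have "\<dots> = lam" using r qx by simp
  finally have \<rho>: "\<rho> \<le> lam" .
  have Epos: "q z z - \<rho> * w z z \<ge> 0" if z: "z \<in> E" for z
  proof (cases "z = 0")
    case False
    have zD: "z \<in> D" using z ED by auto
    obtain r where r: "r > 0" "w (sc (of_real r) z) (sc (of_real r) z) = 1" using normalize zD False by blast
    have "q (sc (of_real r) z) (sc (of_real r) z) \<in> R" using r E_sc[OF z] unfolding R_def by force
    then have "\<rho> \<le> q (sc (of_real r) z) (sc (of_real r) z)"
      unfolding \<rho>_def by (intro cInf_lower bdd)
    then have "\<rho> * w (sc (of_real r) z) (sc (of_real r) z) \<le> q (sc (of_real r) z) (sc (of_real r) z)"
      using r by simp
    then have "r\<^sup>2 * (q z z - \<rho> * w z z) \<ge> 0"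
      using Q.cscale_self[OF zD, of "of_real r"] W.cscale_self[OF zD, of "of_real r"]
      by (simp add: algebra_simps)
    then show ?thesis using r(1) by (simp add: zero_le_mult_iff)
  qed auto
  have "\<exists>y. y \<in> E \<and> w y y = 1 \<and> q y y < \<rho> + 1 / real (Suc j)" for j
  proof -
    have "Inf R < \<rho> + 1 / real (Suc j)" unfolding \<rho>_def by simp
    then obtain v where "v \<in> R" "v < \<rho> + 1 / real (Suc j)"
      using cInf_lessD[of R] Rx by blast
    then show ?thesis unfolding R_def by auto
  qed
  then obtain y where y: "\<And>j. y j \<in> E" "\<And>j. w (y j) (y j) = 1" "\<And>j. q (y j) (y j) < \<rho> + 1 / real (Suc j)"
    by metis
  have yD: "y j \<in> D" for j using y ED by auto
  interpret H: hform sc D "\<lambda>x y. q x y - \<rho> * w x y" by (rule hform_shift)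
  have lim: "(\<lambda>j. q (y j) z - \<rho> * w (y j) z) \<longlonglongrightarrow> 0" if z: "z \<in> D" for z
  proof -
    \<comment> \<open>Only the component of \<open>z\<close> in \<open>E\<close> matters, because
      \<open>y j\<close> is orthogonal to \<open>span B0\<close> for both forms.\<close>
    obtain s where s: "s \<in> span B0" "\<And>t. t \<in> span B0 \<Longrightarrow> w (z - s) t = 0"
      using W.projection[OF w_pos B0(1) B0D z] by blast
    define u where "u = z - s"
    have sD: "s \<in> D" using s sB0D by auto
    have u: "u \<in> E" "u \<in> D" using s z sD by (auto simp: E_def u_def)
    have hs: "q (y j) z - \<rho> * w (y j) z = q (y j) u - \<rho> * w (y j) u" for j
    proof -
      have w0: "w (y j) t = 0" if "t \<in> span B0" for t using y(1)[of j] that by (auto simp: E_def)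
      have "w (y j) k = 0" if "\<mu> \<in> F" "k \<in> eigsp \<mu>" for \<mu> k
        using w0 B0(3,4) that by blast
      then have "q (y j) s = 0" using orthogonal_eigenvectors(2)[OF B0(2) yD _ s(1)] by blast
      then show ?thesis
        using Q.diff_right[OF z sD yD, of j] W.diff_right[OF z sD yD, of j] w0[OF s(1)] unfolding u_def by simp
    qed
    \<comment> \<open>Cauchy-Schwarz for \<open>q - \<rho> w\<close>, nonnegative on
      \<open>E\<close>; its value at \<open>y j\<close> is below \<open>1 / Suc j\<close> since the
      sequence is minimizing.\<close>
    have le: "(q (y j) u - \<rho> * w (y j) u)\<^sup>2 \<le> (q u u - \<rho> * w u u) * (1 / real (Suc j))" for j
    proof -
      have "(q (y j) u - \<rho> * w (y j) u)\<^sup>2 \<le> (q (y j) (y j) - \<rho> * w (y j) (y j)) * (q u u - \<rho> * w u u)"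
        using H.Cauchy_Schwarz[OF yD u(2)] Epos E_add E_sc u(1) y(1) by blast
      also have "\<dots> \<le> (1 / real (Suc j)) * (q u u - \<rho> * w u u)"
        using y(2,3)[of j] Epos[OF u(1)] by (intro mult_right_mono) auto
      finally show ?thesis by (simp add: mult.commute)
    qed
    have up: "(\<lambda>j. (q u u - \<rho> * w u u) * (1 / real (Suc j))) \<longlonglongrightarrow> 0"
      by (intro tendsto_mult_right_zero LIMSEQ_Suc[OF lim_1_over_n])
    have "(\<lambda>j. (q (y j) u - \<rho> * w (y j) u)\<^sup>2) \<longlonglongrightarrow> 0"
      by (rule real_tendsto_sandwich[OF _ _ tendsto_const[of 0] up]; rule always_eventually; rule allI; (rule le | rule zero_le_power2))
    then have "(\<lambda>j. sqrt ((q (y j) u - \<rho> * w (y j) u)\<^sup>2)) \<longlonglongrightarrow> 0"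
      using tendsto_real_sqrt by fastforce
    then show ?thesis unfolding hs by (simp add: tendsto_rabs_zero_iff)
  qed
  have "q (y j) (y j) \<le> \<rho> + 1" for j
  proof -
    have "1 / real (Suc j) \<le> 1" by simp
    then show ?thesis using y(3)[of j] by linarith
  qed
  then obtain k where k: "k \<in> D" "\<forall>z\<in>D. q k z = \<rho> * w k z" "\<not> (\<lambda>j. w (y j) k) \<longlonglongrightarrow> 0"
    using attainment[of y "\<rho> + 1" \<rho>] yD y(2) lim by blast
  then have "k \<in> span B0" using B0(4)[OF \<rho>] by (auto simp: eigsp_def)
  then have "w (y j) k = 0" for j using y(1)[of j] by (auto simp: E_def)
  then show False using k(3) by simp
qed

lemma finite_spectrum_below: "finite {\<mu>. \<mu> \<le> lam \<and> dim (eigsp \<mu>) > 0}" (is "finite ?S")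
proof -
  obtain M where M: "\<forall>B. below lam B \<longrightarrow> card B \<le> M" using below_card_bounded by blast
  have "card F \<le> M" if F: "F \<subseteq> ?S" "finite F" for F
  proof -
    obtain B where B: "below lam B" "card B = (\<Sum>\<mu>\<in>F. dim (eigsp \<mu>))"
      using eigenvector_family[OF F(2), of lam] F(1) by auto
    have "card F = (\<Sum>\<mu>\<in>F. 1)" by simp
    also have "\<dots> \<le> (\<Sum>\<mu>\<in>F. dim (eigsp \<mu>))" using F(1) by (intro sum_mono) (force simp: Suc_le_eq)
    finally show ?thesis using B M by auto
  qed
  then show ?thesis by (meson finite_if_finite_subsets_card_bdd)
qed

text \<open>From right to left by counting dimensions: a \<open>below\<close> space larger than the
  sum of the eigenspaces up to \<open>lam\<close> would contain a nonzero vector orthogonal to that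
  sum, where \<open>q\<close> exceeds \<open>lam * w\<close>. From left to right any
  \<open>n\<close> members of the eigenbasis will do.\<close>

theorem count_eq_below:
  "n \<le> (\<Sum>\<mu>\<in>{\<mu>. \<mu> \<le> lam \<and> dim (eigsp \<mu>) > 0}. dim (eigsp \<mu>)) \<longleftrightarrow>
    (\<exists>B. below lam B \<and> card B = n)"
proof -
  let ?S = "{\<mu>. \<mu> \<le> lam \<and> dim (eigsp \<mu>) > 0}"
  obtain B0 where B0: "below lam B0" "B0 \<subseteq> (\<Union>\<mu>\<in>?S. eigsp \<mu>)"
    "card B0 = (\<Sum>\<mu>\<in>?S. dim (eigsp \<mu>))" "\<forall>\<mu>\<in>?S. eigsp \<mu> \<subseteq> span B0"
    using eigenvector_family[OF finite_spectrum_below[of lam], of lam] by blast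
  have e: "eigsp \<mu> \<subseteq> span B0" if "\<mu> \<le> lam" for \<mu>
  proof (cases "dim (eigsp \<mu>) > 0")
    case True then show ?thesis using B0 that by auto
  next
    case False
    obtain A where A: "finite A" "span A = eigsp \<mu>" "card A = dim (eigsp \<mu>)" by (rule eigsp_basis)
    then have "eigsp \<mu> = {0}" using False by auto
    then show ?thesis using span_zero by auto
  qed
  show ?thesis
  proof
    assume "n \<le> (\<Sum>\<mu>\<in>?S. dim (eigsp \<mu>))"
    then obtain B where B: "B \<subseteq> B0" "card B = n" "finite B"
      using B0(3) by (metis obtain_subset_with_card_n)
    then have "below lam B"
      using B0(1) independent_mono[of B0 B] span_mono[OF B(1)] unfolding below_def by blast
    then show "\<exists>B. below lam B \<and> card B = n" using B by auto
  next
    assume "\<exists>B. below lam B \<and> card B = n"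
    then obtain B where B: "below lam B" "card B = n" by auto
    show "n \<le> (\<Sum>\<mu>\<in>?S. dim (eigsp \<mu>))"
    proof (rule ccontr)
      assume "\<not> ?thesis"
      then have cd: "card B > card B0" using B B0 by simp
      obtain x where "x \<in> span B" "x \<in> D" "x \<noteq> 0" "\<And>t. t \<in> span B0 \<Longrightarrow> w x t = 0"
        by (rule W.orthogonal_vector_in_span[of B0 B]) (use B(1) B0(1) cd in \<open>simp_all add: below_def\<close>)
      then show False
        using orthogonal_complement_empty[OF _ B0(2) _ e] B0(1) B(1) unfolding below_def by fastforce
    qed
  qed
qed

text \<open>It makes the set behind \<open>eig_n\<close> nonempty. The new vector is replaced by
  \<open>b'\<close>, orthogonal to \<open>span B\<close> for \<open>w\<close>; the remaining mixed
  term of \<open>q\<close> is absorbed by \<open>q + C0 w \<ge> 0\<close> at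
  \<open>s - c b'\<close>, which costs a factor \<open>2\<close>.\<close>

lemma finite_dim_below:
  assumes "finite B" "B \<subseteq> D" "independent B"
  shows "\<exists>lam. below lam B"
proof -
  have "\<exists>lam. \<forall>x\<in>span B. q x x \<le> lam * w x x"
    using assms(1,2)
  proof (induction B rule: finite_induct)
    case empty
    then show ?case by simp
  next
    case (insert b B)
    then have BD: "B \<subseteq> D" "b \<in> D" by auto
    have sBD: "span B \<subseteq> D" using BD(1) Q.subspace_D span_minimal by blast
    obtain lam where lam: "\<forall>x\<in>span B. q x x \<le> lam * w x x" using insert BD by blast
    obtain p where p: "p \<in> span B" "\<And>t. t \<in> span B \<Longrightarrow> w (b - p) t = 0"
      using W.projection[OF w_pos insert.hyps(1) BD] by blast
    define b' where "b' = b - p"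
    have b'D: "b' \<in> D" using BD p sBD by (auto simp: b'_def)
    \<comment> \<open>The default \<open>0\<close> is taken only at \<open>b' = 0\<close>, where
      both forms vanish.\<close>
    define lam' where "lam' = (if b' = 0 then 0 else q b' b' / w b' b')"
    have lam': "q b' b' = lam' * w b' b'" using w_pos[OF b'D] by (auto simp: lam'_def)
    define M where "M = \<bar>lam + C0\<bar> + \<bar>lam' + C0\<bar>"
    have "q x x \<le> (2 * M - C0) * w x x" if x: "x \<in> span (insert b B)" for x
    proof -
      obtain c where c: "x - sc c b \<in> span B" using x span_breakdown_eq by blast
      define s where "s = x - sc c b'"
      have "s = (x - sc c b) + sc c p" by (simp add: s_def b'_def scale_right_diff_distrib)
      then have s: "s \<in> span B" using c p span_add span_scale by auto
      have D: "s \<in> D" "sc c b' \<in> D" "sc \<i> b' \<in> D" "sc \<i> s \<in> D" using s sBD b'D by auto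
      have w0: "w s (sc c b') = 0"
      proof -
        have "w b' s = 0" "w b' (sc \<i> s) = 0" using p(2) s by (auto simp: b'_def intro: span_scale)
        then have "w (sc c b') s = 0"
          using W.cscale_left[OF b'D D(1), of c] W.rotate_left[OF b'D D(1)] by simp
        then show ?thesis using W.sym[OF D(1,2)] by simp
      qed
      have xx: "x = s + sc c b'" by (simp add: s_def)
      have "s - sc c b' \<in> D" using D by auto
      then have "q (s - sc c b') (s - sc c b') + C0 * w (s - sc c b') (s - sc c b') \<ge> 0"
        using q_bound by fastforce
      then have "2 * q s (sc c b') \<le> q s s + q (sc c b') (sc c b') + C0 * (w s s + w (sc c b') (sc c b'))"
        using w0 D Q.sym[OF D(1,2)] W.sym[OF D(1,2)]
        by (simp add: Q.diff_left Q.diff_right W.diff_left W.diff_right algebra_simps)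
      then have "q x x + C0 * w x x \<le> 2 * (q s s + C0 * w s s) + 2 * (q (sc c b') (sc c b') + C0 * w (sc c b') (sc c b'))"
        unfolding xx Q.add_self[OF D(1,2)] W.add_self[OF D(1,2)] w0 by (simp add: algebra_simps)
      also have "q s s + C0 * w s s \<le> (lam + C0) * w s s" using lam s by (simp add: algebra_simps)
      also have "\<dots> \<le> M * w s s" using w_nonneg[OF D(1)] by (intro mult_right_mono) (auto simp: M_def)
      also have "q (sc c b') (sc c b') + C0 * w (sc c b') (sc c b') = (lam' + C0) * w (sc c b') (sc c b')"
        unfolding Q.cscale_self[OF b'D] W.cscale_self[OF b'D] lam' by (simp add: algebra_simps)
      also have "\<dots> \<le> M * w (sc c b') (sc c b')"
        using w_nonneg[OF D(2)] by (intro mult_right_mono) (auto simp: M_def)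
      also have "2 * (M * w s s) + 2 * (M * w (sc c b') (sc c b')) = 2 * M * w x x"
        unfolding xx W.add_self[OF D(1,2)] w0 by (simp add: algebra_simps)
      finally show ?thesis by (simp add: algebra_simps)
    qed
    then show ?case by blast
  qed
  then show ?thesis using assms by (auto simp: below_def)
qed

end

section \<open>Lebesgue differentiation and absolutely continuous functions\<close>

lemma AE_lebesgue_on_iff_negligible:
  assumes "S \<in> sets lebesgue"
  shows "(AE t in lebesgue_on S. P t) \<longleftrightarrow> negligible {t \<in> S. \<not> P t}"
proof -
  have "(AE t in lebesgue_on S. P t) \<longleftrightarrow> (AE t in lebesgue. t \<in> S \<longrightarrow> P t)"
    using assms by (simp add: AE_restrict_space_iff)
  also have "\<dots> \<longleftrightarrow> {t \<in> S. \<not> P t} \<in> null_sets lebesgue"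
  proof
    assume "AE t in lebesgue. t \<in> S \<longrightarrow> P t"
    then obtain N where N: "N \<in> null_sets lebesgue" "{t \<in> space lebesgue. \<not> (t \<in> S \<longrightarrow> P t)} \<subseteq> N"
      unfolding eventually_ae_filter by blast
    have "{t \<in> S. \<not> P t} \<subseteq> N" using N(2) by simp
    then show "{t \<in> S. \<not> P t} \<in> null_sets lebesgue" by (rule null_sets_completion_subset[OF _ N(1)])
  next
    assume "{t \<in> S. \<not> P t} \<in> null_sets lebesgue"
    then show "AE t in lebesgue. t \<in> S \<longrightarrow> P t" by (rule AE_I') auto
  qed
  finally show ?thesis by (simp add: negligible_iff_null_sets)
qed

lemma AE_lebesgue_onD:
  assumes "AE t in lebesgue_on {a..b::real}. P t"
  obtains N where "negligible N" "\<And>t. t \<in> {a..b} - N \<Longrightarrow> P t"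
proof
  show "negligible {t \<in> {a..b}. \<not> P t}"
    using assms AE_lebesgue_on_iff_negligible[of "{a..b}" P] by simp
qed blast

lemma AE_lebesgue_onI:
  assumes "negligible N" "\<And>t. t \<in> {a..b::real} - N \<Longrightarrow> P t"
  shows "AE t in lebesgue_on {a..b}. P t"
proof -
  have "negligible {t \<in> {a..b}. \<not> P t}"
    by (rule negligible_subset[OF assms(1)]) (use assms(2) in blast)
  then show ?thesis using AE_lebesgue_on_iff_negligible[of "{a..b}" P] by simp
qed

lemma cball_segment:
  fixes x y :: real
  shows "cball ((x + y) / 2) (\<bar>y - x\<bar> / 2) = {min x y..max x y}"
  unfolding cball_eq_atLeastAtMost by (cases "x \<le> y") (auto simp: field_simps)

text \<open>Only norms are compared, so the order of \<open>x\<close> and \<open>y\<close> drops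
  out. The left-hand side is the expression that Henstock's lemma estimates for a tagged
  interval.\<close>

lemma integral_segment_norm:
  fixes f :: "real \<Rightarrow> 'b::euclidean_space"
  assumes f: "f integrable_on {a..b}" and x: "x \<in> {a..b}" and y: "y \<in> {a..b}"
  shows "norm (measure lborel {min x y..max x y} *\<^sub>R f x - integral {min x y..max x y} f) =
    norm (integral {a..y} f - integral {a..x} f - (y - x) *\<^sub>R f x)"
proof -
  have int: "f integrable_on {a..z}" if "z \<in> {a..b}" for z
    using that by (intro integrable_on_subinterval[OF f]) auto
  show ?thesis
  proof (cases "x \<le> y")
    case True
    have "integral {a..x} f + integral {x..y} f = integral {a..y} f"
      using x True by (intro Henstock_Kurzweil_Integration.integral_combine int y) auto
    then have "integral {x..y} f = integral {a..y} f - integral {a..x} f" by (simp add: algebra_simps)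
    then show ?thesis using True by (simp add: norm_minus_commute)
  next
    case False
    have "integral {a..y} f + integral {y..x} f = integral {a..x} f"
      using y False by (intro Henstock_Kurzweil_Integration.integral_combine int x) auto
    then have "integral {y..x} f = integral {a..x} f - integral {a..y} f" by (simp add: algebra_simps)
    then have "measure lborel {y..x} *\<^sub>R f x - integral {y..x} f = integral {a..y} f - integral {a..x} f - (y - x) *\<^sub>R f x"
      using False by (simp add: algebra_simps)
    then show ?thesis using False by simp
  qed
qed

text \<open>The intervals on which the difference quotient is off by more than \<open>q\<close> form a Vitali covering
  of the exceptional set, and Henstock's lemma bounds the total length of any disjoint finite
  subfamily.\<close>
lemma negligible_bad_difference_quotients:
  fixes f :: "real \<Rightarrow> 'b::euclidean_space"
  assumes f: "f integrable_on {a..b}" and q: "q > 0"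
  defines "F \<equiv> \<lambda>t. integral {a..t} f"
  shows "negligible {x \<in> {a..b}. \<forall>d>0. \<exists>y\<in>{a..b}. 0 < \<bar>y - x\<bar> \<and> \<bar>y - x\<bar> < d \<and>
    norm (F y - F x - (y - x) *\<^sub>R f x) > q * \<bar>y - x\<bar>}" (is "negligible ?S")
  unfolding negligible_outer_le
proof (intro allI impI)
  fix e :: real assume e: "e > 0"
  define bad where "bad = (\<lambda>x y. norm (F y - F x - (y - x) *\<^sub>R f x) > q * \<bar>y - x\<bar>)"
  have f': "f integrable_on cbox a b" and eq: "e * q > 0" using f e q by simp_all
  obtain \<gamma> where \<gamma>: "gauge \<gamma>" and
    small: "\<And>p. p tagged_partial_division_of (cbox a b) \<Longrightarrow> \<gamma> fine p \<Longrightarrow>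
             (\<Sum>(x,k)\<in>p. norm (measure lborel k *\<^sub>R f x - integral k f)) < e * q"
    by (rule Henstock_lemma[OF f' eq]; rule that; (assumption | blast))
  \<comment> \<open>The tag \<open>x\<close> is an endpoint of its interval. The intervals are then
    described as closed balls about their midpoints to fit the Vitali covering theorem.\<close>
  define K where "K = {(x, y). x \<in> ?S \<and> y \<in> {a..b} \<and> x \<noteq> y \<and> bad x y \<and> {min x y..max x y} \<subseteq> \<gamma> x}"
  define c where "c = (\<lambda>(x, y). (x + y) / 2 :: real)"
  define r where "r = (\<lambda>(x, y). \<bar>y - x\<bar> / 2 :: real)"
  have cb: "cball (c i) (r i) = {min (fst i) (snd i)..max (fst i) (snd i)}" for i
    using cball_segment[of "fst i" "snd i"] by (simp add: c_def r_def case_prod_beta)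
  have cover: "\<exists>i. i \<in> K \<and> x \<in> cball (c i) (r i) \<and> r i < d" if x: "x \<in> ?S" and d: "d > 0" for x d
  proof -
    have "open (\<gamma> x)" "x \<in> \<gamma> x" using \<gamma> by (auto simp: gauge_def)
    then obtain \<delta> where \<delta>: "\<delta> > 0" "ball x \<delta> \<subseteq> \<gamma> x" by (meson openE)
    then have m: "min \<delta> d > 0" using d by simp
    have "\<forall>d>0. \<exists>y\<in>{a..b}. 0 < \<bar>y - x\<bar> \<and> \<bar>y - x\<bar> < d \<and> norm (F y - F x - (y - x) *\<^sub>R f x) > q * \<bar>y - x\<bar>"
      using x by blast
    then obtain y where y: "y \<in> {a..b}" "0 < \<bar>y - x\<bar>" "\<bar>y - x\<bar> < min \<delta> d" "bad x y"
      using m unfolding bad_def by meson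
    have "{min x y..max x y} \<subseteq> ball x \<delta>" using y(3) by (auto simp: dist_real_def)
    then have "(x, y) \<in> K" using x y \<delta> by (auto simp: K_def)
    moreover have "x \<in> cball (c (x, y)) (r (x, y))" unfolding cb by simp
    moreover have "\<bar>y - x\<bar> < d" using y(3) by simp
    then have "r (x, y) < d" using d by (simp add: r_def)
    ultimately show ?thesis by blast
  qed
  obtain C where C: "countable C" "C \<subseteq> K"
     "pairwise (\<lambda>i j. disjnt (cball (c i) (r i)) (cball (c j) (r j))) C"
     "negligible (?S - (\<Union>i \<in> C. cball (c i) (r i)))"
  proof (rule Vitali_covering_theorem_cballs[of K r ?S c])
    show "0 < r i" if "i \<in> K" for i using that by (auto simp: K_def r_def)
  qed (use cover in blast)+
  have fin: "measure lebesgue (\<Union>i\<in>C'. cball (c i) (r i)) \<le> e" if C': "C' \<subseteq> C" "finite C'" for C'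
  proof -
    define J where "J = (\<lambda>i::real\<times>real. {min (fst i) (snd i)..max (fst i) (snd i)})"
    \<comment> \<open>Disjointness makes different pairs give different tagged intervals, so a sum
      over \<open>p\<close> is a sum over \<open>C'\<close>.\<close>
    have inj: "inj_on (\<lambda>i. (fst i, J i)) C'"
    proof (rule inj_onI)
      fix i j assume ij: "i \<in> C'" "j \<in> C'" "(fst i, J i) = (fst j, J j)"
      show "i = j"
      proof (rule ccontr)
        assume "i \<noteq> j"
        then have "disjnt (J i) (J j)" using C(3) ij C' unfolding pairwise_def cb J_def by blast
        then show False using ij by (auto simp: disjnt_def J_def)
      qed
    qed
    define p where "p = (\<lambda>i. (fst i, J i)) ` C'"
    have K: "i \<in> K" if "i \<in> C'" for i using that C' C by auto
    have "p tagged_partial_division_of (cbox a b)"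
      unfolding tagged_partial_division_of_def
    proof (intro conjI allI impI)
      show "finite p" using C' by (simp add: p_def)
    next
      fix x k assume "(x, k) \<in> p"
      then obtain i where i: "i \<in> C'" "x = fst i" "k = J i" by (auto simp: p_def)
      then show "x \<in> k" by (simp add: J_def)
      show "k \<subseteq> cbox a b" using K[OF i(1)] i(3) by (auto simp: K_def J_def)
      show "\<exists>a b. k = cbox a b" using i(3) by (auto simp: J_def)
    next
      fix x1 k1 x2 k2 assume h: "(x1, k1) \<in> p \<and> (x2, k2) \<in> p \<and> (x1, k1) \<noteq> (x2, k2)"
      then obtain i j where ij: "i \<in> C'" "j \<in> C'" "k1 = J i" "k2 = J j" "i \<noteq> j" by (auto simp: p_def)
      then have "disjnt (J i) (J j)" using C(3) C' unfolding pairwise_def cb J_def by blast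
      then show "interior k1 \<inter> interior k2 = {}"
        unfolding ij(3,4) disjnt_def using interior_subset by blast
    qed
    moreover have "\<gamma> fine p"
      using K by (fastforce simp: fine_def p_def K_def J_def)
    ultimately have "(\<Sum>(x,k)\<in>p. norm (measure lborel k *\<^sub>R f x - integral k f)) < e * q" by (rule small)
    then have "(\<Sum>i\<in>C'. norm (measure lborel (J i) *\<^sub>R f (fst i) - integral (J i) f)) < e * q"
      unfolding p_def by (subst (asm) sum.reindex[OF inj]) (simp add: o_def)
    moreover have "q * measure lebesgue (J i) \<le> norm (measure lborel (J i) *\<^sub>R f (fst i) - integral (J i) f)" if "i \<in> C'" for i
    proof -
      obtain x y where i: "i = (x, y)" by (cases i)
      have xy: "x \<in> {a..b}" "y \<in> {a..b}" "bad x y" using K[OF that] by (auto simp: i K_def)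
      have "measure lebesgue (J i) = \<bar>y - x\<bar>" by (auto simp: J_def i min_def max_def)
      then show ?thesis
        using xy(3) integral_segment_norm[OF f xy(1,2)] unfolding bad_def F_def J_def i by simp
    qed
    then have "(\<Sum>i\<in>C'. q * measure lebesgue (J i)) \<le>
        (\<Sum>i\<in>C'. norm (measure lborel (J i) *\<^sub>R f (fst i) - integral (J i) f))" by (rule sum_mono)
    ultimately have "q * (\<Sum>i\<in>C'. measure lebesgue (J i)) \<le> q * e"
      by (simp add: sum_distrib_left mult.commute)
    then have "(\<Sum>i\<in>C'. measure lebesgue (J i)) \<le> e" using q by simp
    moreover have "measure lebesgue (\<Union>i\<in>C'. J i) \<le> (\<Sum>i\<in>C'. measure lebesgue (J i))"
      by (intro measure_UNION_le C') (auto simp: J_def)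
    ultimately show ?thesis unfolding cb J_def by simp
  qed
  have U: "(\<Union>i\<in>C. cball (c i) (r i)) \<in> lmeasurable" "measure lebesgue (\<Union>i\<in>C. cball (c i) (r i)) \<le> e"
    using fmeasurable_UN_bound[OF C(1) _ fin] measure_UN_bound[OF C(1) _ fin] by auto
  let ?T = "(?S - (\<Union>i \<in> C. cball (c i) (r i))) \<union> (\<Union>i\<in>C. cball (c i) (r i))"
  have "?T \<in> lmeasurable" by (rule fmeasurable.Un[OF negligible_imp_measurable[OF C(4)] U(1)])
  moreover have "measure lebesgue ?T \<le> 0 + e"
    using measure_Un_le[of "?S - (\<Union>i \<in> C. cball (c i) (r i))" lebesgue "\<Union>i\<in>C. cball (c i) (r i)"]
      U C(4) negligible_imp_measure0[OF C(4)] negligible_imp_sets[OF C(4)] by auto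
  ultimately show "\<exists>T. ?S \<subseteq> T \<and> T \<in> lmeasurable \<and> measure lebesgue T \<le> e"
    by (intro exI[of _ ?T]) auto
qed

text \<open>Where the derivative fails to be \<open>f x\<close>, the difference quotient is off by
  more than some \<open>1 / Suc n\<close> at arbitrarily small distances, which happens on countably
  many null sets. The endpoints are discarded too because the derivative is two-sided.\<close>

theorem lebesgue_differentiation:
  fixes f :: "real \<Rightarrow> 'b::euclidean_space"
  assumes f: "f integrable_on {a..b}"
  obtains N where "negligible N"
    "\<And>x. x \<in> {a..b} - N \<Longrightarrow> ((\<lambda>t. integral {a..t} f) has_vector_derivative f x) (at x)"
proof -
  define F where "F = (\<lambda>t. integral {a..t} f)"
  define S where "S = (\<lambda>n::nat. {x \<in> {a..b}. \<forall>d>0. \<exists>y\<in>{a..b}. 0 < \<bar>y - x\<bar> \<and> \<bar>y - x\<bar> < d \<and>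
    norm (F y - F x - (y - x) *\<^sub>R f x) > (1 / real (Suc n)) * \<bar>y - x\<bar>})"
  have S: "negligible (S n)" for n
    using negligible_bad_difference_quotients[OF f, of "1 / real (Suc n)"] unfolding S_def F_def by simp
  have "(F has_vector_derivative f x) (at x)" if x: "x \<in> {a..b} - ({a, b} \<union> (\<Union>n. S n))" for x
    unfolding has_vector_derivative_def has_derivative_at_alt
  proof (intro conjI allI impI)
    show "bounded_linear (\<lambda>h. h *\<^sub>R f x)" by (rule bounded_linear_scaleR_left)
    fix e :: real assume e: "e > 0"
    obtain n where n: "1 / real (Suc n) < e" using e nat_approx_posE by blast
    have xab: "a < x" "x < b" using x by auto
    have "x \<notin> S n" using x by auto
    then obtain d where d: "d > 0" "\<And>y. y \<in> {a..b} \<Longrightarrow> 0 < \<bar>y - x\<bar> \<Longrightarrow> \<bar>y - x\<bar> < d \<Longrightarrow>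
      norm (F y - F x - (y - x) *\<^sub>R f x) \<le> (1 / real (Suc n)) * \<bar>y - x\<bar>"
    proof -
      have "\<not> (\<forall>d>0. \<exists>y\<in>{a..b}. 0 < \<bar>y - x\<bar> \<and> \<bar>y - x\<bar> < d \<and>
          norm (F y - F x - (y - x) *\<^sub>R f x) > (1 / real (Suc n)) * \<bar>y - x\<bar>)"
        using xab \<open>x \<notin> S n\<close> unfolding S_def by auto
      then show thesis using that by (meson not_less)
    qed
    show "\<exists>d>0. \<forall>y. norm (y - x) < d \<longrightarrow> norm (F y - F x - (y - x) *\<^sub>R f x) \<le> e * norm (y - x)"
    proof (intro exI conjI allI impI)
      show "min d (min (x - a) (b - x)) > 0" using d xab by simp
      fix y assume y: "norm (y - x) < min d (min (x - a) (b - x))"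
      show "norm (F y - F x - (y - x) *\<^sub>R f x) \<le> e * norm (y - x)"
      proof (cases "y = x")
        case False
        have "norm (F y - F x - (y - x) *\<^sub>R f x) \<le> (1 / real (Suc n)) * \<bar>y - x\<bar>"
          using False y by (intro d(2)) auto
        also have "\<dots> \<le> e * \<bar>y - x\<bar>" using n by (intro mult_right_mono) auto
        finally show ?thesis by simp
      qed auto
    qed
  qed
  moreover have "negligible ({a, b} \<union> (\<Union>n. S n))"
    using S by (intro negligible_Un negligible_countable_Union) auto
  ultimately show thesis using that unfolding F_def by blast
qed

text \<open>The fundamental theorem of calculus, by a gauge adapted to the exceptional set
  \<open>N\<close>. Intervals tagged outside \<open>N\<close> obey the derivative estimate; those
  tagged in \<open>N\<close> are confined to an open set of measure below \<open>\<delta>\<close>,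
  where absolute continuity makes the sum of the increments small.\<close>

lemma has_integral_abs_cont:
  fixes F :: "real \<Rightarrow> 'b::euclidean_space"
  assumes ab: "a \<le> b" and ac: "abs_cont_on a b F"
    and deriv: "AE t in lebesgue_on {a..b}. (F has_vector_derivative f t) (at t)"
  shows "(f has_integral F b - F a) {a..b}"
proof -
  obtain N where N: "negligible N" "\<And>t. t \<in> {a..b} - N \<Longrightarrow> (F has_vector_derivative f t) (at t)"
    using AE_lebesgue_onD[OF deriv] by metis
  define g where "g = (\<lambda>t. if t \<in> N then 0 else f t)"
  have "(g has_integral F b - F a) {a..b}"
    unfolding has_integral_factor_content_real
  proof (intro allI impI)
    fix e :: real assume e: "e > 0"
    show "\<exists>\<gamma>. gauge \<gamma> \<and> (\<forall>p. p tagged_division_of {a..b} \<and> \<gamma> fine p \<longrightarrow>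
      norm ((\<Sum>(x,k)\<in>p. measure lborel k *\<^sub>R g x) - (F b - F a)) \<le> e * measure lborel {a..b})"
    proof (cases "a = b")
      \<comment> \<open>For \<open>a = b\<close> the tolerance \<open>e * (b - a) / 2\<close> of the
        other case would not be positive.\<close>
      case True
      have 0: "measure lborel k = 0 \<and> F (Sup k) - F (Inf k) = 0"
        if pk: "p tagged_division_of {a..b}" "(x, k) \<in> p" for p x k
      proof -
        obtain u v where "k = cbox u v" using tagged_division_ofD(4)[OF pk] by blast
        then have uv: "k = {u..v}" "x \<in> k" "k \<subseteq> {a..b}"
          using tagged_division_ofD(2,3)[OF pk] by simp_all
        then have "u \<in> {a..b}" "v \<in> {a..b}" by auto
        then have "u = v" using True by simp
        then show ?thesis using uv by simp
      qed
      have "norm ((\<Sum>(x,k)\<in>p. measure lborel k *\<^sub>R g x) - (F b - F a)) \<le> e * measure lborel {a..b}"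
        if "p tagged_division_of {a..b}" for p
      proof -
        have "(\<Sum>(x,k)\<in>p. measure lborel k *\<^sub>R g x) = 0"
          using 0[OF that] by (intro sum.neutral) auto
        then show ?thesis using True by simp
      qed
      then show ?thesis using gauge_trivial by blast
    next
      case False
      then have ab': "a < b" using ab by simp
      have e2: "e * (b - a) / 2 > 0" using e ab' by simp
      obtain \<delta> where \<delta>: "\<delta> > 0" and ac': "\<And>D. finite D \<Longrightarrow> (\<forall>(s,t)\<in>D. a \<le> s \<and> s \<le> t \<and> t \<le> b) \<Longrightarrow>
        (\<forall>(s,t)\<in>D. \<forall>(s',t')\<in>D. (s,t) \<noteq> (s',t') \<longrightarrow> t \<le> s' \<or> t' \<le> s) \<Longrightarrow>
        (\<Sum>(s,t)\<in>D. t - s) < \<delta> \<Longrightarrow> (\<Sum>(s,t)\<in>D. norm (F t - F s)) < e * (b - a) / 2"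
        using ac e2 unfolding abs_cont_on_def by meson
      obtain T where T: "open T" "N \<subseteq> T" "(T - N) \<in> lmeasurable" "emeasure lebesgue (T - N) < ennreal \<delta>"
        using sets_lebesgue_outer_open[OF negligible_imp_sets[OF N(1)] \<delta>] by blast
      have TN: "T = N \<union> (T - N)" using T(2) by blast
      have Tm: "T \<in> lmeasurable"
        by (subst TN) (rule fmeasurable.Un[OF negligible_imp_measurable[OF N(1)] T(3)])
      have "measure lebesgue T \<le> measure lebesgue N + measure lebesgue (T - N)"
        by (subst TN) (rule measure_Un_le[OF negligible_imp_sets[OF N(1)] fmeasurableD[OF T(3)]])
      also have "\<dots> < \<delta>"
        using T(4) \<delta> negligible_imp_measure0[OF N(1)] emeasure_eq_measure2[OF T(3)] by (simp add: ennreal_less_iff)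
      finally have T\<delta>: "measure lebesgue T < \<delta>" .
      have "\<exists>d>0. t \<in> {a..b} - N \<longrightarrow> (\<forall>y. \<bar>y - t\<bar> < d \<longrightarrow> norm (F y - F t - (y - t) *\<^sub>R f t) \<le> e / 2 * \<bar>y - t\<bar>)" for t
      proof (cases "t \<in> {a..b} - N")
        case True
        then have "(F has_derivative (\<lambda>h. h *\<^sub>R f t)) (at t)"
          using N(2) unfolding has_vector_derivative_def by blast
        then have "\<forall>e>0. \<exists>d>0. \<forall>y. norm (y - t) < d \<longrightarrow> norm (F y - F t - (y - t) *\<^sub>R f t) \<le> e * norm (y - t)"
          unfolding has_derivative_at_alt by blast
        from this[rule_format, of "e / 2"] show ?thesis using e by auto
      qed (auto intro: exI[of _ 1])
      then obtain d where d: "\<And>t. d t > 0"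
        "\<And>t y. t \<in> {a..b} - N \<Longrightarrow> \<bar>y - t\<bar> < d t \<Longrightarrow> norm (F y - F t - (y - t) *\<^sub>R f t) \<le> e / 2 * \<bar>y - t\<bar>"
        by metis
      define \<gamma> where "\<gamma> = (\<lambda>t. if t \<in> N then T else ball t (d t))"
      have gauge: "gauge \<gamma>" using T d by (auto simp: gauge_def \<gamma>_def)
      have main: "norm ((\<Sum>(x,k)\<in>p. measure lborel k *\<^sub>R g x) - (F b - F a)) \<le> e * measure lborel {a..b}"
        if p: "p tagged_division_of {a..b}" and fine: "\<gamma> fine p" for p
      proof -
        have fin: "finite p" using p by blast
        have k: "\<exists>u v. k = {u..v} \<and> u \<le> x \<and> x \<le> v \<and> a \<le> u \<and> v \<le> b \<and> Inf k = u \<and> Sup k = v \<and> measure lborel k = v - u"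
          if xk: "(x, k) \<in> p" for x k
        proof -
          obtain u v where "k = cbox u v" using tagged_division_ofD(4)[OF p xk] by blast
          then have uv: "k = {u..v}" "x \<in> k" "k \<subseteq> {a..b}"
            using tagged_division_ofD(2,3)[OF p xk] by simp_all
          then have "u \<le> v" by auto
          then show ?thesis using uv by (intro exI[of _ u] exI[of _ v]) auto
        qed
        have eq: "(\<Sum>(x,k)\<in>p. measure lborel k *\<^sub>R g x) - (F b - F a) =
            (\<Sum>(x,k)\<in>p. measure lborel k *\<^sub>R g x - (F (Sup k) - F (Inf k)))"
          using additive_tagged_division_1[OF ab p, of F] by (simp add: sum_subtractf case_prod_beta)
        \<comment> \<open>Degenerate intervals contribute no increment; without them, distinct
          members have distinct pairs of endpoints.\<close>
        define p2 where "p2 = {(x, k) \<in> p. x \<in> N \<and> Inf k < Sup k}"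
        have p2: "finite p2" "p2 \<subseteq> p" using fin finite_subset[of p2 p] by (auto simp: p2_def)
        have len: "(\<Sum>(x,k)\<in>p. measure lborel k) = b - a"
        proof -
          have "(\<Sum>(x,k)\<in>p. measure lborel k) = (\<Sum>(x,k)\<in>p. Sup k - Inf k)"
            using k by (intro sum.cong) fastforce+
          then show ?thesis using additive_tagged_division_1[OF ab p, of "\<lambda>x. x"] by simp
        qed
        have bound: "norm (measure lborel k *\<^sub>R g x - (F (Sup k) - F (Inf k))) \<le>
            e / 2 * measure lborel k + (if (x, k) \<in> p2 then norm (F (Sup k) - F (Inf k)) else 0)"
          if xk: "(x, k) \<in> p" for x k
        proof -
          obtain u v where uv: "k = {u..v}" "u \<le> x" "x \<le> v" "a \<le> u" "v \<le> b" "Inf k = u" "Sup k = v"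
            "measure lborel k = v - u" using k[OF xk] by blast
          have e2: "0 \<le> e / 2 * (v - u)" using e uv by simp
          show ?thesis
          proof (cases "x \<in> N")
            case True
            show ?thesis
            proof (cases "u < v")
              case True
              then have "(x, k) \<in> p2" using uv xk \<open>x \<in> N\<close> by (simp add: p2_def)
              then show ?thesis using \<open>x \<in> N\<close> e2 uv by (simp add: g_def norm_minus_commute)
            next
              case False
              then have "u = v" using uv by simp
              then show ?thesis using \<open>x \<in> N\<close> uv by (simp add: g_def)
            qed
          next
            case False
            have sub: "k \<subseteq> ball x (d x)" using fine xk False by (force simp: fine_def \<gamma>_def)
            have "u \<in> k" "v \<in> k" using uv by auto
            then have "\<bar>u - x\<bar> < d x" "\<bar>v - x\<bar> < d x" using sub by (auto simp: dist_real_def)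
            moreover have "x \<in> {a..b} - N" using False uv by auto
            ultimately have 1: "norm (F u - F x - (u - x) *\<^sub>R f x) \<le> e / 2 * \<bar>u - x\<bar>"
              "norm (F v - F x - (v - x) *\<^sub>R f x) \<le> e / 2 * \<bar>v - x\<bar>" using d(2) by blast+
            have "measure lborel k *\<^sub>R g x - (F (Sup k) - F (Inf k)) =
                (F u - F x - (u - x) *\<^sub>R f x) - (F v - F x - (v - x) *\<^sub>R f x)"
              using False uv by (simp add: g_def algebra_simps)
            then have "norm (measure lborel k *\<^sub>R g x - (F (Sup k) - F (Inf k))) =
                norm ((F u - F x - (u - x) *\<^sub>R f x) - (F v - F x - (v - x) *\<^sub>R f x))" by (rule arg_cong)
            also have "\<dots> \<le> e / 2 * \<bar>u - x\<bar> + e / 2 * \<bar>v - x\<bar>"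
              using norm_triangle_ineq4[of "F u - F x - (u - x) *\<^sub>R f x" "F v - F x - (v - x) *\<^sub>R f x"] 1
              by linarith
            also have "\<dots> = e / 2 * (\<bar>u - x\<bar> + \<bar>v - x\<bar>)" by (rule distrib_left[symmetric])
            also have "\<bar>u - x\<bar> + \<bar>v - x\<bar> = v - u" using uv by simp
            finally show ?thesis using uv False by (simp add: p2_def)
          qed
        qed
        have small: "(\<Sum>(x,k)\<in>p2. norm (F (Sup k) - F (Inf k))) < e * (b - a) / 2"
        proof -
          define D where "D = (\<lambda>(x,k). (Inf k, Sup k)) ` p2"
          have disj: "disjnt {Inf k<..<Sup k} {Inf k'<..<Sup k'}"
            if "(x,k) \<in> p2" "(x',k') \<in> p2" "(x,k) \<noteq> (x',k')" for x k x' k'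
          proof -
            have pp: "(x,k) \<in> p" "(x',k') \<in> p" using that p2 by auto
            have "interior k \<inter> interior k' = {}" using tagged_division_ofD(5)[OF p pp that(3)] .
            moreover have "interior k = {Inf k<..<Sup k}" "interior k' = {Inf k'<..<Sup k'}"
              using k[OF pp(1)] k[OF pp(2)] interior_atLeastAtMost_real by metis+
            ultimately show ?thesis by (simp add: disjnt_def)
          qed
          have nd: "Inf k < Sup k" if "(x, k) \<in> p2" for x k using that by (auto simp: p2_def)
          have inj: "inj_on (\<lambda>(x,k). (Inf k, Sup k)) p2"
          proof (rule inj_onI, safe)
            fix x k x' k' assume h: "(x,k) \<in> p2" "(x',k') \<in> p2" "Inf k = Inf k'" "Sup k = Sup k'"
            then have "(x, k) = (x', k')"
              using disj[OF h(1,2)] nd[OF h(1)] dense[of "Inf k'" "Sup k'"] by (auto simp: disjnt_def)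
            then show "x = x'" "\<And>z. z \<in> k \<Longrightarrow> z \<in> k'" "\<And>z. z \<in> k' \<Longrightarrow> z \<in> k" by auto
          qed
          have "(\<Sum>(s,t)\<in>D. norm (F t - F s)) < e * (b - a) / 2"
          proof (rule ac')
            show "finite D" using p2 by (simp add: D_def)
            show "\<forall>(s,t)\<in>D. a \<le> s \<and> s \<le> t \<and> t \<le> b"
              using k p2 by (fastforce simp: D_def)
            show "\<forall>(s,t)\<in>D. \<forall>(s',t')\<in>D. (s,t) \<noteq> (s',t') \<longrightarrow> t \<le> s' \<or> t' \<le> s"
            proof (clarsimp simp: D_def)
              fix x k x' k' assume h: "(x,k) \<in> p2" "(x',k') \<in> p2" "Inf k = Inf k' \<longrightarrow> Sup k \<noteq> Sup k'"
                "\<not> Sup k' \<le> Inf k"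
              then have "disjnt {Inf k<..<Sup k} {Inf k'<..<Sup k'}" using disj[OF h(1,2)] by auto
              then show "Sup k \<le> Inf k'"
                using nd[OF h(1)] nd[OF h(2)] h(4) dense[of "max (Inf k) (Inf k')" "min (Sup k) (Sup k')"]
                by (auto simp: disjnt_iff) (smt (verit))
            qed
            have "(\<Sum>(s,t)\<in>D. t - s) = (\<Sum>(x,k)\<in>p2. Sup k - Inf k)"
              unfolding D_def by (subst sum.reindex[OF inj]) (simp add: o_def case_prod_beta)
            also have "\<dots> = (\<Sum>i\<in>p2. measure lebesgue {Inf (snd i)<..<Sup (snd i)})"
              using nd by (intro sum.cong) (auto simp: less_imp_le)
            also have "\<dots> = measure lebesgue (\<Union>i\<in>p2. {Inf (snd i)<..<Sup (snd i)})"
            proof (rule measure_UNION'[symmetric, OF p2(1)])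
              show "pairwise (\<lambda>i j. disjnt {Inf (snd i)<..<Sup (snd i)} {Inf (snd j)<..<Sup (snd j)}) p2"
                unfolding pairwise_def
              proof (intro ballI impI)
                fix i j assume "i \<in> p2" "j \<in> p2" "i \<noteq> j"
                then show "disjnt {Inf (snd i)<..<Sup (snd i)} {Inf (snd j)<..<Sup (snd j)}"
                  using disj[of "fst i" "snd i" "fst j" "snd j"] by simp
              qed
            qed auto
            also have "\<dots> \<le> measure lebesgue T"
            proof (rule measure_mono_fmeasurable[OF _ _ Tm])
              show "(\<Union>i\<in>p2. {Inf (snd i)<..<Sup (snd i)}) \<subseteq> T"
              proof safe
                fix x k t assume h: "(x, k) \<in> p2" "t \<in> {Inf (snd (x,k))<..<Sup (snd (x,k))}"
                then have xk: "(x, k) \<in> p" "x \<in> N" by (auto simp: p2_def)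
                have "k \<subseteq> T" using fine xk by (force simp: fine_def \<gamma>_def)
                moreover have "t \<in> k"
                proof -
                  obtain u v where "k = {u..v}" "Inf k = u" "Sup k = v" using k[OF xk(1)] by blast
                  then show ?thesis using h(2) by simp
                qed
                ultimately show "t \<in> T" by auto
              qed
            qed (use p2 in auto)
            finally show "(\<Sum>(s,t)\<in>D. t - s) < \<delta>" using T\<delta> by simp
          qed
          moreover have "(\<Sum>(s,t)\<in>D. norm (F t - F s)) = (\<Sum>(x,k)\<in>p2. norm (F (Sup k) - F (Inf k)))"
            unfolding D_def by (subst sum.reindex[OF inj]) (simp add: o_def case_prod_beta)
          ultimately show ?thesis by simp
        qed
        have "norm ((\<Sum>(x,k)\<in>p. measure lborel k *\<^sub>R g x) - (F b - F a)) \<le>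
            (\<Sum>(x,k)\<in>p. e / 2 * measure lborel k + (if (x, k) \<in> p2 then norm (F (Sup k) - F (Inf k)) else 0))"
          unfolding eq using bound by (intro sum_norm_le) auto
        also have "\<dots> = e / 2 * (\<Sum>(x,k)\<in>p. measure lborel k) +
            (\<Sum>i\<in>p. if i \<in> p2 then norm (F (Sup (snd i)) - F (Inf (snd i))) else 0)"
          by (simp add: case_prod_beta sum.distrib sum_distrib_left)
        also have "(\<Sum>i\<in>p. if i \<in> p2 then norm (F (Sup (snd i)) - F (Inf (snd i))) else 0) =
            (\<Sum>(x,k)\<in>p2. norm (F (Sup k) - F (Inf k)))"
          using fin p2 by (simp add: sum.inter_restrict[symmetric] Int_absorb1 case_prod_beta)
        also have "e / 2 * (\<Sum>(x,k)\<in>p. measure lborel k) + (\<Sum>(x,k)\<in>p2. norm (F (Sup k) - F (Inf k))) \<le> e * (b - a)"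
          using small unfolding len by (simp add: field_simps)
        finally show ?thesis using ab by simp
      qed
      show ?thesis
      proof (intro exI conjI allI impI)
        show "gauge \<gamma>" by (rule gauge)
      qed (elim conjE, rule main)
    qed
  qed
  then show ?thesis by (rule has_integral_spike[OF N(1), rotated]) (simp add: g_def)
qed

lemma lipschitz_imp_abs_cont:
  fixes F :: "real \<Rightarrow> 'b::real_normed_vector"
  assumes "L-lipschitz_on {a..b} F"
  shows "abs_cont_on a b F"
  unfolding abs_cont_on_def
proof (intro allI impI)
  fix \<epsilon> :: real assume \<epsilon>: "\<epsilon> > 0"
  have L: "L \<ge> 0" using assms by (rule lipschitz_on_nonneg)
  show "\<exists>\<delta>>0. \<forall>D. finite D \<longrightarrow> (\<forall>(s,t)\<in>D. a \<le> s \<and> s \<le> t \<and> t \<le> b) \<longrightarrow>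
      (\<forall>(s,t)\<in>D. \<forall>(s',t')\<in>D. (s,t) \<noteq> (s',t') \<longrightarrow> t \<le> s' \<or> t' \<le> s) \<longrightarrow>
      (\<Sum>(s,t)\<in>D. t - s) < \<delta> \<longrightarrow> (\<Sum>(s,t)\<in>D. norm (F t - F s)) < \<epsilon>"
  proof (intro exI conjI allI impI)
    \<comment> \<open>\<open>L + 1\<close> because \<open>L\<close> may be \<open>0\<close>.\<close>
    show "\<epsilon> / (L + 1) > 0" using L \<epsilon> by simp
    fix D :: "(real \<times> real) set"
    assume D: "\<forall>(s,t)\<in>D. a \<le> s \<and> s \<le> t \<and> t \<le> b" "(\<Sum>(s,t)\<in>D. t - s) < \<epsilon> / (L + 1)"
    have "(\<Sum>(s,t)\<in>D. norm (F t - F s)) \<le> (\<Sum>(s,t)\<in>D. (L + 1) * (t - s))"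
    proof (intro sum_mono, safe)
      fix s t assume "(s, t) \<in> D"
      then have st: "a \<le> s" "s \<le> t" "t \<le> b" using D(1) by auto
      then have "norm (F t - F s) \<le> L * norm (t - s)"
        by (intro lipschitz_on_normD[OF assms]) auto
      also have "\<dots> \<le> (L + 1) * (t - s)" using st by (simp add: mult_right_mono)
      finally show "norm (F t - F s) \<le> (L + 1) * (t - s)" .
    qed
    also have "\<dots> = (L + 1) * (\<Sum>(s,t)\<in>D. t - s)" by (simp add: sum_distrib_left case_prod_beta)
    also have "\<dots> < (L + 1) * (\<epsilon> / (L + 1))" using D(2) L by (intro mult_strict_left_mono) auto
    also have "\<dots> = \<epsilon>" using L by simp
    finally show "(\<Sum>(s,t)\<in>D. norm (F t - F s)) < \<epsilon>" .
  qed
qed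

section \<open>Lipschitz functions and essentially bounded functions on an interval\<close>

abbreviation vd :: "(real \<Rightarrow> 'b::real_normed_vector) \<Rightarrow> real \<Rightarrow> 'b" where
  "vd y t \<equiv> vector_derivative y (at t)"

definition ess_bounded :: "real \<Rightarrow> real \<Rightarrow> (real \<Rightarrow> 'b::euclidean_space) \<Rightarrow> bool" where
  "ess_bounded a b f \<longleftrightarrow> f \<in> borel_measurable (lebesgue_on {a..b}) \<and>
    (\<exists>C. AE t in lebesgue_on {a..b}. norm (f t) \<le> C)"

text \<open>These functions are Lipschitz, see \<open>lip_ae_lipschitz\<close>. They are recorded
  through their a.e. derivative because this is what integration by parts and the differential
  equation refer to.\<close>

definition lip_ae :: "real \<Rightarrow> real \<Rightarrow> (real \<Rightarrow> 'b::euclidean_space) \<Rightarrow> bool" where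
  "lip_ae a b y \<longleftrightarrow> abs_cont_on a b y \<and>
    (\<exists>C. AE t in lebesgue_on {a..b}. y differentiable (at t) \<and> norm (vd y t) \<le> C)"

lemma ess_bounded_integrable:
  assumes "ess_bounded a b f" shows "integrable (lebesgue_on {a..b}) f"
proof -
  interpret finite_measure "lebesgue_on {a..b}"
    by (intro finite_measure_lebesgue_on) simp
  show ?thesis using assms integrable_const_bound unfolding ess_bounded_def by blast
qed

lemma ess_bounded_has_integral:
  assumes "ess_bounded a b f"
  shows "(f has_integral (integral\<^sup>L (lebesgue_on {a..b}) f)) {a..b}" "f integrable_on {a..b}"
    "integral {a..b} f = integral\<^sup>L (lebesgue_on {a..b}) f"
  using has_integral_integral_lebesgue_on[OF ess_bounded_integrable[OF assms]]
    lebesgue_integral_eq_integral[OF ess_bounded_integrable[OF assms]] by auto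

lemma ess_boundedI:
  "f \<in> borel_measurable (lebesgue_on {a..b}) \<Longrightarrow> (AE t in lebesgue_on {a..b}. norm (f t) \<le> C) \<Longrightarrow> ess_bounded a b f"
  unfolding ess_bounded_def by blast

lemma ess_bounded_bilinear:
  assumes B: "bounded_bilinear B" and f: "ess_bounded a b f" and g: "ess_bounded a b g"
  shows "ess_bounded a b (\<lambda>t. B (f t) (g t))"
proof -
  interpret B: bounded_bilinear B by (rule B)
  obtain K where K: "K > 0" "\<And>x y. norm (B x y) \<le> norm x * norm y * K" using B.pos_bounded by blast
  obtain C1 C2 where C: "AE t in lebesgue_on {a..b}. norm (f t) \<le> C1" "AE t in lebesgue_on {a..b}. norm (g t) \<le> C2"
    using f g unfolding ess_bounded_def by blast
  have "continuous_on UNIV (\<lambda>x. B (fst x) (snd x))"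
    by (intro B.continuous_on continuous_intros)
  then have "(\<lambda>t. B (f t) (g t)) \<in> borel_measurable (lebesgue_on {a..b})"
    using f g borel_measurable_continuous_Pair[where H = B] unfolding ess_bounded_def by blast
  moreover have "AE t in lebesgue_on {a..b}. norm (B (f t) (g t)) \<le> C1 * C2 * K"
    using C
  proof eventually_elim
    case (elim t)
    have "norm (B (f t) (g t)) \<le> norm (f t) * norm (g t) * K" by (rule K)
    also have "\<dots> \<le> C1 * C2 * K"
      using elim K norm_ge_zero[of "f t"] by (intro mult_right_mono mult_mono) (auto intro: order_trans[OF norm_ge_zero])
    finally show ?case .
  qed
  ultimately show ?thesis by (rule ess_boundedI)
qed

lemma ess_bounded_linear:
  assumes B: "bounded_linear B" and f: "ess_bounded a b f"
  shows "ess_bounded a b (\<lambda>t. B (f t))"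
proof -
  interpret B: bounded_linear B by (rule B)
  obtain K where K: "K > 0" "\<And>x. norm (B x) \<le> norm x * K" using B.pos_bounded by blast
  obtain C where C: "AE t in lebesgue_on {a..b}. norm (f t) \<le> C"
    using f unfolding ess_bounded_def by blast
  have "continuous_on UNIV B" by (intro B.continuous_on continuous_intros)
  then have "B \<in> borel_measurable borel" by (rule borel_measurable_continuous_onI)
  then have "(\<lambda>t. B (f t)) \<in> borel_measurable (lebesgue_on {a..b})"
    using f measurable_compose unfolding ess_bounded_def by blast
  moreover have "AE t in lebesgue_on {a..b}. norm (B (f t)) \<le> C * K"
    using C by eventually_elim (use K in \<open>meson mult_right_mono less_imp_le order_trans\<close>)
  ultimately show ?thesis by (rule ess_boundedI)
qed

lemma ess_bounded_add:
  assumes f: "ess_bounded a b f" and g: "ess_bounded a b g"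
  shows "ess_bounded a b (\<lambda>t. f t + g t)"
proof -
  obtain C1 C2 where C: "AE t in lebesgue_on {a..b}. norm (f t) \<le> C1" "AE t in lebesgue_on {a..b}. norm (g t) \<le> C2"
    using f g unfolding ess_bounded_def by blast
  have "AE t in lebesgue_on {a..b}. norm (f t + g t) \<le> C1 + C2"
    using C by eventually_elim (use norm_triangle_mono in blast)
  then show ?thesis using f g unfolding ess_bounded_def by (auto intro: borel_measurable_add)
qed

lemma ess_bounded_inner:
  "ess_bounded a b f \<Longrightarrow> ess_bounded a b g \<Longrightarrow> ess_bounded a b (\<lambda>t. f t \<bullet> g t)"
  by (rule ess_bounded_bilinear[OF bounded_bilinear_inner])

lemma ess_bounded_minus: "ess_bounded a b f \<Longrightarrow> ess_bounded a b (\<lambda>t. - f t)"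
  by (rule ess_bounded_linear[OF bounded_linear_minus[OF bounded_linear_ident]])

lemma ess_bounded_diff:
  "ess_bounded a b f \<Longrightarrow> ess_bounded a b g \<Longrightarrow> ess_bounded a b (\<lambda>t. f t - g t)"
  using ess_bounded_add[OF _ ess_bounded_minus, of a b f g] by simp

lemma ess_bounded_continuous:
  fixes f :: "real \<Rightarrow> 'b::euclidean_space"
  assumes "continuous_on {a..b} f" shows "ess_bounded a b f"
proof -
  have "bounded (f ` {a..b})" using assms compact_continuous_image compact_imp_bounded by blast
  then obtain C where "\<And>t. t \<in> {a..b} \<Longrightarrow> norm (f t) \<le> C" 
    unfolding bounded_iff by blast
  then have "AE t in lebesgue_on {a..b}. norm (f t) \<le> C" by (intro AE_I2) simp
  then show ?thesis
    using continuous_imp_measurable_on_sets_lebesgue[OF assms] ess_boundedI by auto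
qed

lemma abs_cont_on_mono:
  assumes "abs_cont_on a b y" "a \<le> s" "t \<le> b"
  shows "abs_cont_on s t y"
  unfolding abs_cont_on_def
proof (intro allI impI)
  fix \<epsilon> :: real assume "\<epsilon> > 0"
  then obtain \<delta> where \<delta>: "\<delta> > 0" "\<And>D. finite D \<Longrightarrow> (\<forall>(s,t)\<in>D. a \<le> s \<and> s \<le> t \<and> t \<le> b) \<Longrightarrow>
        (\<forall>(s,t)\<in>D. \<forall>(s',t')\<in>D. (s,t) \<noteq> (s',t') \<longrightarrow> t \<le> s' \<or> t' \<le> s) \<Longrightarrow>
        (\<Sum>(s,t)\<in>D. t - s) < \<delta> \<Longrightarrow> (\<Sum>(s,t)\<in>D. norm (y t - y s)) < \<epsilon>"
    using assms(1) unfolding abs_cont_on_def by meson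
  have "(\<Sum>(s,t)\<in>D. norm (y t - y s)) < \<epsilon>"
    if "finite D" "\<forall>(s',t')\<in>D. s \<le> s' \<and> s' \<le> t' \<and> t' \<le> t"
      "\<forall>(s,t)\<in>D. \<forall>(s',t')\<in>D. (s,t) \<noteq> (s',t') \<longrightarrow> t \<le> s' \<or> t' \<le> s" "(\<Sum>(s,t)\<in>D. t - s) < \<delta>" for D
    by (rule \<delta>(2)[OF that(1) _ that(3,4)]) (use that(2) assms in fastforce)
  then show "\<exists>\<delta>>0. \<forall>D. finite D \<longrightarrow> (\<forall>(s',t')\<in>D. s \<le> s' \<and> s' \<le> t' \<and> t' \<le> t) \<longrightarrow>
      (\<forall>(s,t)\<in>D. \<forall>(s',t')\<in>D. (s,t) \<noteq> (s',t') \<longrightarrow> t \<le> s' \<or> t' \<le> s) \<longrightarrow>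
      (\<Sum>(s,t)\<in>D. t - s) < \<delta> \<longrightarrow> (\<Sum>(s,t)\<in>D. norm (y t - y s)) < \<epsilon>"
    using \<delta>(1) by blast
qed

lemma AE_lebesgue_on_mono:
  assumes "AE t in lebesgue_on {a..b::real}. P t" "a \<le> s" "t \<le> b"
  shows "AE t in lebesgue_on {s..t}. P t"
proof -
  obtain N where N: "negligible N" "\<And>t. t \<in> {a..b} - N \<Longrightarrow> P t" using AE_lebesgue_onD[OF assms(1)] by metis
  show ?thesis by (rule AE_lebesgue_onI[OF N(1)]) (use N(2) assms in auto)
qed

lemma lip_ae_vd:
  assumes "lip_ae a b y"
  shows "AE t in lebesgue_on {a..b}. (y has_vector_derivative vd y t) (at t)"
proof -
  have "AE t in lebesgue_on {a..b}. y differentiable (at t)"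
    using assms unfolding lip_ae_def by (auto intro: AE_mp)
  then show ?thesis by eventually_elim (simp add: vector_derivative_works)
qed

lemma lip_ae_has_integral:
  assumes "lip_ae a b y" "a \<le> s" "s \<le> t" "t \<le> b"
  shows "(vd y has_integral y t - y s) {s..t}"
proof (rule has_integral_abs_cont[OF assms(3)])
  show "abs_cont_on s t y" using assms abs_cont_on_mono unfolding lip_ae_def by blast
  show "AE t in lebesgue_on {s..t}. (y has_vector_derivative vd y t) (at t)"
    by (rule AE_lebesgue_on_mono[OF lip_ae_vd[OF assms(1)] assms(2,4)])
qed

lemma ess_bounded_vd:
  assumes "lip_ae a b y" "a \<le> b"
  shows "ess_bounded a b (vd y)"
proof -
  obtain C where C: "AE t in lebesgue_on {a..b}. y differentiable (at t) \<and> norm (vd y t) \<le> C"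
    using assms(1) unfolding lip_ae_def by blast
  show ?thesis
  proof (rule ess_boundedI)
    show "vd y \<in> borel_measurable (lebesgue_on {a..b})"
      using lip_ae_has_integral[OF assms(1), of a b] assms(2) by (intro integrable_imp_measurable) auto
    show "AE t in lebesgue_on {a..b}. norm (vd y t) \<le> C" using C by eventually_elim simp
  qed
qed

lemma has_integral_bound_AE:
  fixes f :: "real \<Rightarrow> 'b::euclidean_space"
  assumes "(f has_integral i) {s..t}" "AE t in lebesgue_on {s..t}. norm (f t) \<le> C" "C \<ge> 0" "s \<le> t"
  shows "norm i \<le> C * (t - s)"
proof -
  obtain N where N: "negligible N" "\<And>r. r \<in> {s..t} - N \<Longrightarrow> norm (f r) \<le> C"
    using AE_lebesgue_onD[OF assms(2)] by metis
  define g where "g = (\<lambda>r. if r \<in> N then 0 else f r)"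
  have g: "(g has_integral i) {s..t}"
    by (rule has_integral_spike[OF N(1) _ assms(1)]) (simp add: g_def)
  have "norm i \<le> C * measure lborel {s..t}"
    by (rule has_integral_bound_real[OF assms(3) _ g, of "{}"]) (use N(2) assms(3) in \<open>auto simp: g_def\<close>)
  then show ?thesis using assms(4) by simp
qed

lemma lip_ae_lipschitz:
  assumes "lip_ae a b y"
  obtains L where "L-lipschitz_on {a..b} y"
proof -
  obtain C where "AE t in lebesgue_on {a..b}. y differentiable (at t) \<and> norm (vd y t) \<le> C"
    using assms(1) unfolding lip_ae_def by blast
  then have C: "AE t in lebesgue_on {a..b}. norm (vd y t) \<le> max C 0" by eventually_elim auto
  have le: "norm (y t - y s) \<le> max C 0 * (t - s)" if "a \<le> s" "s \<le> t" "t \<le> b" for s t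
    by (rule has_integral_bound_AE[OF lip_ae_has_integral[OF assms that]])
      (use AE_lebesgue_on_mono[OF C] that in auto)
  have "(max C 0)-lipschitz_on {a..b} y"
  proof (rule lipschitz_onI)
    fix s t assume "s \<in> {a..b}" "t \<in> {a..b}"
    then show "dist (y s) (y t) \<le> max C 0 * dist s t"
      using le[of s t] le[of t s] by (cases "s \<le> t") (auto simp: dist_norm dist_real_def norm_minus_commute)
  qed simp
  then show thesis by (rule that)
qed

lemma lip_ae_continuous_on: "lip_ae a b y \<Longrightarrow> continuous_on {a..b} y"
  using lip_ae_lipschitz lipschitz_on_continuous_on by blast

lemma lip_ae_ess_bounded: "lip_ae a b y \<Longrightarrow> ess_bounded a b y"
  using lip_ae_continuous_on ess_bounded_continuous by blast

lemma lip_aeI: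
  assumes L: "abs_cont_on a b y" and f: "AE t in lebesgue_on {a..b}. (y has_vector_derivative f t) (at t)"
    and C: "AE t in lebesgue_on {a..b}. norm (f t) \<le> C"
  shows "lip_ae a b y" "AE t in lebesgue_on {a..b}. vd y t = f t"
proof -
  show *: "AE t in lebesgue_on {a..b}. vd y t = f t" using f by eventually_elim (rule vector_derivative_at)
  have "AE t in lebesgue_on {a..b}. y differentiable (at t) \<and> norm (vd y t) \<le> C"
    using f C * by eventually_elim (auto intro: differentiableI_vector)
  then show "lip_ae a b y" using L unfolding lip_ae_def by blast
qed

lemma lip_ae_bilinear:
  assumes B: "bounded_bilinear B" and u: "lip_ae a b u" and v: "lip_ae a b v" and ab: "a \<le> b"
  shows "lip_ae a b (\<lambda>t. B (u t) (v t))"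
    "AE t in lebesgue_on {a..b}. vd (\<lambda>t. B (u t) (v t)) t = B (u t) (vd v t) + B (vd u t) (v t)"
proof -
  interpret B: bounded_bilinear B by (rule B)
  obtain K where K: "K > 0" "\<And>x y. norm (B x y) \<le> norm x * norm y * K" using B.pos_bounded by blast
  obtain L1 where L1: "L1-lipschitz_on {a..b} u" by (rule lip_ae_lipschitz[OF u])
  obtain L2 where L2: "L2-lipschitz_on {a..b} v" by (rule lip_ae_lipschitz[OF v])
  have "bounded (u ` {a..b})" "bounded (v ` {a..b})"
    using u v lip_ae_continuous_on compact_continuous_image compact_imp_bounded compact_Icc by blast+
  then obtain C1 C2 where C: "\<And>t. t \<in> {a..b} \<Longrightarrow> norm (u t) \<le> C1" "\<And>t. t \<in> {a..b} \<Longrightarrow> norm (v t) \<le> C2"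
    unfolding bounded_iff by blast
  have C0: "C1 \<ge> 0" "C2 \<ge> 0" using ab order_trans[OF norm_ge_zero C(1)[of a]] order_trans[OF norm_ge_zero C(2)[of a]] by auto
  have L0: "L1 \<ge> 0" "L2 \<ge> 0" using L1 L2 lipschitz_on_nonneg by auto
  have "(K * (C1 * L2 + L1 * C2))-lipschitz_on {a..b} (\<lambda>t. B (u t) (v t))"
  proof (rule lipschitz_onI)
    fix s t assume st: "s \<in> {a..b}" "t \<in> {a..b}"
    have "B (u s) (v s) - B (u t) (v t) = B (u s) (v s - v t) + B (u s - u t) (v t)"
      by (simp add: B.diff_left B.diff_right)
    then have "norm (B (u s) (v s) - B (u t) (v t)) \<le> norm (u s) * norm (v s - v t) * K + norm (u s - u t) * norm (v t) * K"
      using norm_triangle_le add_mono K(2) by metis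
    also have "\<dots> \<le> C1 * (L2 * \<bar>s - t\<bar>) * K + (L1 * \<bar>s - t\<bar>) * C2 * K"
      using lipschitz_on_normD[OF L1 st(1,2)] lipschitz_on_normD[OF L2 st(1,2)] C st K C0 L0
      by (intro add_mono mult_right_mono mult_mono) auto
    finally show "dist (B (u s) (v s)) (B (u t) (v t)) \<le> K * (C1 * L2 + L1 * C2) * dist s t"
      by (simp add: dist_norm dist_real_def algebra_simps)
  qed (use K C0 L0 in simp)
  then have ac: "abs_cont_on a b (\<lambda>t. B (u t) (v t))" by (rule lipschitz_imp_abs_cont)
  have d: "AE t in lebesgue_on {a..b}. ((\<lambda>t. B (u t) (v t)) has_vector_derivative B (u t) (vd v t) + B (vd u t) (v t)) (at t)"
    using lip_ae_vd[OF u] lip_ae_vd[OF v] by eventually_elim (rule B.has_vector_derivative)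
  have "ess_bounded a b (\<lambda>t. B (u t) (vd v t) + B (vd u t) (v t))"
    using u v ab by (intro ess_bounded_add ess_bounded_bilinear[OF B] ess_bounded_vd lip_ae_ess_bounded)
  then obtain C where "AE t in lebesgue_on {a..b}. norm (B (u t) (vd v t) + B (vd u t) (v t)) \<le> C"
    unfolding ess_bounded_def by blast
  from lip_aeI[OF ac d this] show "lip_ae a b (\<lambda>t. B (u t) (v t))"
    "AE t in lebesgue_on {a..b}. vd (\<lambda>t. B (u t) (v t)) t = B (u t) (vd v t) + B (vd u t) (v t)" by auto
qed

lemma lip_ae_smooth:
  fixes f :: "real \<Rightarrow> 'b::euclidean_space"
  assumes "\<And>t. (f has_vector_derivative f' t) (at t)" "continuous_on {a..b} f'"
  shows "lip_ae a b f" "AE t in lebesgue_on {a..b}. vd f t = f' t"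
proof -
  obtain C where C: "\<And>t. t \<in> {a..b} \<Longrightarrow> norm (f' t) \<le> C"
    using compact_imp_bounded[OF compact_continuous_image[OF assms(2)]] unfolding bounded_iff by blast
  have "(max C 0)-lipschitz_on {a..b} f"
  proof (rule lipschitz_onI)
    fix s t assume st: "s \<in> {a..b}" "t \<in> {a..b}"
    have "norm (f s - f t) \<le> max C 0 * norm (s - t)"
    proof (rule differentiable_bound[of "{a..b}" f "\<lambda>t h. h *\<^sub>R f' t"])
      show "(f has_derivative (\<lambda>h. h *\<^sub>R f' x)) (at x within {a..b})" for x
        using assms(1)[of x] unfolding has_vector_derivative_def by (rule has_derivative_at_withinI)
      show "onorm (\<lambda>h. h *\<^sub>R f' x) \<le> max C 0" if "x \<in> {a..b}" for x
      proof (rule onorm_bound)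
        have "norm (f' x) \<le> max C 0" using C[OF that] by simp
        then show "norm (h *\<^sub>R f' x) \<le> max C 0 * norm h" for h
          using mult_right_mono[of "norm (f' x)" "max C 0" "\<bar>h\<bar>"] by (simp add: mult.commute)
      qed simp
    qed (use st in auto)
    then show "dist (f s) (f t) \<le> max C 0 * dist s t" by (simp add: dist_norm)
  qed simp
  then have ac: "abs_cont_on a b f" by (rule lipschitz_imp_abs_cont)
  have 1: "AE t in lebesgue_on {a..b}. (f has_vector_derivative f' t) (at t)" using assms(1) by simp
  have 2: "AE t in lebesgue_on {a..b}. norm (f' t) \<le> C" using C by (intro AE_I2) simp
  show "lip_ae a b f" "AE t in lebesgue_on {a..b}. vd f t = f' t" using lip_aeI[OF ac 1 2] by auto
qed

lemma lip_ae_linear: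
  assumes B: "bounded_linear B" and u: "lip_ae a b u" and ab: "a \<le> b"
  shows "lip_ae a b (\<lambda>t. B (u t))" "AE t in lebesgue_on {a..b}. vd (\<lambda>t. B (u t)) t = B (vd u t)"
proof -
  interpret B: bounded_linear B by (rule B)
  obtain K where K: "K > 0" "\<And>x. norm (B x) \<le> norm x * K" using B.pos_bounded by blast
  obtain L1 where L1: "L1-lipschitz_on {a..b} u" by (rule lip_ae_lipschitz[OF u])
  have L0: "L1 \<ge> 0" using L1 lipschitz_on_nonneg by auto
  have "(L1 * K)-lipschitz_on {a..b} (\<lambda>t. B (u t))"
  proof (rule lipschitz_onI)
    fix s t assume st: "s \<in> {a..b}" "t \<in> {a..b}"
    have "norm (B (u s) - B (u t)) \<le> norm (u s - u t) * K" using K(2) B.diff by metis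
    also have "\<dots> \<le> (L1 * norm (s - t)) * K"
      using lipschitz_on_normD[OF L1 st] K by (intro mult_right_mono) auto
    finally show "dist (B (u s)) (B (u t)) \<le> L1 * K * dist s t" by (simp add: dist_norm algebra_simps)
  qed (use K L0 in simp)
  then have ac: "abs_cont_on a b (\<lambda>t. B (u t))" by (rule lipschitz_imp_abs_cont)
  have d: "AE t in lebesgue_on {a..b}. ((\<lambda>t. B (u t)) has_vector_derivative B (vd u t)) (at t)"
    using lip_ae_vd[OF u] by eventually_elim (rule B.has_vector_derivative)
  have "ess_bounded a b (\<lambda>t. B (vd u t))"
    using u ab by (intro ess_bounded_linear[OF B] ess_bounded_vd)
  then obtain C where "AE t in lebesgue_on {a..b}. norm (B (vd u t)) \<le> C"
    unfolding ess_bounded_def by blast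
  from lip_aeI[OF ac d this] show "lip_ae a b (\<lambda>t. B (u t))"
    "AE t in lebesgue_on {a..b}. vd (\<lambda>t. B (u t)) t = B (vd u t)" by auto
qed

lemma lip_ae_add:
  assumes u: "lip_ae a b u" and v: "lip_ae a b v" and ab: "a \<le> b"
  shows "lip_ae a b (\<lambda>t. u t + v t)" "AE t in lebesgue_on {a..b}. vd (\<lambda>t. u t + v t) t = vd u t + vd v t"
proof -
  obtain L1 where L1: "L1-lipschitz_on {a..b} u" by (rule lip_ae_lipschitz[OF u])
  obtain L2 where L2: "L2-lipschitz_on {a..b} v" by (rule lip_ae_lipschitz[OF v])
  have ac: "abs_cont_on a b (\<lambda>t. u t + v t)"
    using lipschitz_on_add[OF L1 L2] by (rule lipschitz_imp_abs_cont)
  have d: "AE t in lebesgue_on {a..b}. ((\<lambda>t. u t + v t) has_vector_derivative vd u t + vd v t) (at t)"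
    using lip_ae_vd[OF u] lip_ae_vd[OF v] by eventually_elim (rule has_vector_derivative_add)
  have "ess_bounded a b (\<lambda>t. vd u t + vd v t)"
    using u v ab by (intro ess_bounded_add ess_bounded_vd)
  then obtain C where "AE t in lebesgue_on {a..b}. norm (vd u t + vd v t) \<le> C"
    unfolding ess_bounded_def by blast
  from lip_aeI[OF ac d this] show "lip_ae a b (\<lambda>t. u t + v t)"
    "AE t in lebesgue_on {a..b}. vd (\<lambda>t. u t + v t) t = vd u t + vd v t" by auto
qed

lemma integral_by_parts:
  fixes u v :: "real \<Rightarrow> 'b::euclidean_space"
  assumes u: "lip_ae a b u" and v: "lip_ae a b v" and ab: "a \<le> b"
  shows "(\<integral>t. u t \<bullet> vd v t + vd u t \<bullet> v t \<partial>lebesgue_on {a..b}) = u b \<bullet> v b - u a \<bullet> v a"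
proof -
  note B = lip_ae_bilinear[OF bounded_bilinear_inner u v ab]
  have e: "ess_bounded a b (\<lambda>t. u t \<bullet> vd v t + vd u t \<bullet> v t)"
    using u v ab by (intro ess_bounded_add ess_bounded_inner ess_bounded_vd lip_ae_ess_bounded)
  have e2: "ess_bounded a b (vd (\<lambda>t. u t \<bullet> v t))" by (rule ess_bounded_vd[OF B(1) ab])
  have "(\<integral>t. u t \<bullet> vd v t + vd u t \<bullet> v t \<partial>lebesgue_on {a..b}) =
      (\<integral>t. vd (\<lambda>t. u t \<bullet> v t) t \<partial>lebesgue_on {a..b})"
    using B(2) e e2 unfolding ess_bounded_def by (intro integral_cong_AE) auto
  also have "\<dots> = integral {a..b} (vd (\<lambda>t. u t \<bullet> v t))"
    using ess_bounded_has_integral(3)[OF e2] by simp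
  also have "\<dots> = u b \<bullet> v b - u a \<bullet> v a"
    using lip_ae_has_integral[OF B(1) order_refl ab order_refl] by (rule integral_unique)
  finally show ?thesis .
qed

lemma abs_cont_on_cong:
  assumes "\<And>t. t \<in> {a..b} \<Longrightarrow> y t = z t"
  shows "abs_cont_on a b y \<longleftrightarrow> abs_cont_on a b z"
proof -
  have "(\<Sum>(s,t)\<in>D. norm (y t - y s)) = (\<Sum>(s,t)\<in>D. norm (z t - z s))"
    if "\<forall>(s,t)\<in>D. a \<le> s \<and> s \<le> t \<and> t \<le> b" for D
    using that assms by (intro sum.cong) auto
  then show ?thesis unfolding abs_cont_on_def by (smt (verit, ccfv_threshold))
qed

lemma has_vector_derivative_cong_on:
  assumes "\<And>t. t \<in> {a..b} \<Longrightarrow> y t = z t" "t \<in> {a..b} - {a, b}" "(y has_vector_derivative d) (at t)"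
  shows "(z has_vector_derivative d) (at t)"
  by (rule has_vector_derivative_transform_within_open[OF assms(3), of "{a<..<b}"]) (use assms in auto)

text \<open>Agreement on \<open>[a, b]\<close> says nothing about two-sided derivatives at the
  endpoints, but these two points form a null set.\<close>

lemma lip_ae_cong:
  assumes "\<And>t. t \<in> {a..b} \<Longrightarrow> y t = z t" "lip_ae a b y"
  shows "lip_ae a b z" "AE t in lebesgue_on {a..b}. vd z t = vd y t"
proof -
  obtain N where N: "negligible N" "\<And>t. t \<in> {a..b} - N \<Longrightarrow> (y has_vector_derivative vd y t) (at t)"
    using AE_lebesgue_onD[OF lip_ae_vd[OF assms(2)]] by metis
  have d: "AE t in lebesgue_on {a..b}. (z has_vector_derivative vd y t) (at t)"
  proof (rule AE_lebesgue_onI)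
    show "negligible (N \<union> {a, b})" using N by (intro negligible_Un) auto
    show "(z has_vector_derivative vd y t) (at t)" if "t \<in> {a..b} - (N \<union> {a, b})" for t
      by (rule has_vector_derivative_cong_on[OF assms(1)]) (use that N(2) in auto)
  qed
  obtain C where "AE t in lebesgue_on {a..b}. y differentiable (at t) \<and> norm (vd y t) \<le> C"
    using assms(2) unfolding lip_ae_def by blast
  then have C: "AE t in lebesgue_on {a..b}. norm (vd y t) \<le> C" by eventually_elim simp
  have ac: "abs_cont_on a b z" using abs_cont_on_cong[of a b y z] assms unfolding lip_ae_def by blast
  show "lip_ae a b z" "AE t in lebesgue_on {a..b}. vd z t = vd y t" using lip_aeI[OF ac d C] by auto
qed

text \<open>Lebesgue differentiation enters here. Primitives built this way are the source of
  quasi-derivatives and test functions in the regularity argument.\<close>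

lemma lip_ae_integral:
  fixes f :: "real \<Rightarrow> 'b::euclidean_space"
  assumes f: "ess_bounded a b f"
  shows "lip_ae a b (\<lambda>t. c + integral {a..t} f)"
    "AE t in lebesgue_on {a..b}. vd (\<lambda>t. c + integral {a..t} f) t = f t"
proof -
  let ?F = "\<lambda>t. c + integral {a..t} f"
  note int = ess_bounded_has_integral(2)[OF f]
  obtain C0 where C0: "AE t in lebesgue_on {a..b}. norm (f t) \<le> C0" using f unfolding ess_bounded_def by blast
  define C where "C = max C0 0"
  have C: "AE t in lebesgue_on {a..b}. norm (f t) \<le> C" using C0 by eventually_elim (simp add: C_def)
  have le: "norm (?F t - ?F s) \<le> C * (t - s)" if st: "a \<le> s" "s \<le> t" "t \<le> b" for s t
  proof -
    have i: "f integrable_on {a..t}" "f integrable_on {s..t}"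
      by (rule integrable_on_subinterval[OF int]; use st in simp)+
    have "integral {a..s} f + integral {s..t} f = integral {a..t} f"
      using st by (intro Henstock_Kurzweil_Integration.integral_combine i) auto
    then have e: "?F t - ?F s = integral {s..t} f" by (simp add: algebra_simps)
    show ?thesis unfolding e
      by (rule has_integral_bound_AE[OF integrable_integral[OF i(2)] AE_lebesgue_on_mono[OF C st(1,3)]])
        (use st in \<open>auto simp: C_def\<close>)
  qed
  have "C-lipschitz_on {a..b} ?F"
  proof (rule lipschitz_onI)
    fix s t assume "s \<in> {a..b}" "t \<in> {a..b}"
    then show "dist (?F s) (?F t) \<le> C * dist s t"
      using le[of s t] le[of t s] by (cases "s \<le> t") (auto simp: dist_norm dist_real_def norm_minus_commute)
  qed (simp add: C_def)
  then have ac: "abs_cont_on a b ?F" by (rule lipschitz_imp_abs_cont)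
  obtain N where N: "negligible N"
    "\<And>x. x \<in> {a..b} - N \<Longrightarrow> ((\<lambda>t. integral {a..t} f) has_vector_derivative f x) (at x)"
    using lebesgue_differentiation[OF int] by metis
  have d: "AE t in lebesgue_on {a..b}. (?F has_vector_derivative f t) (at t)"
    by (rule AE_lebesgue_onI[OF N(1)])
      (use has_vector_derivative_add[OF has_vector_derivative_const N(2)] in simp)
  show "lip_ae a b ?F" "AE t in lebesgue_on {a..b}. vd ?F t = f t" using lip_aeI[OF ac d C] by auto
qed

section \<open>Forms of a Sturm--Liouville problem\<close>

lemma cm_mv_nth: "(cm M *v x) $ i = (\<Sum>j\<in>UNIV. M $ i $ j *\<^sub>R x $ j)"
  by (simp add: matrix_vector_mult_def cm_def scaleR_conv_of_real)

lemma bounded_bilinear_cm: "bounded_bilinear (\<lambda>(M::real^'d::finite^'d) (x::complex^'d). cm M *v x)"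
  unfolding bilinear_conv_bounded_bilinear[symmetric] bilinear_def
proof (intro conjI allI linearI)
  fix M N :: "real^'d^'d" and x y :: "complex^'d" and r :: real
  show "cm (M + N) *v x = cm M *v x + cm N *v x" "cm M *v (x + y) = cm M *v x + cm M *v y"
    by (simp_all add: vec_eq_iff cm_mv_nth scaleR_left_distrib scaleR_right_distrib sum.distrib)
  show "cm (r *\<^sub>R M) *v x = r *\<^sub>R (cm M *v x)"
    by (simp add: vec_eq_iff cm_mv_nth scaleR_sum_right)
  show "cm M *v (r *\<^sub>R x) = r *\<^sub>R (cm M *v x)"
    by (simp add: vec_eq_iff cm_mv_nth scaleR_sum_right mult.commute)
qed

interpretation cm: bounded_bilinear "\<lambda>(M::real^'d::finite^'d) (x::complex^'d). cm M *v x"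
  by (rule bounded_bilinear_cm)

lemma cm_symmetric:
  fixes x y :: "complex^'d::finite"
  assumes "transpose M = M" shows "(cm M *v x) \<bullet> y = x \<bullet> (cm M *v y)"
proof -
  have "M $ i $ j = M $ j $ i" for i j
    using assms by (metis transpose_def vec_lambda_beta)
  then show ?thesis
    unfolding inner_vec_def cm_mv_nth inner_sum_left inner_sum_right
    by (subst sum.swap) simp
qed

text \<open>A real matrix acts on real and imaginary parts separately, so the real inequality is
  applied to each.\<close>

lemma cm_coercive:
  fixes x :: "complex^'d::finite" and M :: "real^'d^'d"
  assumes "\<And>x. \<mu> * (x \<bullet> x) \<le> x \<bullet> (M *v x)"
  shows "\<mu> * (x \<bullet> x) \<le> x \<bullet> (cm M *v x)"
proof -
  let ?r = "\<chi> i. Re (x $ i)" and ?i = "\<chi> i. Im (x $ i)"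
  have 1: "x \<bullet> x = ?r \<bullet> ?r + ?i \<bullet> ?i"
    by (simp add: inner_vec_def inner_complex_def sum.distrib)
  have 2: "x \<bullet> (cm M *v x) = ?r \<bullet> (M *v ?r) + ?i \<bullet> (M *v ?i)"
    by (simp add: inner_vec_def inner_complex_def sum.distrib cm_def matrix_vector_mult_def)
  show ?thesis unfolding 1 2 distrib_left using assms by (intro add_mono)
qed

lemma inner_rotate: "(\<i> *s x) \<bullet> (\<i> *s y) = x \<bullet> (y :: complex^'n::finite)"
  by (simp add: inner_vec_def inner_complex_def add.commute)

lemma of_real_vector_scalar: "complex_of_real r *s x = r *\<^sub>R (x :: complex^'n::finite)"
  by (simp add: vec_eq_iff vector_scalar_mult_def scaleR_conv_of_real[of r "x $ _"])

lemma norm_le_of_coercive: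
  fixes x y :: "'a::real_inner"
  assumes "\<mu> * (x \<bullet> x) \<le> x \<bullet> y" "\<mu> > 0" shows "norm x \<le> norm y / \<mu>"
proof (cases "x = 0")
  case False
  have "\<mu> * norm x * norm x \<le> norm x * norm y"
    using assms(1) norm_cauchy_schwarz[of x y] by (simp add: power2_norm_eq_inner[symmetric] power2_eq_square)
  then have "norm x * (\<mu> * norm x) \<le> norm x * norm y" by (simp add: mult_ac)
  then have "\<mu> * norm x \<le> norm y" using False by (simp add: mult_le_cancel_left)
  then show ?thesis using assms(2) by (simp add: field_simps)
qed (use assms in simp)

text \<open>The solution of \<open>A x = v\<close> by Cramer's rule: it consists of determinants and
  one reciprocal, which makes its measurability in a parameter evident.\<close>

definition cramer_solve :: "complex^'d::finite^'d \<Rightarrow> complex^'d \<Rightarrow> complex^'d" where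
  "cramer_solve A v = inverse (det A) *s (\<chi> k. det (\<chi> i j. if j = k then v $ i else A $ i $ j))"

lemma cramer_solve: "det A \<noteq> 0 \<Longrightarrow> A *v x = v \<longleftrightarrow> x = cramer_solve A v"
  unfolding cramer cramer_solve_def by (simp add: vector_scalar_mult_def divide_inverse mult.commute)

lemma cramer_solve_eq: "det A \<noteq> 0 \<Longrightarrow> A *v cramer_solve A v = v"
  using cramer_solve by blast

lemma cramer_solve_measurable:
  fixes A :: "real \<Rightarrow> complex^'d::finite^'d"
  assumes A: "A \<in> borel_measurable M" and v: "v \<in> borel_measurable M"
  shows "(\<lambda>t. cramer_solve (A t) (v t)) \<in> borel_measurable M"
proof -
  have "continuous_on UNIV (\<lambda>A::complex^'d^'d. det A)"
    unfolding det_def by (intro continuous_intros)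
  then have 1: "(\<lambda>t. inverse (det (A t))) \<in> borel_measurable M"
    using borel_measurable_continuous_on[OF _ A] by (intro borel_measurable_inverse) blast
  have "continuous_on UNIV (\<lambda>x::(complex^'d^'d) \<times> (complex^'d).
      \<chi> k. det (\<chi> i j. if j = k then snd x $ i else fst x $ i $ j))"
  proof -
    have "continuous_on UNIV (\<lambda>x::(complex^'d^'d) \<times> (complex^'d). if p = k then snd x $ i else fst x $ i $ p)" for i p k
      by (cases "p = k") (auto intro!: continuous_intros)
    then show ?thesis
      unfolding det_def by (intro continuous_intros) simp
  qed
  from borel_measurable_continuous_Pair[OF A v this]
  have 2: "(\<lambda>t. \<chi> k. det (\<chi> i j. if j = k then v t $ i else A t $ i $ j)) \<in> borel_measurable M" by simp
  have "continuous_on UNIV (\<lambda>x::complex \<times> (complex^'d). fst x *s snd x)"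
    unfolding vector_scalar_mult_def by (intro continuous_intros)
  from borel_measurable_continuous_Pair[OF 1 2 this] show ?thesis
    unfolding cramer_solve_def by simp
qed

lemma cm_det_nonzero:
  fixes M :: "real^'d::finite^'d"
  assumes "\<And>x. \<mu> * (x \<bullet> x) \<le> x \<bullet> (M *v x)" "\<mu> > 0"
  shows "det (cm M) \<noteq> 0"
proof -
  have "x = 0" if "cm M *v x = 0" for x
    using cm_coercive[OF assms(1), of x] that assms(2) norm_le_of_coercive[of \<mu> x 0] by simp
  then have "\<exists>B. B ** cm M = mat 1" by (simp add: matrix_left_invertible_ker)
  then have "invertible (cm M)" unfolding invertible_def using matrix_left_right_inverse by blast
  then show ?thesis using invertible_det_nz by blast
qed

lemma ess_bounded_cm:
  fixes P :: "real \<Rightarrow> real^'d::finite^'d"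
  shows "ess_bounded a b P \<Longrightarrow> ess_bounded a b f \<Longrightarrow> ess_bounded a b (\<lambda>t. cm (P t) *v f t)"
  by (rule ess_bounded_bilinear[OF bounded_bilinear_cm])

text \<open>One rule for additivity (\<open>r = 1\<close>) and for homogeneity
  (\<open>f = 0\<close>).\<close>

lemma ess_integral_linear:
  fixes f g h :: "real \<Rightarrow> real"
  assumes f: "ess_bounded a b f" and g: "ess_bounded a b g" and h: "ess_bounded a b h"
    and eq: "AE t in lebesgue_on {a..b}. h t = f t + r * g t"
  shows "integral\<^sup>L (lebesgue_on {a..b}) h = integral\<^sup>L (lebesgue_on {a..b}) f + r * integral\<^sup>L (lebesgue_on {a..b}) g"
proof -
  note i = ess_bounded_integrable
  have "integral\<^sup>L (lebesgue_on {a..b}) h = (\<integral>t. f t + r * g t \<partial>lebesgue_on {a..b})"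
    using i[OF f] i[OF g] i[OF h] eq by (intro integral_cong_AE) (auto intro: borel_measurable_integrable)
  also have "\<dots> = integral\<^sup>L (lebesgue_on {a..b}) f + (\<integral>t. r * g t \<partial>lebesgue_on {a..b})"
    using i[OF f] i[OF g] by (intro Bochner_Integration.integral_add) auto
  finally show ?thesis by simp
qed

lemma ess_integral_cong:
  fixes f g :: "real \<Rightarrow> real"
  assumes "ess_bounded a b f" "ess_bounded a b g" "AE t in lebesgue_on {a..b}. f t = g t"
  shows "integral\<^sup>L (lebesgue_on {a..b}) f = integral\<^sup>L (lebesgue_on {a..b}) g"
  using assms by (intro integral_cong_AE) (auto simp: ess_bounded_def)

lemma ess_integral_mono:
  fixes f g :: "real \<Rightarrow> real"
  assumes "ess_bounded a b f" "ess_bounded a b g" "AE t in lebesgue_on {a..b}. f t \<le> g t"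
  shows "integral\<^sup>L (lebesgue_on {a..b}) f \<le> integral\<^sup>L (lebesgue_on {a..b}) g"
  using assms by (intro integral_mono_AE ess_bounded_integrable)

lemma ess_bounded_const: "ess_bounded a b (\<lambda>t. c)"
  by (rule ess_bounded_continuous) simp

lemma ess_bounded_cmult: "ess_bounded a b f \<Longrightarrow> ess_bounded a b (\<lambda>t. r * f t :: real)"
  by (rule ess_bounded_linear[OF bounded_linear_mult_right])

text \<open>The pointwise bound is split into an integrable part, which may be integrated over the whole
  interval, and a constant part, which sees the length of the subinterval; this replaces the
  Cauchy--Schwarz inequality in the equicontinuity estimate.\<close>
lemma norm_subintegral_bound:
  fixes f :: "real \<Rightarrow> 'b::euclidean_space"
  assumes f: "ess_bounded a b f" and g: "ess_bounded a b g"
    and le: "AE t in lebesgue_on {a..b}. norm (f t) \<le> g t + k" and g0: "\<And>t. g t \<ge> 0"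
    and st: "a \<le> s" "s \<le> t" "t \<le> b"
  shows "norm (integral {s..t} f) \<le> integral\<^sup>L (lebesgue_on {a..b}) g + k * (t - s)"
proof -
  obtain N where N: "negligible N" "\<And>t. t \<in> {a..b} - N \<Longrightarrow> norm (f t) \<le> g t + k" using AE_lebesgue_onD[OF le] by metis
  define f' where "f' = (\<lambda>t. if t \<in> N then 0 else f t)"
  define h where "h = (\<lambda>t. if t \<in> N then 0 else g t + k)"
  have sub: "{s..t} \<subseteq> {a..b}" using st by auto
  have fi: "f integrable_on {s..t}" and gi: "g integrable_on {s..t}"
    by (rule integrable_on_subinterval[OF ess_bounded_has_integral(2) sub]; fact f g)+
  have ki: "(\<lambda>t. g t + k) integrable_on {s..t}"
    by (intro integrable_add gi integrable_const_ivl)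
  have hi: "h integrable_on {s..t}"
    by (rule integrable_spike[OF ki N(1)]) (simp add: h_def)
  have fi': "f' integrable_on {s..t}"
    by (rule integrable_spike[OF fi N(1)]) (simp add: f'_def)
  have "norm (integral {s..t} f') \<le> integral {s..t} h"
    by (rule integral_norm_bound_integral[OF fi' hi]) (use N(2) sub in \<open>auto simp: f'_def h_def\<close>)
  moreover have "integral {s..t} f' = integral {s..t} f"
    by (rule integral_spike[OF N(1)]) (simp add: f'_def)
  moreover have "integral {s..t} h = integral {s..t} (\<lambda>t. g t + k)"
    by (rule integral_spike[OF N(1)]) (simp add: h_def)
  moreover have "integral {s..t} (\<lambda>t. g t + k) = integral {s..t} g + k * (t - s)"
    using st by (subst Henstock_Kurzweil_Integration.integral_add) (auto intro: gi)
  moreover have "integral {s..t} g \<le> integral {a..b} g"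
    by (rule integral_subset_le[OF sub gi ess_bounded_has_integral(2)[OF g]]) (use g0 in auto)
  ultimately show ?thesis using ess_bounded_has_integral(3)[OF g] by simp
qed

section \<open>The form domain and its two forms\<close>

definition fsc :: "complex \<Rightarrow> (real \<Rightarrow> complex^'d::finite) \<Rightarrow> real \<Rightarrow> complex^'d" where
  "fsc c y = (\<lambda>t. c *s y t)"

interpretation fs: vector_space fsc
  by unfold_locales (auto simp: fsc_def fun_eq_iff plus_fun_def vec.scale_right_distrib vec.scale_left_distrib)

text \<open>The sign is chosen so that the boundary term of an integration by parts,
  \<open>u b \<bullet> z b - u a \<bullet> z a\<close>, is the inner product
  \<open>bvec (u a) (u b) \<bullet> bd a b z\<close>.\<close>

definition bd :: "real \<Rightarrow> real \<Rightarrow> (real \<Rightarrow> complex^'d::finite) \<Rightarrow> complex^('d + 'd)" where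
  "bd a b y = bvec (- y a) (y b)"

lemma bvec_add: "bvec (x + x') (y + y') = bvec x y + bvec x' y'"
  by (auto simp: bvec_def vec_eq_iff split: sum.split)

lemma bvec_scale: "bvec (c *s x) (c *s y) = c *s bvec x y"
  by (auto simp: bvec_def vec_eq_iff split: sum.split)

lemma bvec_inner: "bvec x y \<bullet> bvec x' y' = x \<bullet> x' + y \<bullet> y'"
proof -
  have "bvec x y \<bullet> bvec x' y' = (\<Sum>i\<in>range Inl. bvec x y $ i \<bullet> bvec x' y' $ i) + (\<Sum>i\<in>range Inr. bvec x y $ i \<bullet> bvec x' y' $ i)"
    unfolding inner_vec_def UNIV_sum by (rule sum.union_disjoint) auto
  then show ?thesis
    by (simp add: sum.reindex bvec_def inner_vec_def)
qed

lemma bd_add: "bd a b (y + z) = bd a b y + bd a b z"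
  by (simp add: bd_def bvec_add[symmetric])

lemma bd_scale: "bd a b (fsc c y) = c *s bd a b y"
  by (simp add: bd_def fsc_def bvec_scale[symmetric])

lemma norm_bd: "(norm (bd a b y))\<^sup>2 = (norm (y a))\<^sup>2 + (norm (y b))\<^sup>2"
  by (simp add: power2_norm_eq_inner bd_def bvec_inner)

lemma linear_scalar: "bounded_linear (\<lambda>x::complex^'d::finite. c *s x)"
  unfolding linear_conv_bounded_linear[symmetric] by (rule linearI) (simp_all add: vec_eq_iff algebra_simps)

text \<open>The boundary condition enters only through the subspace \<open>V\<close> and the form
  \<open>\<beta>\<close>. One \<open>\<mu>\<close> bounds \<open>P\<close> and \<open>W\<close> from
  below and one \<open>C\<close> bounds coefficients and \<open>\<beta>\<close> from above, so that
  all problems near a given one can be instances with the same \<open>\<mu>\<close> and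
  \<open>C\<close>.\<close>

locale sl_form =
  fixes a b :: real and P Q W :: "real \<Rightarrow> real^'d::finite^'d"
    and V :: "(complex^('d + 'd)) set" and \<beta> :: "complex^('d + 'd) \<Rightarrow> complex^('d + 'd) \<Rightarrow> real"
    and \<mu> C :: real
  assumes ab: "a < b" and \<mu>: "\<mu> > 0" and C: "C > 0"
    and ess: "ess_bounded a b P" "ess_bounded a b Q" "ess_bounded a b W"
    and AE_sym: "AE t in lebesgue_on {a..b}. transpose (P t) = P t \<and> transpose (Q t) = Q t \<and> transpose (W t) = W t"
    and AE_pos: "AE t in lebesgue_on {a..b}. (\<forall>x::real^'d. \<mu> * (x \<bullet> x) \<le> x \<bullet> (P t *v x)) \<and>
      (\<forall>x::real^'d. \<mu> * (x \<bullet> x) \<le> x \<bullet> (W t *v x))"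
    and AE_bound: "AE t in lebesgue_on {a..b}. \<forall>x::complex^'d. norm (cm (P t) *v x) \<le> C * norm x \<and>
      norm (cm (Q t) *v x) \<le> C * norm x \<and> norm (cm (W t) *v x) \<le> C * norm x"
    and V: "vec.subspace V"
    and \<beta>_sym: "Y \<in> V \<Longrightarrow> Z \<in> V \<Longrightarrow> \<beta> Y Z = \<beta> Z Y"
    and \<beta>_add: "X \<in> V \<Longrightarrow> Y \<in> V \<Longrightarrow> Z \<in> V \<Longrightarrow> \<beta> (X + Y) Z = \<beta> X Z + \<beta> Y Z"
    and \<beta>_scale: "Y \<in> V \<Longrightarrow> Z \<in> V \<Longrightarrow> \<beta> (r *\<^sub>R Y) Z = r * \<beta> Y Z"
    and \<beta>_rotate: "Y \<in> V \<Longrightarrow> Z \<in> V \<Longrightarrow> \<beta> (\<i> *s Y) (\<i> *s Z) = \<beta> Y Z"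
    and \<beta>_bound: "Y \<in> V \<Longrightarrow> Z \<in> V \<Longrightarrow> \<bar>\<beta> Y Z\<bar> \<le> C * norm Y * norm Z"
begin

abbreviation M :: "real measure" where "M \<equiv> lebesgue_on {a..b}"

lemma ab': "a \<le> b" using ab by simp

text \<open>Functions vanish outside \<open>[a, b]\<close>, so that equality of functions means equality on \<open>[a, b]\<close>.\<close>
definition D :: "(real \<Rightarrow> complex^'d) set" where
  "D = {y. (\<forall>t. t \<notin> {a..b} \<longrightarrow> y t = 0) \<and> lip_ae a b y \<and> bd a b y \<in> V}"

definition iq :: "(real \<Rightarrow> complex^'d) \<Rightarrow> (real \<Rightarrow> complex^'d) \<Rightarrow> real \<Rightarrow> real" where
  "iq y z t = (cm (P t) *v vd y t) \<bullet> vd z t + (cm (Q t) *v y t) \<bullet> z t"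

definition iw :: "(real \<Rightarrow> complex^'d) \<Rightarrow> (real \<Rightarrow> complex^'d) \<Rightarrow> real \<Rightarrow> real" where
  "iw y z t = (cm (W t) *v y t) \<bullet> z t"

definition q :: "(real \<Rightarrow> complex^'d) \<Rightarrow> (real \<Rightarrow> complex^'d) \<Rightarrow> real" where
  "q y z = integral\<^sup>L M (iq y z) + \<beta> (bd a b y) (bd a b z)"

definition w :: "(real \<Rightarrow> complex^'d) \<Rightarrow> (real \<Rightarrow> complex^'d) \<Rightarrow> real" where
  "w y z = integral\<^sup>L M (iw y z)"

lemma cm_swap: "transpose A = A \<Longrightarrow> (cm A *v x) \<bullet> y = (cm A *v y) \<bullet> (x :: complex^'d)"
  by (subst cm_symmetric) (auto simp: inner_commute)

lemma DD: "y \<in> D \<Longrightarrow> lip_ae a b y" "y \<in> D \<Longrightarrow> bd a b y \<in> V" "y \<in> D \<Longrightarrow> t \<notin> {a..b} \<Longrightarrow> y t = 0"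
  by (auto simp: D_def)

lemma ess_vd: "lip_ae a b y \<Longrightarrow> ess_bounded a b (vd y)"
  by (rule ess_bounded_vd[OF _ ab'])

lemma ess_iq: "lip_ae a b y \<Longrightarrow> lip_ae a b z \<Longrightarrow> ess_bounded a b (iq y z)"
  unfolding iq_def by (intro ess_bounded_add ess_bounded_inner ess_bounded_cm ess ess_vd lip_ae_ess_bounded)

lemma ess_iw: "ess_bounded a b y \<Longrightarrow> ess_bounded a b z \<Longrightarrow> ess_bounded a b (iw y z)"
  unfolding iw_def by (intro ess_bounded_inner ess_bounded_cm ess)

lemma lip_fsc: "lip_ae a b y \<Longrightarrow> lip_ae a b (fsc c y)"
  "lip_ae a b y \<Longrightarrow> AE t in M. vd (fsc c y) t = c *s vd y t"
  unfolding fsc_def using lip_ae_linear[OF linear_scalar _ ab'] by auto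

lemma lip_plus: "lip_ae a b y \<Longrightarrow> lip_ae a b z \<Longrightarrow> lip_ae a b (y + z)"
  "lip_ae a b y \<Longrightarrow> lip_ae a b z \<Longrightarrow> AE t in M. vd (y + z) t = vd y t + vd z t"
  unfolding plus_fun_def using lip_ae_add[OF _ _ ab'] by auto

lemma lip_zero: "lip_ae a b (0 :: real \<Rightarrow> complex^'d)"
  using lip_ae_smooth(1)[of "\<lambda>t. 0 :: complex^'d" "\<lambda>t. 0"] by (simp add: zero_fun_def)

lemma subspace_D: "fs.subspace D"
proof (rule fs.subspaceI)
  show "0 \<in> D"
    using lip_zero vec.subspace_0[OF V] bd_scale[of a b 0 "0 :: real \<Rightarrow> complex^'d"] by (simp add: D_def)
next
  fix x y assume "x \<in> D" "y \<in> D"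
  then show "x + y \<in> D"
    by (auto simp: D_def bd_add vec.subspace_add[OF V] intro!: lip_plus(1))
next
  fix c x assume x: "x \<in> D"
  have "fsc c x t = 0" if "t \<notin> {a..b}" for t
    using DD(3)[OF x that] by (simp add: fsc_def)
  then show "fsc c x \<in> D"
    using x lip_fsc(1)[of x c] vec.subspace_scale[OF V, of "bd a b x" c] by (simp add: D_def bd_scale)
qed

lemma real_V: "Y \<in> V \<Longrightarrow> r *\<^sub>R Y \<in> V"
  using vec.subspace_scale[OF V, of Y "complex_of_real r"] by (simp add: of_real_vector_scalar)

lemma hform_q: "hform fsc D q"
proof unfold_locales
  show "fs.subspace D" by (rule subspace_D)
next
  fix y z assume yz: "y \<in> D" "z \<in> D"
  have "AE t in M. iq y z t = iq z y t"
    using AE_sym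
  proof eventually_elim
    case (elim t)
    then show ?case
      using cm_swap[of "P t" "vd y t" "vd z t"] cm_swap[of "Q t" "y t" "z t"] by (simp add: iq_def)
  qed
  then show "q y z = q z y"
    unfolding q_def using ess_integral_cong[OF ess_iq[OF DD(1)[OF yz(1)] DD(1)[OF yz(2)]] ess_iq[OF DD(1)[OF yz(2)] DD(1)[OF yz(1)]]]
      \<beta>_sym[OF DD(2)[OF yz(1)] DD(2)[OF yz(2)]] by simp
next
  fix x y z assume xyz: "x \<in> D" "y \<in> D" "z \<in> D"
  then have l: "lip_ae a b x" "lip_ae a b y" "lip_ae a b z" using DD by blast+
  have "AE t in M. iq (x + y) z t = iq x z t + 1 * iq y z t"
    using lip_plus(2)[OF l(1,2)]
    by eventually_elim (simp add: iq_def cm.add_right inner_add_left)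
  then show "q (x + y) z = q x z + q y z"
    unfolding q_def bd_add using ess_integral_linear[OF ess_iq[OF l(1,3)] ess_iq[OF l(2,3)] ess_iq[OF lip_plus(1)[OF l(1,2)] l(3)], of 1]
      \<beta>_add[OF DD(2)[OF xyz(1)] DD(2)[OF xyz(2)] DD(2)[OF xyz(3)]] by simp
next
  fix x y and r :: real assume xy: "x \<in> D" "y \<in> D"
  then have l: "lip_ae a b x" "lip_ae a b y" using DD by blast+
  have "AE t in M. iq (fsc (of_real r) x) y t = 0 + r * iq x y t"
    using lip_fsc(2)[OF l(1), of "of_real r"]
    by eventually_elim (simp add: iq_def of_real_vector_scalar fsc_def cm.scaleR_right algebra_simps)
  then show "q (fsc (of_real r) x) y = r * q x y"
    unfolding q_def bd_scale of_real_vector_scalar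
    using ess_integral_linear[OF ess_bounded_const[of a b 0] ess_iq[OF l] ess_iq[OF lip_fsc(1)[OF l(1)] l(2)]]
      \<beta>_scale[OF DD(2)[OF xy(1)] DD(2)[OF xy(2)]] by (simp add: distrib_left)
next
  fix x y assume xy: "x \<in> D" "y \<in> D"
  then have l: "lip_ae a b x" "lip_ae a b y" using DD by blast+
  have "AE t in M. iq (fsc \<i> x) (fsc \<i> y) t = iq x y t"
    using lip_fsc(2)[OF l(1), of \<i>] lip_fsc(2)[OF l(2), of \<i>]
    by eventually_elim (simp add: iq_def fsc_def vector_scalar_commute inner_rotate)
  then show "q (fsc \<i> x) (fsc \<i> y) = q x y"
    unfolding q_def bd_scale
    using ess_integral_cong[OF ess_iq[OF lip_fsc(1)[OF l(1)] lip_fsc(1)[OF l(2)]] ess_iq[OF l]]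
      \<beta>_rotate[OF DD(2)[OF xy(1)] DD(2)[OF xy(2)]] by simp
qed

lemma hform_w: "hform fsc D w"
proof unfold_locales
  show "fs.subspace D" by (rule subspace_D)
next
  fix y z assume yz: "y \<in> D" "z \<in> D"
  then have l: "ess_bounded a b y" "ess_bounded a b z" using DD(1) lip_ae_ess_bounded by blast+
  have "AE t in M. iw y z t = iw z y t"
    using AE_sym
  proof eventually_elim
    case (elim t)
    then show ?case using cm_swap[of "W t" "y t" "z t"] by (simp add: iw_def)
  qed
  then show "w y z = w z y"
    unfolding w_def using ess_integral_cong[OF ess_iw[OF l] ess_iw[OF l(2,1)]] by blast
next
  fix x y z assume xyz: "x \<in> D" "y \<in> D" "z \<in> D"
  then have l: "ess_bounded a b x" "ess_bounded a b y" "ess_bounded a b z" using DD(1) lip_ae_ess_bounded by blast+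
  have l2: "ess_bounded a b (x + y)" using ess_bounded_add[OF l(1,2)] by (simp add: plus_fun_def)
  have "AE t in M. iw (x + y) z t = iw x z t + 1 * iw y z t"
    by (simp add: iw_def cm.add_right inner_add_left)
  then show "w (x + y) z = w x z + w y z"
    unfolding w_def using ess_integral_linear[OF ess_iw[OF l(1,3)] ess_iw[OF l(2,3)] ess_iw[OF l2 l(3)], of 1] by simp
next
  fix x y and r :: real assume xy: "x \<in> D" "y \<in> D"
  then have l: "ess_bounded a b x" "ess_bounded a b y" "ess_bounded a b (fsc (of_real r) x)"
    using DD(1) lip_ae_ess_bounded lip_fsc(1) by blast+
  have "AE t in M. iw (fsc (of_real r) x) y t = 0 + r * iw x y t"
    by (simp add: iw_def of_real_vector_scalar fsc_def cm.scaleR_right)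
  then show "w (fsc (of_real r) x) y = r * w x y"
    unfolding w_def using ess_integral_linear[OF ess_bounded_const[of a b 0] ess_iw[OF l(1,2)] ess_iw[OF l(3,2)]] by simp
next
  fix x y assume xy: "x \<in> D" "y \<in> D"
  then show "w (fsc \<i> x) (fsc \<i> y) = w x y"
    unfolding w_def by (simp add: iw_def[abs_def] fsc_def vector_scalar_commute inner_rotate)
qed

end

section \<open>Energy estimates\<close>

context sl_form begin

definition deriv_sq :: "(real \<Rightarrow> complex^'d) \<Rightarrow> real" where
  "deriv_sq y = (\<integral>t. vd y t \<bullet> vd y t \<partial>M)"

definition fun_sq :: "(real \<Rightarrow> complex^'d) \<Rightarrow> real" where
  "fun_sq y = (\<integral>t. y t \<bullet> y t \<partial>M)"

lemma deriv_sq_nonneg: "deriv_sq y \<ge> 0" and fun_sq_nonneg: "fun_sq y \<ge> 0"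
  by (simp_all add: deriv_sq_def fun_sq_def)

lemma integral_const: "(\<integral>t. c \<partial>M) = (b - a) * (c::real)"
  using ab' by (simp add: measure_restrict_space)

text \<open>The derivative of \<open>|y|^2\<close> is bounded by \<open>g\<close>, a weighted Young
  bound for \<open>2 (y \<bullet> y')\<close>. So \<open>|y|^2\<close> oscillates by at most the
  integral of \<open>g\<close>, and its value at \<open>t\<close> exceeds its mean over the interval
  by no more than that.\<close>

lemma sobolev:
  assumes y: "lip_ae a b y" and \<epsilon>: "\<epsilon> > 0" and t: "t \<in> {a..b}"
  shows "(norm (y t))\<^sup>2 \<le> \<epsilon> * deriv_sq y + (1 / \<epsilon> + 1 / (b - a)) * fun_sq y"
proof -
  define \<phi> where "\<phi> = (\<lambda>t. y t \<bullet> y t)"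
  note B = lip_ae_bilinear[OF bounded_bilinear_inner y y ab', folded \<phi>_def]
  define g where "g = (\<lambda>t. \<epsilon> * (vd y t \<bullet> vd y t) + 1 / \<epsilon> * (y t \<bullet> y t))"
  have ey: "ess_bounded a b (\<lambda>t. y t \<bullet> y t)" "ess_bounded a b (\<lambda>t. vd y t \<bullet> vd y t)"
    by (intro ess_bounded_inner ess_vd lip_ae_ess_bounded y)+
  have eg: "ess_bounded a b g"
    unfolding g_def by (intro ess_bounded_add ess_bounded_cmult ey)
  have ig: "integral\<^sup>L M g = \<epsilon> * deriv_sq y + 1 / \<epsilon> * fun_sq y"
    using ess_integral_linear[OF ess_bounded_cmult[OF ey(2), of \<epsilon>] ey(1) eg, of "1 / \<epsilon>"]
    by (simp add: g_def deriv_sq_def fun_sq_def)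
  have pt: "\<bar>2 * (u \<bullet> v)\<bar> \<le> \<epsilon> * (v \<bullet> v) + 1 / \<epsilon> * (u \<bullet> u)" for u v :: "complex^'d"
  proof -
    have "0 \<le> (norm (\<epsilon> *\<^sub>R v - u))\<^sup>2" "0 \<le> (norm (\<epsilon> *\<^sub>R v + u))\<^sup>2" by auto
    then have "2 * \<epsilon> * \<bar>u \<bullet> v\<bar> \<le> \<epsilon>\<^sup>2 * (v \<bullet> v) + u \<bullet> u"
      unfolding power2_norm_eq_inner by (simp add: inner_diff inner_add inner_commute power2_eq_square abs_if)
    then have "(2 * \<epsilon> * \<bar>u \<bullet> v\<bar>) / \<epsilon> \<le> (\<epsilon>\<^sup>2 * (v \<bullet> v) + u \<bullet> u) / \<epsilon>" using \<epsilon> by (intro divide_right_mono) auto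
    then show ?thesis using \<epsilon> by (simp add: field_simps power2_eq_square abs_mult)
  qed
  have le: "AE t in M. norm (vd \<phi> t) \<le> g t + 0"
    using B(2)
  proof eventually_elim
    case (elim t)
    then have "vd \<phi> t = 2 * (y t \<bullet> vd y t)" by (simp add: inner_commute)
    then show ?case using pt[of "y t" "vd y t"] by (simp add: g_def)
  qed
  have g0: "g t \<ge> 0" for t using \<epsilon> by (simp add: g_def)
  have osc: "\<bar>\<phi> t - \<phi> s\<bar> \<le> integral\<^sup>L M g" if "a \<le> s" "s \<le> t" "t \<le> b" for s t
    using norm_subintegral_bound[OF ess_vd[OF B(1)] eg le g0 that] integral_unique[OF lip_ae_has_integral[OF B(1) that]] by simp
  have "\<phi> t \<le> \<phi> s + integral\<^sup>L M g" if "s \<in> {a..b}" for s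
    using osc[of s t] osc[of t s] that t by (cases "s \<le> t") auto
  then have "AE s in M. \<phi> t - integral\<^sup>L M g \<le> \<phi> s" by (intro AE_I2) force
  from ess_integral_mono[OF ess_bounded_const _ this]
  have "(b - a) * (\<phi> t - integral\<^sup>L M g) \<le> fun_sq y"
    using ey unfolding integral_const fun_sq_def \<phi>_def by blast
  then have "\<phi> t - integral\<^sup>L M g \<le> fun_sq y / (b - a)" using ab by (simp add: field_simps)
  then show ?thesis unfolding ig \<phi>_def power2_norm_eq_inner by (simp add: algebra_simps)
qed

lemma w_lower: assumes "lip_ae a b y" shows "\<mu> * fun_sq y \<le> w y y"
proof -
  have e: "ess_bounded a b y" using assms by (rule lip_ae_ess_bounded)
  have "AE t in M. \<mu> * (y t \<bullet> y t) \<le> iw y y t"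
    using AE_pos
  proof eventually_elim
    case (elim t)
    then show ?case using cm_coercive[of \<mu> "W t" "y t"] by (simp add: iw_def inner_commute[of "cm (W t) *v y t"])
  qed
  then have "(\<integral>t. \<mu> * (y t \<bullet> y t) \<partial>M) \<le> w y y"
    unfolding w_def by (intro ess_integral_mono ess_bounded_cmult ess_bounded_inner ess_iw e)
  then show ?thesis by (simp add: fun_sq_def)
qed

lemma abs_inner_le: "norm (u::complex^'d) \<le> C * norm v \<Longrightarrow> \<bar>u \<bullet> v\<bar> \<le> C * (v \<bullet> v)"
  using Cauchy_Schwarz_ineq2[of u v] mult_right_mono[of "norm u" "C * norm v" "norm v"]
  by (simp add: power2_norm_eq_inner[symmetric] power2_eq_square)

text \<open>What \<open>q_lower\<close> has to subtract: the first \<open>C\<close> comes from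
  \<open>Q\<close>, the rest from \<open>\<beta>\<close> at the two endpoints.\<close>

definition cL :: real where "cL = C + 2 * C * (4 * C / \<mu> + 1 / (b - a))"

lemma cL_pos: "cL > 0" using C \<mu> ab by (simp add: cL_def add_pos_pos)

text \<open>The boundary form is estimated by \<open>sobolev\<close> with parameter
  \<open>\<mu> / (4 * C)\<close>. With this choice both endpoints together consume just half of the
  coercivity \<open>\<mu> * deriv_sq y\<close>.\<close>

lemma q_lower:
  assumes "y \<in> D" shows "\<mu> / 2 * deriv_sq y - cL * fun_sq y \<le> q y y"
proof -
  have y: "lip_ae a b y" "bd a b y \<in> V" using assms DD by auto
  have ey: "ess_bounded a b (\<lambda>t. y t \<bullet> y t)" "ess_bounded a b (\<lambda>t. vd y t \<bullet> vd y t)"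
    by (intro ess_bounded_inner ess_vd lip_ae_ess_bounded y(1))+
  have "AE t in M. \<mu> * (vd y t \<bullet> vd y t) - C * (y t \<bullet> y t) \<le> iq y y t"
    using AE_pos AE_bound
  proof eventually_elim
    case (elim t)
    have "\<mu> * (vd y t \<bullet> vd y t) \<le> (cm (P t) *v vd y t) \<bullet> vd y t"
      using elim cm_coercive[of \<mu> "P t" "vd y t"] by (simp add: inner_commute[of "cm (P t) *v vd y t"])
    moreover have "\<bar>(cm (Q t) *v y t) \<bullet> y t\<bar> \<le> C * (y t \<bullet> y t)" using elim by (intro abs_inner_le) auto
    ultimately show ?case unfolding iq_def by linarith
  qed
  then have "(\<integral>t. \<mu> * (vd y t \<bullet> vd y t) - C * (y t \<bullet> y t) \<partial>M) \<le> integral\<^sup>L M (iq y y)"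
    by (intro ess_integral_mono ess_bounded_diff ess_bounded_cmult ey ess_iq y)
  moreover have "(\<integral>t. \<mu> * (vd y t \<bullet> vd y t) - C * (y t \<bullet> y t) \<partial>M) = \<mu> * deriv_sq y - C * fun_sq y"
    using ess_bounded_integrable[OF ey(1)] ess_bounded_integrable[OF ey(2)] by (simp add: deriv_sq_def fun_sq_def)
  moreover have "\<bar>\<beta> (bd a b y) (bd a b y)\<bar> \<le> C * (norm (bd a b y))\<^sup>2"
    using \<beta>_bound[OF y(2) y(2)] by (simp add: power2_eq_square mult.assoc)
  moreover define K where "K = 4 * C / \<mu> + 1 / (b - a)"
  have "(norm (bd a b y))\<^sup>2 \<le> 2 * (\<mu> / (4 * C) * deriv_sq y + K * fun_sq y)"
    using sobolev[OF y(1), of "\<mu> / (4 * C)" a] sobolev[OF y(1), of "\<mu> / (4 * C)" b] \<mu> C ab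
    unfolding norm_bd K_def by simp
  then have "C * (norm (bd a b y))\<^sup>2 \<le> C * (2 * (\<mu> / (4 * C) * deriv_sq y + K * fun_sq y))"
    using C by (intro mult_left_mono) auto
  moreover have "C * (2 * (\<mu> / (4 * C) * deriv_sq y + K * fun_sq y)) = \<mu> / 2 * deriv_sq y + 2 * C * K * fun_sq y"
    using C by (simp add: field_simps)
  moreover have "cL * fun_sq y = C * fun_sq y + 2 * C * K * fun_sq y"
    by (simp add: cL_def K_def distrib_right)
  moreover have "\<mu> / 2 * deriv_sq y + \<mu> / 2 * deriv_sq y = \<mu> * deriv_sq y" by simp
  ultimately show ?thesis unfolding q_def by linarith
qed

text \<open>Both constants result from solving \<open>q_lower\<close> for \<open>deriv_sq\<close>
  and replacing \<open>fun_sq\<close> by \<open>w / \<mu>\<close>.\<close>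

definition c1 :: real where "c1 = 2 / \<mu>"
definition c2 :: real where "c2 = (2 * cL / \<mu> + 1) / \<mu>"

lemma energy_bound:
  assumes "y \<in> D" shows "deriv_sq y + fun_sq y \<le> c1 * q y y + c2 * w y y"
proof -
  have "deriv_sq y \<le> 2 / \<mu> * q y y + 2 * cL / \<mu> * fun_sq y"
    using q_lower[OF assms] \<mu> by (simp add: field_simps)
  moreover have "fun_sq y \<le> w y y / \<mu>" using w_lower[OF DD(1)[OF assms]] \<mu> by (simp add: field_simps)
  then have "(2 * cL / \<mu> + 1) * fun_sq y \<le> (2 * cL / \<mu> + 1) * (w y y / \<mu>)"
    using cL_pos \<mu> by (intro mult_left_mono) auto
  moreover have "(2 * cL / \<mu> + 1) * fun_sq y = 2 * cL / \<mu> * fun_sq y + fun_sq y" by (simp add: distrib_right)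
  moreover have "c2 * w y y = (2 * cL / \<mu> + 1) * (w y y / \<mu>)" by (simp add: c2_def)
  moreover have "c1 * q y y = 2 / \<mu> * q y y" by (simp add: c1_def)
  ultimately show ?thesis by linarith
qed

lemma q_bounded_below:
  assumes "y \<in> D" shows "- (cL / \<mu>) * w y y \<le> q y y"
proof -
  have "cL * fun_sq y \<le> cL * (w y y / \<mu>)"
    using w_lower[OF DD(1)[OF assms]] \<mu> cL_pos by (intro mult_left_mono) (auto simp: field_simps)
  moreover have "\<mu> / 2 * deriv_sq y \<ge> 0" using \<mu> deriv_sq_nonneg by simp
  ultimately show ?thesis using q_lower[OF assms] by (simp add: algebra_simps)
qed

text \<open>The parameter of \<open>sobolev\<close> is free: if \<open>fun_sq y = 0\<close>, then
  \<open>|y t|^2 \<le> \<epsilon> * deriv_sq y\<close> for every positive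
  \<open>\<epsilon>\<close>.\<close>

lemma fun_sq_zero:
  assumes "y \<in> D" "fun_sq y = 0" shows "y = 0"
proof -
  have "y t = 0" if t: "t \<in> {a..b}" for t
  proof (rule ccontr)
    assume "y t \<noteq> 0"
    define X where "X = deriv_sq y"
    have y: "lip_ae a b y" using assms DD by auto
    have le: "(norm (y t))\<^sup>2 \<le> \<epsilon> * X" if "\<epsilon> > 0" for \<epsilon>
      using sobolev[OF y that t] assms(2) by (simp add: X_def)
    have p: "(norm (y t))\<^sup>2 > 0" using \<open>y t \<noteq> 0\<close> by simp
    have X: "X \<ge> 0" using deriv_sq_nonneg X_def by simp
    have "(norm (y t))\<^sup>2 / (2 * (X + 1)) * X \<le> (norm (y t))\<^sup>2 / 2"
      using X p by (simp add: field_simps)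
    moreover have "(norm (y t))\<^sup>2 \<le> (norm (y t))\<^sup>2 / (2 * (X + 1)) * X" using p X by (intro le) auto
    ultimately show False using p by linarith
  qed
  then show ?thesis using DD(3)[OF assms(1)] by (auto simp: fun_eq_iff)
qed

lemma w_positive: assumes "y \<in> D" "y \<noteq> 0" shows "w y y > 0"
proof -
  have "fun_sq y > 0" using fun_sq_zero assms fun_sq_nonneg[of y] by force
  then have "\<mu> * fun_sq y > 0" using \<mu> by simp
  then show ?thesis using w_lower[OF DD(1)[OF assms(1)]] by linarith
qed

end

section \<open>Compactness of sublevel sets\<close>

context sl_form begin

lemma w_bound:
  assumes y: "ess_bounded a b y" and z: "ess_bounded a b z" and A: "A \<ge> 0"
    and le: "\<And>t. t \<in> {a..b} \<Longrightarrow> norm (y t) \<le> A" "\<And>t. t \<in> {a..b} \<Longrightarrow> norm (z t) \<le> B"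
  shows "\<bar>w y z\<bar> \<le> (b - a) * (C * A * B)"
proof -
  have le2: "AE t in M. norm (y t) \<le> A \<and> norm (z t) \<le> B" using le by (intro AE_I2) auto
  have "AE t in M. \<bar>iw y z t\<bar> \<le> C * A * B"
    using AE_bound le2
  proof eventually_elim
    case (elim t)
    have "\<bar>iw y z t\<bar> \<le> norm (cm (W t) *v y t) * norm (z t)" unfolding iw_def by (rule Cauchy_Schwarz_ineq2)
    also have "\<dots> \<le> (C * norm (y t)) * norm (z t)" using elim by (intro mult_right_mono) auto
    also have "\<dots> \<le> (C * A) * B" using elim C A by (intro mult_mono) auto
    finally show ?case .
  qed
  then have "AE t in M. iw y z t \<le> C * A * B" "AE t in M. - (C * A * B) \<le> iw y z t"
    by (eventually_elim, linarith)+
  from ess_integral_mono[OF ess_iw[OF y z] ess_bounded_const this(1)]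
    ess_integral_mono[OF ess_bounded_const ess_iw[OF y z] this(2)]
  show ?thesis unfolding integral_const w_def by simp
qed

text \<open>With \<open>\<kappa>\<close> small against the energy, and then \<open>t - s\<close>
  small against \<open>\<kappa>\<close>, both terms are small; so sets of bounded energy are
  equicontinuous.\<close>

lemma equicontinuity:
  assumes y: "lip_ae a b y" and k: "\<kappa> > 0" and st: "a \<le> s" "s \<le> t" "t \<le> b"
  shows "norm (y t - y s) \<le> \<kappa> * deriv_sq y + 1 / \<kappa> * (t - s)"
proof -
  define g where "g = (\<lambda>t. \<kappa> * (vd y t \<bullet> vd y t))"
  have eg: "ess_bounded a b g" unfolding g_def by (intro ess_bounded_cmult ess_bounded_inner ess_vd y)
  have pt: "norm v \<le> \<kappa> * (v \<bullet> v) + 1 / \<kappa>" for v :: "complex^'d"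
  proof -
    have "0 \<le> (\<kappa> * norm v - 1)\<^sup>2" by simp
    then have "2 * \<kappa> * norm v \<le> \<kappa>\<^sup>2 * (norm v)\<^sup>2 + 1" by (simp add: power2_eq_square algebra_simps)
    moreover have "\<kappa> * norm v \<ge> 0" using k by simp
    ultimately have "\<kappa> * norm v \<le> \<kappa>\<^sup>2 * (norm v)\<^sup>2 + 1" by linarith
    then have "\<kappa> * norm v \<le> \<kappa> * (\<kappa> * (v \<bullet> v) + 1 / \<kappa>)"
      using k by (simp add: power2_norm_eq_inner[symmetric] power2_eq_square algebra_simps)
    then show ?thesis using k by simp
  qed
  have "AE t in M. norm (vd y t) \<le> g t + 1 / \<kappa>" using pt by (simp add: g_def)
  from norm_subintegral_bound[OF ess_vd[OF y] eg this _ st]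
  have "norm (integral {s..t} (vd y)) \<le> integral\<^sup>L M g + 1 / \<kappa> * (t - s)" using k by (simp add: g_def)
  then show ?thesis
    using integral_unique[OF lip_ae_has_integral[OF y st]] by (simp add: g_def deriv_sq_def)
qed

lemma c1_pos: "c1 > 0" using \<mu> by (simp add: c1_def)

text \<open>Arzela-Ascoli: the energy bound \<open>E\<close> controls the sup norms through
  \<open>sobolev\<close> and the moduli of continuity through \<open>equicontinuity\<close>. About
  the limit \<open>g\<close> only continuity is learnt, which is why a regularity theorem has to
  follow.\<close>

lemma uniform_subsequence:
  fixes y :: "nat \<Rightarrow> real \<Rightarrow> complex^'d"
  assumes y: "\<And>j. y j \<in> D" "\<And>j. w (y j) (y j) = 1" "\<And>j. q (y j) (y j) \<le> K"
  obtains g r where "continuous_on {a..b} g" "strict_mono (r :: nat \<Rightarrow> nat)"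
    "uniform_limit {a..b} (\<lambda>j. y (r j)) g sequentially"
proof -
  define E where "E = c1 * K + c2"
  have E: "deriv_sq (y j) + fun_sq (y j) \<le> E" for j
    using energy_bound[OF y(1)[of j]] y(2,3)[of j] c1_pos mult_left_mono[of "q (y j) (y j)" K c1] by (simp add: E_def order_trans[OF _ add_right_mono])
  have E2: "deriv_sq (y j) \<le> E" "fun_sq (y j) \<le> E" for j
    using E[of j] deriv_sq_nonneg[of "y j"] fun_sq_nonneg[of "y j"] by auto
  have E0: "E \<ge> 0" using E2(1)[of 0] deriv_sq_nonneg[of "y 0"] by linarith
  define B where "B = sqrt (E + (1 + 1 / (b - a)) * E)"
  have sup: "norm (y j x) \<le> B" if "x \<in> {a..b}" for j x
  proof -
    have "(norm (y j x))\<^sup>2 \<le> 1 * deriv_sq (y j) + (1 / 1 + 1 / (b - a)) * fun_sq (y j)"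
      by (rule sobolev[OF DD(1)[OF y(1)] zero_less_one that])
    also have "\<dots> \<le> E + (1 + 1 / (b - a)) * E"
      using E2[of j] ab by (intro add_mono) (auto intro!: mult_left_mono)
    finally show ?thesis unfolding B_def by (rule real_le_rsqrt)
  qed
  have equi: "\<exists>d. 0 < d \<and> (\<forall>n z. z \<in> {a..b} \<and> norm (x - z) < d \<longrightarrow> norm (y n x - y n z) < e)"
    if x: "x \<in> {a..b}" and e: "0 < e" for x e
  proof -
    define \<kappa> where "\<kappa> = e / (2 * (E + 1))"
    have k: "\<kappa> > 0" using e E0 by (simp add: \<kappa>_def)
    have kE: "\<kappa> * E < e / 2"
    proof -
      have "\<kappa> * E < \<kappa> * (E + 1)" using k by simp
      also have "\<dots> = e / 2" using E0 by (simp add: \<kappa>_def field_simps)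
      finally show ?thesis .
    qed
    have *: "norm (y n t - y n s) < e" if st: "a \<le> s" "s \<le> t" "t \<le> b" "t - s < \<kappa> * e / 2" for n s t
    proof -
      have "norm (y n t - y n s) \<le> \<kappa> * deriv_sq (y n) + 1 / \<kappa> * (t - s)"
        by (rule equicontinuity[OF DD(1)[OF y(1)] k st(1-3)])
      also have "\<kappa> * deriv_sq (y n) \<le> \<kappa> * E" using E2(1) k by (intro mult_left_mono) auto
      also have "1 / \<kappa> * (t - s) < 1 / \<kappa> * (\<kappa> * e / 2)" using st(4) k by (intro mult_strict_left_mono) auto
      also have "1 / \<kappa> * (\<kappa> * e / 2) = e / 2" using k by simp
      finally show ?thesis using kE by linarith
    qed
    have "norm (y n x - y n z) < e" if z: "z \<in> {a..b}" "norm (x - z) < \<kappa> * e / 2" for n z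
      using *[of x z n] *[of z x n] x z by (cases "x \<le> z") (auto simp: norm_minus_commute)
    moreover have "\<kappa> * e / 2 > 0" using k e by simp
    ultimately show ?thesis by blast
  qed
  obtain g and r :: "nat \<Rightarrow> nat" where gr: "continuous_on {a..b} g" "strict_mono r"
    "\<And>e. 0 < e \<Longrightarrow> \<exists>N. \<forall>n x. n \<ge> N \<and> x \<in> {a..b} \<longrightarrow> norm (y (r n) x - g x) < e"
    using Arzela_Ascoli[of "{a..b}" y B] sup equi by (metis compact_Icc)
  have "uniform_limit {a..b} (\<lambda>j. y (r j)) g sequentially"
    unfolding uniform_limit_iff eventually_sequentially dist_norm using gr(3) by blast
  then show thesis using that gr by blast
qed

lemma compactness_w:
  fixes y :: "nat \<Rightarrow> real \<Rightarrow> complex^'d"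
  assumes y: "\<And>j. y j \<in> D" "\<And>j. w (y j) (y j) = 1" "\<And>j. q (y j) (y j) \<le> K"
  shows "\<exists>r::nat \<Rightarrow> nat. strict_mono r \<and>
        (\<forall>e>0. \<exists>N. \<forall>i\<ge>N. \<forall>j\<ge>N. w (y (r i) - y (r j)) (y (r i) - y (r j)) < e)"
proof -
  obtain g and r :: "nat \<Rightarrow> nat" where gr: "continuous_on {a..b} g" "strict_mono r"
    "uniform_limit {a..b} (\<lambda>j. y (r j)) g sequentially" by (rule uniform_subsequence[OF y])
  have "\<exists>N. \<forall>i\<ge>N. \<forall>j\<ge>N. w (y (r i) - y (r j)) (y (r i) - y (r j)) < e" if e: "e > 0" for e
  proof -
    \<comment> \<open>Chosen so that \<open>(b - a) * C * \<delta>^2 = e / 2\<close>.\<close>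
    define \<delta> where "\<delta> = sqrt (e / (2 * ((b - a) * C)))"
    have d: "\<delta> > 0" "(b - a) * (C * \<delta> * \<delta>) < e"
      using e ab C by (auto simp: \<delta>_def field_simps)
    have "\<forall>\<^sub>F n in sequentially. \<forall>x\<in>{a..b}. dist (y (r n) x) (g x) < \<delta> / 2"
      using gr(3) half_gt_zero[OF d(1)] unfolding uniform_limit_iff by blast
    then obtain N where N: "\<And>n x. n \<ge> N \<Longrightarrow> x \<in> {a..b} \<Longrightarrow> dist (y (r n) x) (g x) < \<delta> / 2"
      unfolding eventually_sequentially by blast
    have "w (y (r i) - y (r j)) (y (r i) - y (r j)) < e" if "i \<ge> N" "j \<ge> N" for i j
    proof -
      have le: "norm ((y (r i) - y (r j)) x) \<le> \<delta>" if x: "x \<in> {a..b}" for x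
        using dist_triangle_half_l[OF N[OF \<open>i \<ge> N\<close> x] N[OF \<open>j \<ge> N\<close> x]] by (simp add: dist_norm fun_diff_def)
      have "y (r i) - y (r j) \<in> D" using y(1) subspace_D fs.subspace_diff by blast
      then have es: "ess_bounded a b (y (r i) - y (r j))" using DD(1) lip_ae_ess_bounded by blast
      have "\<bar>w (y (r i) - y (r j)) (y (r i) - y (r j))\<bar> \<le> (b - a) * (C * \<delta> * \<delta>)"
        by (rule w_bound[OF es es less_imp_le[OF d(1)]]) (use le in blast)+
      then show ?thesis using d(2) by linarith
    qed
    then show ?thesis by blast
  qed
  then show ?thesis using gr(2) by blast
qed

text \<open>Here \<open>v\<close> is the quasi-derivative of \<open>z\<close>. No derivative of \<open>y\<close> occurs, so the expression passes to
  uniform limits in \<open>y\<close>.\<close>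
definition vw :: "real \<Rightarrow> (real \<Rightarrow> complex^'d) \<Rightarrow> (real \<Rightarrow> complex^'d) \<Rightarrow> (real \<Rightarrow> complex^'d) \<Rightarrow> real" where
  "vw \<rho> y z v = v b \<bullet> y b - v a \<bullet> y a - (\<integral>t. vd v t \<bullet> y t \<partial>M) +
    (\<integral>t. (cm (Q t) *v z t - \<rho> *\<^sub>R (cm (W t) *v z t)) \<bullet> y t \<partial>M) + \<beta> (bd a b y) (bd a b z)"

lemma ess_potential: "ess_bounded a b z \<Longrightarrow> ess_bounded a b (\<lambda>t. cm (Q t) *v z t - \<rho> *\<^sub>R (cm (W t) *v z t))"
  by (intro ess_bounded_diff ess_bounded_cm ess ess_bounded_linear[OF bounded_linear_scaleR_right])

lemma by_parts:
  assumes "lip_ae a b u" "lip_ae a b v"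
  shows "(\<integral>t. u t \<bullet> vd v t \<partial>M) + (\<integral>t. vd u t \<bullet> v t \<partial>M) = u b \<bullet> v b - u a \<bullet> v a"
proof -
  have "ess_bounded a b (\<lambda>t. u t \<bullet> vd v t)" "ess_bounded a b (\<lambda>t. vd u t \<bullet> v t)"
    using assms by (intro ess_bounded_inner ess_vd lip_ae_ess_bounded; simp)+
  then show ?thesis
    using integral_by_parts[OF assms ab'] by (simp add: ess_bounded_integrable)
qed

text \<open>By symmetry of \<open>P\<close>, \<open>P y' \<bullet> z' = v \<bullet> y'\<close>, and
  integration by parts moves the derivative from \<open>y\<close> to \<open>v\<close>.\<close>

lemma vw_eq:
  assumes y: "y \<in> D" and z: "z \<in> D" and v: "lip_ae a b v" and Pz: "AE t in M. cm (P t) *v vd z t = v t"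
  shows "q y z - \<rho> * w y z = vw \<rho> y z v"
proof -
  note l = DD(1)[OF y] DD(1)[OF z]
  note e = lip_ae_ess_bounded[OF l(1)] lip_ae_ess_bounded[OF l(2)]
  have 1: "ess_bounded a b (\<lambda>t. v t \<bullet> vd y t)" "ess_bounded a b (\<lambda>t. (cm (Q t) *v z t - \<rho> *\<^sub>R (cm (W t) *v z t)) \<bullet> y t)"
    by (intro ess_bounded_inner ess_vd lip_ae_ess_bounded ess_potential v l)+
  have "AE t in M. iq y z t = (v t \<bullet> vd y t + (cm (Q t) *v z t - \<rho> *\<^sub>R (cm (W t) *v z t)) \<bullet> y t) + \<rho> * iw y z t"
    using AE_sym Pz
  proof eventually_elim
    case (elim t)
    then show ?case
      using cm_swap[of "P t" "vd y t" "vd z t"] cm_swap[of "Q t" "y t" "z t"] cm_swap[of "W t" "y t" "z t"]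
      by (simp add: iq_def iw_def inner_diff_left)
  qed
  then have "integral\<^sup>L M (iq y z) = (\<integral>t. v t \<bullet> vd y t + (cm (Q t) *v z t - \<rho> *\<^sub>R (cm (W t) *v z t)) \<bullet> y t \<partial>M) + \<rho> * w y z"
    unfolding w_def by (intro ess_integral_linear ess_bounded_add 1 ess_iw e ess_iq l)
  also have "(\<integral>t. v t \<bullet> vd y t + (cm (Q t) *v z t - \<rho> *\<^sub>R (cm (W t) *v z t)) \<bullet> y t \<partial>M) =
      (\<integral>t. v t \<bullet> vd y t \<partial>M) + (\<integral>t. (cm (Q t) *v z t - \<rho> *\<^sub>R (cm (W t) *v z t)) \<bullet> y t \<partial>M)"
    using 1 by (simp add: ess_bounded_integrable)
  finally show ?thesis using by_parts[OF v l(1)] unfolding q_def vw_def by simp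
qed

lemma integral_inner_limit:
  assumes h: "ess_bounded a b h" and y: "\<And>j::nat. ess_bounded a b (y j)" and g: "ess_bounded a b g"
    and lim: "uniform_limit {a..b} y g sequentially"
  shows "(\<lambda>j. \<integral>t. h t \<bullet> y j t \<partial>M) \<longlonglongrightarrow> (\<integral>t. h t \<bullet> g t \<partial>M)"
proof -
  obtain K0 where "AE t in M. norm (h t) \<le> K0" using h unfolding ess_bounded_def by blast
  then have K: "AE t in M. norm (h t) \<le> \<bar>K0\<bar> + 1" by eventually_elim simp
  define K where "K = \<bar>K0\<bar> + 1"
  have K1: "K > 0" by (simp add: K_def)
  show ?thesis
    unfolding lim_sequentially
  proof (intro allI impI)
    fix e :: real assume e: "e > 0"
    define \<delta> where "\<delta> = e / (2 * K * (b - a))"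
    have "\<delta> * (2 * K * (b - a)) = e" using K1 ab by (simp add: \<delta>_def)
    moreover have "(b - a) * (K * \<delta>) = \<delta> * (2 * K * (b - a)) / 2" by simp
    ultimately have d: "\<delta> > 0" "(b - a) * (K * \<delta>) < e" using e K1 ab by (auto simp: \<delta>_def)
    have "\<forall>\<^sub>F n in sequentially. \<forall>x\<in>{a..b}. dist (y n x) (g x) < \<delta>"
      using lim d(1) unfolding uniform_limit_iff by simp
    then obtain N where N: "\<And>n x. n \<ge> N \<Longrightarrow> x \<in> {a..b} \<Longrightarrow> dist (y n x) (g x) < \<delta>"
      unfolding eventually_sequentially by blast
    have "dist (\<integral>t. h t \<bullet> y n t \<partial>M) (\<integral>t. h t \<bullet> g t \<partial>M) < e" if n: "n \<ge> N" for n
    proof -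
      have ei: "ess_bounded a b (\<lambda>t. h t \<bullet> (y n t - g t))"
        by (intro ess_bounded_inner ess_bounded_diff h y g)
      have "AE t in M. norm (y n t - g t) \<le> \<delta>"
        using N[OF n] by (intro AE_I2) (force simp: dist_norm intro: less_imp_le)
      then have "AE t in M. \<bar>h t \<bullet> (y n t - g t)\<bar> \<le> K * \<delta>"
        using K
      proof eventually_elim
        case (elim t)
        have "\<bar>h t \<bullet> (y n t - g t)\<bar> \<le> norm (h t) * norm (y n t - g t)" by (rule Cauchy_Schwarz_ineq2)
        also have "\<dots> \<le> K * \<delta>" using elim K1 by (intro mult_mono) (auto simp: K_def)
        finally show ?case .
      qed
      then have "AE t in M. h t \<bullet> (y n t - g t) \<le> K * \<delta>" "AE t in M. - (K * \<delta>) \<le> h t \<bullet> (y n t - g t)"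
        by (eventually_elim, linarith)+
      from ess_integral_mono[OF ei ess_bounded_const this(1)] ess_integral_mono[OF ess_bounded_const ei this(2)]
      have "\<bar>\<integral>t. h t \<bullet> (y n t - g t) \<partial>M\<bar> \<le> (b - a) * (K * \<delta>)" unfolding integral_const by simp
      moreover have "(\<integral>t. h t \<bullet> (y n t - g t) \<partial>M) = (\<integral>t. h t \<bullet> y n t \<partial>M) - (\<integral>t. h t \<bullet> g t \<partial>M)"
        unfolding inner_diff_right using ess_bounded_inner[OF h y[of n]] ess_bounded_inner[OF h g]
        by (simp add: ess_bounded_integrable)
      ultimately show ?thesis using d(2) by (simp add: dist_real_def)
    qed
    then show "\<exists>N. \<forall>n\<ge>N. dist (\<integral>t. h t \<bullet> y n t \<partial>M) (\<integral>t. h t \<bullet> g t \<partial>M) < e" by blast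
  qed
qed

section \<open>The equation \<open>P x' = v\<close> and regularity of weak solutions\<close>

definition S :: "real \<Rightarrow> complex^'d \<Rightarrow> complex^'d" where
  "S t v = cramer_solve (cm (P t)) v"

lemma AE_S:
  "AE t in M. \<forall>v. cm (P t) *v S t v = v \<and> (\<forall>x. cm (P t) *v x = v \<longrightarrow> x = S t v) \<and> norm (S t v) \<le> norm v / \<mu>"
  using AE_pos
proof eventually_elim
  case (elim t)
  then have d: "det (cm (P t)) \<noteq> 0" using cm_det_nonzero[of \<mu> "P t"] \<mu> by blast
  show ?case
  proof (intro allI conjI impI)
    fix v
    show e: "cm (P t) *v S t v = v" unfolding S_def by (rule cramer_solve_eq[OF d])
    show "x = S t v" if "cm (P t) *v x = v" for x using that cramer_solve[OF d] unfolding S_def by blast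
    show "norm (S t v) \<le> norm v / \<mu>"
      using norm_le_of_coercive[of \<mu> "S t v" v] cm_coercive[of \<mu> "P t" "S t v"] elim \<mu> e by simp
  qed
qed

lemma bounded_linear_cm: "bounded_linear (cm :: real^'d^'d \<Rightarrow> complex^'d^'d)"
  unfolding linear_conv_bounded_linear[symmetric]
  by (rule linearI) (simp_all add: cm_def vec_eq_iff scaleR_conv_of_real[where 'a=complex])

lemma ess_S:
  assumes v: "ess_bounded a b v" shows "ess_bounded a b (\<lambda>t. S t (v t))"
proof -
  have "(\<lambda>t. S t (v t)) \<in> borel_measurable M"
    using ess_bounded_linear[OF bounded_linear_cm ess(1)] v
    unfolding S_def ess_bounded_def by (intro cramer_solve_measurable) auto
  moreover obtain K where "AE t in M. norm (v t) \<le> K" using v unfolding ess_bounded_def by blast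
  then have "AE t in M. norm (S t (v t)) \<le> K / \<mu>"
    using AE_S
  proof eventually_elim
    case (elim t)
    then have "norm (S t (v t)) \<le> norm (v t) / \<mu>" by blast
    also have "\<dots> \<le> K / \<mu>" using elim \<mu> by (intro divide_right_mono) auto
    finally show ?case .
  qed
  ultimately show ?thesis by (rule ess_boundedI)
qed

lemma S_add: "AE t in M. \<forall>u v. S t (u + v) = S t u + S t v"
  using AE_S
proof eventually_elim
  case (elim t)
  show ?case
  proof (intro allI)
    fix u v
    have "cm (P t) *v (S t u + S t v) = u + v" using elim by (simp add: cm.add_right)
    then show "S t (u + v) = S t u + S t v" using elim by metis
  qed
qed

lemma S_scale: "AE t in M. \<forall>v. S t (r *\<^sub>R v) = r *\<^sub>R S t v"
  using AE_S
proof eventually_elim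
  case (elim t)
  show ?case
  proof (intro allI)
    fix v
    have "cm (P t) *v (r *\<^sub>R S t v) = r *\<^sub>R v" using elim by (simp add: cm.scaleR_right)
    then show "S t (r *\<^sub>R v) = r *\<^sub>R S t v" using elim by metis
  qed
qed

text \<open>The increment over \<open>[a, b]\<close> of a function \<open>x\<close> with
  \<open>P x' = v\<close>.\<close>

definition IS :: "(real \<Rightarrow> complex^'d) \<Rightarrow> complex^'d" where
  "IS v = (\<integral>t. S t (v t) \<partial>M)"

lemma IS_add:
  assumes "ess_bounded a b u" "ess_bounded a b v"
  shows "IS (\<lambda>t. u t + v t) = IS u + IS v"
proof -
  have "AE t in M. S t (u t + v t) = S t (u t) + S t (v t)" using S_add by eventually_elim simp
  then have "IS (\<lambda>t. u t + v t) = (\<integral>t. S t (u t) + S t (v t) \<partial>M)"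
    unfolding IS_def using ess_S[OF ess_bounded_add[OF assms]] ess_bounded_add[OF ess_S[OF assms(1)] ess_S[OF assms(2)]]
    by (intro integral_cong_AE) (auto simp: ess_bounded_def)
  then show ?thesis
    unfolding IS_def using ess_bounded_integrable[OF ess_S[OF assms(1)]] ess_bounded_integrable[OF ess_S[OF assms(2)]] by simp
qed

text \<open>By coercivity and boundedness of \<open>P\<close>, the inner product of
  \<open>IS (\<lambda>t. c)\<close> with \<open>c\<close> is positive for
  \<open>c \<noteq> 0\<close>. So the map is injective, and by finite dimension onto. Adding a
  constant to a quasi-derivative thus adjusts the value at \<open>b\<close> at will.\<close>

lemma IS_const_surj: "\<exists>c. IS (\<lambda>t. c) = v"
proof -
  have "linear (\<lambda>c. IS (\<lambda>t. c))"
  proof (rule linearI)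
    show "IS (\<lambda>t. c + c') = IS (\<lambda>t. c) + IS (\<lambda>t. c')" for c c'
      by (rule IS_add) (rule ess_bounded_const)+
    fix r :: real and c
    have "AE t in M. S t (r *\<^sub>R c) = r *\<^sub>R S t c" using S_scale[of r] by eventually_elim simp
    then have "IS (\<lambda>t. r *\<^sub>R c) = (\<integral>t. r *\<^sub>R S t c \<partial>M)"
      unfolding IS_def using ess_S[OF ess_bounded_const] ess_bounded_linear[OF bounded_linear_scaleR_right ess_S[OF ess_bounded_const]]
      by (intro integral_cong_AE) (auto simp: ess_bounded_def)
    then show "IS (\<lambda>t. r *\<^sub>R c) = r *\<^sub>R IS (\<lambda>t. c)" by (simp add: IS_def)
  qed
  moreover have "c = 0" if c: "IS (\<lambda>t. c) = 0" for c
  proof (rule ccontr)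
    assume "c \<noteq> 0"
    then have p: "\<mu> * (norm c / C)\<^sup>2 > 0" using \<mu> C by simp
    have e: "ess_bounded a b (\<lambda>t. S t c)" by (rule ess_S[OF ess_bounded_const])
    have "AE t in M. \<mu> * (norm c / C)\<^sup>2 \<le> S t c \<bullet> c"
      using AE_S AE_pos AE_bound
    proof eventually_elim
      case (elim t)
      have cm: "cm (P t) *v S t c = c" using elim(1) by blast
      then have "norm c \<le> C * norm (S t c)" using elim(3) by metis
      then have "norm c / C \<le> norm (S t c)" using C by (simp add: field_simps)
      then have "(norm c / C)\<^sup>2 \<le> (norm (S t c))\<^sup>2" using C by (intro power_mono) auto
      then have "\<mu> * (norm c / C)\<^sup>2 \<le> \<mu> * (S t c \<bullet> S t c)"
        using \<mu> by (simp add: power2_norm_eq_inner)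
      also have "\<dots> \<le> S t c \<bullet> c" using cm_coercive[of \<mu> "P t" "S t c"] elim(2) cm by simp
      finally show ?case .
    qed
    then have "(b - a) * (\<mu> * (norm c / C)\<^sup>2) \<le> (\<integral>t. S t c \<bullet> c \<partial>M)"
      unfolding integral_const[symmetric]
      by (intro ess_integral_mono ess_bounded_const ess_bounded_inner e)
    also have "(\<integral>t. S t c \<bullet> c \<partial>M) = IS (\<lambda>t. c) \<bullet> c"
      unfolding IS_def using ess_bounded_integrable[OF e] by simp
    also have "\<dots> = 0" using c by simp
    finally show False using mult_pos_pos[OF _ p, of "b - a"] ab by linarith
  qed
  ultimately have "surj (\<lambda>c. IS (\<lambda>t. c))"
    by (intro linear_inj_imp_surj) (auto simp: linear_injective_0)
  then show ?thesis by (metis surjD)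
qed

definition ext :: "(real \<Rightarrow> complex^'d) \<Rightarrow> real \<Rightarrow> complex^'d" where
  "ext y = (\<lambda>t. if t \<in> {a..b} then y t else 0)"

definition primitive :: "complex^'d \<Rightarrow> (real \<Rightarrow> complex^'d) \<Rightarrow> real \<Rightarrow> complex^'d" where
  "primitive c v = ext (\<lambda>t. c + integral {a..t} (\<lambda>s. S s (v s)))"

lemma primitive:
  assumes "ess_bounded a b v"
  shows "lip_ae a b (primitive c v)" "AE t in M. cm (P t) *v vd (primitive c v) t = v t"
    "primitive c v a = c" "primitive c v b = c + IS v" "t \<notin> {a..b} \<Longrightarrow> primitive c v t = 0"
proof -
  note L = lip_ae_integral[OF ess_S[OF assms], of c]
  have eq: "c + integral {a..t} (\<lambda>s. S s (v s)) = primitive c v t" if "t \<in> {a..b}" for t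
    using that by (simp add: primitive_def ext_def)
  have L2: "lip_ae a b (primitive c v)"
    "AE t in M. vd (primitive c v) t = vd (\<lambda>t. c + integral {a..t} (\<lambda>s. S s (v s))) t"
    by (rule lip_ae_cong[OF _ L(1)], rule eq, assumption)+
  show "lip_ae a b (primitive c v)" by (rule L2(1))
  show "AE t in M. cm (P t) *v vd (primitive c v) t = v t"
    using L(2) L2(2) AE_S by eventually_elim metis
  show "primitive c v a = c" using ab by (simp add: primitive_def ext_def)
  show "primitive c v b = c + IS v"
    using ab ess_bounded_has_integral(3)[OF ess_S[OF assms]] by (simp add: primitive_def ext_def IS_def)
  show "primitive c v t = 0" if "t \<notin> {a..b}" using that unfolding primitive_def ext_def by (rule if_not_P)
qed

text \<open>The strong form of the problem: \<open>u\<close> is the quasi-derivative, and the last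
  clause is the natural boundary condition belonging to \<open>V\<close> and
  \<open>\<beta>\<close>.\<close>

definition eig :: "real \<Rightarrow> (real \<Rightarrow> complex^'d) \<Rightarrow> bool" where
  "eig \<rho> y \<longleftrightarrow> y \<in> D \<and> (\<exists>u. lip_ae a b u \<and> (AE t in M. cm (P t) *v vd y t = u t) \<and>
    (AE t in M. vd u t = cm (Q t) *v y t - \<rho> *\<^sub>R (cm (W t) *v y t)) \<and>
    (\<forall>Z\<in>V. bvec (u a) (u b) \<bullet> Z + \<beta> (bd a b y) Z = 0))"

lemma potential_swap:
  assumes "transpose (Q t) = Q t" "transpose (W t) = W t"
  shows "(cm (Q t) *v z - \<rho> *\<^sub>R (cm (W t) *v z)) \<bullet> y = (cm (Q t) *v y - \<rho> *\<^sub>R (cm (W t) *v y)) \<bullet> z"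
  using cm_swap[OF assms(1), of z y] cm_swap[OF assms(2), of z y] by (simp add: inner_diff_left)

text \<open>Two integrations by parts move the second-order operator from \<open>z\<close> to a primitive \<open>x\<close> of
  the quasi-derivative determined by \<open>y\<close>; here \<open>y\<close> itself is only continuous.\<close>
lemma green:
  assumes y: "ess_bounded a b y" and x: "lip_ae a b x" and u: "lip_ae a b u" and z: "lip_ae a b z" and v: "lip_ae a b v"
    and Px: "AE t in M. cm (P t) *v vd x t = u t" and Pz: "AE t in M. cm (P t) *v vd z t = v t"
    and du: "AE t in M. vd u t = cm (Q t) *v y t - \<rho> *\<^sub>R (cm (W t) *v y t)"
  shows "(\<integral>t. (cm (Q t) *v z t - \<rho> *\<^sub>R (cm (W t) *v z t)) \<bullet> y t \<partial>M) =
    (u b \<bullet> z b - u a \<bullet> z a) - (v b \<bullet> x b - v a \<bullet> x a) + (\<integral>t. vd v t \<bullet> x t \<partial>M)"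
proof -
  have "AE t in M. (cm (Q t) *v z t - \<rho> *\<^sub>R (cm (W t) *v z t)) \<bullet> y t = vd u t \<bullet> z t"
    using AE_sym du by eventually_elim (simp add: potential_swap)
  then have 1: "(\<integral>t. (cm (Q t) *v z t - \<rho> *\<^sub>R (cm (W t) *v z t)) \<bullet> y t \<partial>M) = (\<integral>t. vd u t \<bullet> z t \<partial>M)"
    by (intro ess_integral_cong ess_bounded_inner ess_potential ess_vd lip_ae_ess_bounded y z u)
  have "AE t in M. u t \<bullet> vd z t = v t \<bullet> vd x t"
    using AE_sym Px Pz
  proof eventually_elim
    case (elim t)
    then show ?case using cm_swap[of "P t" "vd x t" "vd z t"] by simp
  qed
  then have 2: "(\<integral>t. u t \<bullet> vd z t \<partial>M) = (\<integral>t. v t \<bullet> vd x t \<partial>M)"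
    by (intro ess_integral_cong ess_bounded_inner ess_vd lip_ae_ess_bounded x z u v)
  show ?thesis using 1 2 by_parts[OF u z] by_parts[OF v x] by simp
qed

lemma continuous_zero:
  assumes "continuous_on {a..b} r" "(\<integral>t. r t \<bullet> r t \<partial>M) = 0" "t \<in> {a..b}"
  shows "r t = (0 :: complex^'d)"
proof -
  have c: "continuous_on {a..b} (\<lambda>t. r t \<bullet> r t)" by (intro continuous_intros assms)
  have "((\<lambda>t. r t \<bullet> r t) has_integral 0) (cbox a b)"
    using ess_bounded_has_integral(1)[OF ess_bounded_continuous[OF c]] assms(2) by simp
  then have "r t \<bullet> r t = 0"
    using has_integral_0_cbox_imp_0[of a b "\<lambda>t. r t \<bullet> r t" t] c ab assms(3) by simp
  then show ?thesis by simp
qed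

text \<open>Let \<open>x\<close> have quasi-derivative \<open>u\<close> with
  \<open>u' = Q y - \<rho> W y\<close> and the same boundary values as \<open>y\<close>. By
  \<open>green\<close>, \<open>r = y - x\<close> is orthogonal to \<open>v'\<close> whenever
  \<open>v\<close> is the quasi-derivative of a test function vanishing at both ends. A test
  function of this kind with \<open>v' = r\<close> exists, so \<open>r = 0\<close> and
  \<open>y\<close> is as regular as \<open>x\<close>. Test functions with an arbitrary boundary
  vector in \<open>V\<close> then give the natural boundary condition.\<close>

lemma weak_solution_regular:
  assumes cont: "continuous_on {a..b} y" and out: "\<And>t. t \<notin> {a..b} \<Longrightarrow> y t = 0" and bdV: "bd a b y \<in> V"
    and weak: "\<And>z v. z \<in> D \<Longrightarrow> lip_ae a b v \<Longrightarrow> (AE t in M. cm (P t) *v vd z t = v t) \<Longrightarrow> vw \<rho> y z v = 0"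
  shows "eig \<rho> y"
proof -
  have ey: "ess_bounded a b y" by (rule ess_bounded_continuous[OF cont])
  define f where "f = (\<lambda>t. cm (Q t) *v y t - \<rho> *\<^sub>R (cm (W t) *v y t))"
  have ef: "ess_bounded a b f" unfolding f_def by (rule ess_potential[OF ey])
  define g where "g = (\<lambda>t. 0 + integral {a..t} f)"
  have g: "lip_ae a b g" unfolding g_def by (rule lip_ae_integral(1)[OF ef])
  \<comment> \<open>With this constant in \<open>u\<close>, the primitive \<open>x\<close> that
    starts at \<open>y a\<close> ends at \<open>y b\<close>.\<close>
  obtain c where c: "IS (\<lambda>t. c) = y b - y a - IS g" using IS_const_surj by blast
  define u where "u = (\<lambda>t. c + integral {a..t} f)"
  have u: "lip_ae a b u" "AE t in M. vd u t = f t" unfolding u_def by (rule lip_ae_integral[OF ef])+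
  have ug: "u = (\<lambda>t. c + g t)" by (simp add: u_def g_def)
  have ISu: "IS u = y b - y a"
    unfolding ug IS_add[OF ess_bounded_const lip_ae_ess_bounded[OF g]] c by simp
  define x where "x = primitive (y a) u"
  note x = primitive[OF lip_ae_ess_bounded[OF u(1)], where c = "y a", folded x_def]
  have xb: "x b = y b" using x(4) ISu by simp
  define r where "r = (\<lambda>t. y t - x t)"
  have cr: "continuous_on {a..b} r" unfolding r_def by (intro continuous_intros cont lip_ae_continuous_on x)
  have er: "ess_bounded a b r" by (rule ess_bounded_continuous[OF cr])
  define R where "R = (\<lambda>t. 0 + integral {a..t} r)"
  have R: "lip_ae a b R" unfolding R_def by (rule lip_ae_integral(1)[OF er])
  \<comment> \<open>This constant brings \<open>z\<close> back to \<open>0\<close> at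
    \<open>b\<close>; then \<open>bd a b z = 0\<close> lies in \<open>V\<close>, whatever
    \<open>V\<close> is.\<close>
  obtain d where d: "IS (\<lambda>t. d) = - IS R" using IS_const_surj by blast
  define v where "v = (\<lambda>t. d + integral {a..t} r)"
  have v: "lip_ae a b v" "AE t in M. vd v t = r t" unfolding v_def by (rule lip_ae_integral[OF er])+
  have vR: "v = (\<lambda>t. d + R t)" by (simp add: v_def R_def)
  have ISv: "IS v = 0"
    unfolding vR IS_add[OF ess_bounded_const lip_ae_ess_bounded[OF R]] d by simp
  define z where "z = primitive 0 v"
  note z = primitive[OF lip_ae_ess_bounded[OF v(1)], where c = 0, folded z_def]
  have z0: "z a = 0" "z b = 0" using z(3,4) ISv by auto
  have bz: "bd a b z = 0" using z0 by (simp add: bd_def bvec_def vec_eq_iff split: sum.split)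
  have zD: "z \<in> D" using z bz vec.subspace_0[OF V] by (auto simp: D_def)
  have "\<beta> (bd a b y) (bd a b z) = 0"
    using \<beta>_bound[OF bdV, of 0] vec.subspace_0[OF V] unfolding bz by simp
  then have "v b \<bullet> y b - v a \<bullet> y a - (\<integral>t. vd v t \<bullet> y t \<partial>M) +
    (\<integral>t. (cm (Q t) *v z t - \<rho> *\<^sub>R (cm (W t) *v z t)) \<bullet> y t \<partial>M) = 0"
    using weak[OF zD v(1) z(2)] unfolding vw_def by simp
  then have "(\<integral>t. vd v t \<bullet> y t \<partial>M) = (\<integral>t. vd v t \<bullet> x t \<partial>M)"
    using green[OF ey x(1) u(1) z(1) v(1) x(2) z(2) u(2)[unfolded f_def]] z0 xb x(3) by simp
  moreover have "(\<integral>t. vd v t \<bullet> y t \<partial>M) - (\<integral>t. vd v t \<bullet> x t \<partial>M) = (\<integral>t. vd v t \<bullet> r t \<partial>M)"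
    unfolding r_def inner_diff_right
    using ess_bounded_inner[OF ess_vd[OF v(1)] ey] ess_bounded_inner[OF ess_vd[OF v(1)] lip_ae_ess_bounded[OF x(1)]]
    by (simp add: ess_bounded_integrable)
  moreover have "(\<integral>t. vd v t \<bullet> r t \<partial>M) = (\<integral>t. r t \<bullet> r t \<partial>M)"
  proof (intro ess_integral_cong ess_bounded_inner ess_vd er v(1))
    show "AE t in M. vd v t \<bullet> r t = r t \<bullet> r t" using v(2) by eventually_elim simp
  qed
  ultimately have "(\<integral>t. r t \<bullet> r t \<partial>M) = 0" by simp
  then have "r t = 0" if "t \<in> {a..b}" for t by (rule continuous_zero[OF cr _ that])
  then have yx: "y = x" using out x(5) unfolding r_def by (metis eq_iff_diff_eq_0 ext)
  have yD: "y \<in> D" using out bdV x(1) unfolding D_def yx by auto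
  have "bvec (u a) (u b) \<bullet> Z + \<beta> (bd a b y) Z = 0" if Z: "Z \<in> V" for Z
  proof -
    define Z1 Z2 where "Z1 = (\<chi> i. Z $ Inl i)" and "Z2 = (\<chi> i. Z $ Inr i)"
    have ZZ: "Z = bvec Z1 Z2" by (auto simp: bvec_def vec_eq_iff Z1_def Z2_def split: sum.split)
    \<comment> \<open>A constant quasi-derivative is enough to reach every boundary vector; the
      increment from \<open>- Z1\<close> at \<open>a\<close> to \<open>Z2\<close> at
      \<open>b\<close> is \<open>Z2 + Z1\<close>.\<close>
    obtain d where d: "IS (\<lambda>t. d) = Z2 + Z1" using IS_const_surj by blast
    define z where "z = primitive (- Z1) (\<lambda>t. d)"
    note z = primitive[OF ess_bounded_const[of a b d], where c = "- Z1", folded z_def]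
    have bz: "bd a b z = Z" using z(3,4) d ZZ by (simp add: bd_def)
    have zD: "z \<in> D" using z bz Z by (auto simp: D_def)
    have v: "lip_ae a b (\<lambda>t. d)" "AE t in M. vd (\<lambda>t. d) t = 0"
      using lip_ae_smooth[of "\<lambda>t. d" "\<lambda>t. 0"] by auto
    have "(\<integral>t. (cm (Q t) *v z t - \<rho> *\<^sub>R (cm (W t) *v z t)) \<bullet> y t \<partial>M) =
      (u b \<bullet> z b - u a \<bullet> z a) - (d \<bullet> y b - d \<bullet> y a) + (\<integral>t. vd (\<lambda>t. d) t \<bullet> y t \<partial>M)"
      using green[OF ey x(1) u(1) z(1) v(1) x(2) z(2) u(2)[unfolded f_def]] yx by simp
    then have "u b \<bullet> z b - u a \<bullet> z a + \<beta> (bd a b y) Z = 0"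
      using weak[OF zD v(1) z(2)] unfolding vw_def bz by simp
    moreover have "bvec (u a) (u b) \<bullet> Z = u b \<bullet> z b - u a \<bullet> z a"
      unfolding bz[symmetric] bd_def bvec_inner by simp
    ultimately show ?thesis by simp
  qed
  then show ?thesis unfolding eig_def using yD u x(2) unfolding f_def yx by blast
qed

text \<open>From left to right this is \<open>weak_solution_regular\<close> for a \<open>y\<close>
  that already lies in \<open>D\<close>; from right to left it is one integration by parts.\<close>

lemma radical_iff_eig: "(y \<in> D \<and> (\<forall>z\<in>D. q y z = \<rho> * w y z)) \<longleftrightarrow> eig \<rho> y"
proof
  assume y: "y \<in> D \<and> (\<forall>z\<in>D. q y z = \<rho> * w y z)"
  show "eig \<rho> y"
  proof (rule weak_solution_regular)
    show "continuous_on {a..b} y" using y DD lip_ae_continuous_on by blast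
    show "vw \<rho> y z v = 0" if "z \<in> D" "lip_ae a b v" "AE t in M. cm (P t) *v vd z t = v t" for z v
      using vw_eq[OF _ that, of y \<rho>] y that(1) by simp
  qed (use y DD in auto)
next
  assume e: "eig \<rho> y"
  then obtain u where y: "y \<in> D" and u: "lip_ae a b u" "AE t in M. cm (P t) *v vd y t = u t"
    "AE t in M. vd u t = cm (Q t) *v y t - \<rho> *\<^sub>R (cm (W t) *v y t)"
    "\<And>Z. Z \<in> V \<Longrightarrow> bvec (u a) (u b) \<bullet> Z + \<beta> (bd a b y) Z = 0" unfolding eig_def by blast
  have "q y z = \<rho> * w y z" if z: "z \<in> D" for z
  proof -
    note l = DD(1)[OF y] DD(1)[OF z]
    note es = lip_ae_ess_bounded[OF l(1)] lip_ae_ess_bounded[OF l(2)]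
    have 1: "ess_bounded a b (\<lambda>t. u t \<bullet> vd z t)" "ess_bounded a b (\<lambda>t. vd u t \<bullet> z t)"
      by (intro ess_bounded_inner ess_vd lip_ae_ess_bounded u l)+
    have "AE t in M. iq y z t = (u t \<bullet> vd z t + vd u t \<bullet> z t) + \<rho> * iw y z t"
      using u(2,3) by eventually_elim (simp add: iq_def iw_def inner_diff_left)
    then have "integral\<^sup>L M (iq y z) = (\<integral>t. u t \<bullet> vd z t + vd u t \<bullet> z t \<partial>M) + \<rho> * w y z"
      unfolding w_def by (intro ess_integral_linear ess_bounded_add 1 ess_iw es ess_iq l)
    also have "(\<integral>t. u t \<bullet> vd z t + vd u t \<bullet> z t \<partial>M) = u b \<bullet> z b - u a \<bullet> z a"
      by (rule integral_by_parts[OF u(1) l(2) ab'])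
    also have "\<dots> = bvec (u a) (u b) \<bullet> bd a b z" by (simp add: bd_def bvec_inner)
    finally show ?thesis using u(4)[OF DD(2)[OF z]] unfolding q_def by simp
  qed
  then show "y \<in> D \<and> (\<forall>z\<in>D. q y z = \<rho> * w y z)" using y by blast
qed

text \<open>A subsequence converges uniformly to some \<open>k\<close>, the weak equation in the
  form \<open>vw\<close> passes to the limit, and regularity puts \<open>k\<close> into
  \<open>D\<close>. Along the subsequence \<open>w (y j) k\<close> is close to
  \<open>w (y j) (y j) = 1\<close>, so it does not tend to \<open>0\<close>.\<close>

lemma attainment_eig:
  fixes y :: "nat \<Rightarrow> real \<Rightarrow> complex^'d"
  assumes y: "\<And>j. y j \<in> D" "\<And>j. w (y j) (y j) = 1" "\<And>j. q (y j) (y j) \<le> K"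
    and lim: "\<And>z. z \<in> D \<Longrightarrow> (\<lambda>j. q (y j) z - \<rho> * w (y j) z) \<longlonglongrightarrow> 0"
  shows "\<exists>k\<in>D. (\<forall>z\<in>D. q k z = \<rho> * w k z) \<and> \<not> (\<lambda>j. w (y j) k) \<longlonglongrightarrow> 0"
proof -
  obtain g and r :: "nat \<Rightarrow> nat" where gr: "continuous_on {a..b} g" "strict_mono r"
    "uniform_limit {a..b} (\<lambda>j. y (r j)) g sequentially" by (rule uniform_subsequence[OF y])
  define k where "k = ext g"
  have kg: "k t = g t" if "t \<in> {a..b}" for t using that by (simp add: k_def ext_def)
  have kc: "continuous_on {a..b} k" by (rule continuous_on_eq[OF gr(1)]) (simp add: kg)
  have ek: "ess_bounded a b k" by (rule ess_bounded_continuous[OF kc])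
  have ul: "uniform_limit {a..b} (\<lambda>j. y (r j)) k sequentially"
    using gr(3) kg by (simp add: uniform_limit_iff)
  have pt: "(\<lambda>j. y (r j) t) \<longlonglongrightarrow> k t" if "t \<in> {a..b}" for t
    using tendsto_uniform_limitI[OF ul that] .
  have pa: "(\<lambda>j. y (r j) a) \<longlonglongrightarrow> k a" "(\<lambda>j. y (r j) b) \<longlonglongrightarrow> k b" using pt ab by auto
  have bdl: "(\<lambda>j. bd a b (y (r j))) \<longlonglongrightarrow> bd a b k"
  proof (rule vec_tendstoI)
    fix i :: "'d + 'd"
    show "(\<lambda>j. bd a b (y (r j)) $ i) \<longlonglongrightarrow> bd a b k $ i"
      using pa by (cases i) (auto simp: bd_def bvec_def intro!: tendsto_intros)
  qed
  \<comment> \<open>As a subspace of a finite-dimensional space \<open>V\<close> is closed, so it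
    contains the limit of the boundary vectors.\<close>
  have "subspace V"
    using V real_V unfolding subspace_def by (auto intro: vec.subspace_0 vec.subspace_add)
  then have "closed V" by (rule closed_subspace)
  then have kV: "bd a b k \<in> V"
    using closed_sequentially[OF _ _ bdl] DD(2)[OF y(1)] by blast
  have ey: "ess_bounded a b (y j)" for j using DD(1)[OF y(1)] lip_ae_ess_bounded by blast
  have weak: "vw \<rho> k z v = 0" if z: "z \<in> D" and v: "lip_ae a b v" and Pz: "AE t in M. cm (P t) *v vd z t = v t" for z v
  proof -
    have bl: "(\<lambda>j. \<beta> (bd a b (y (r j))) (bd a b z)) \<longlonglongrightarrow> \<beta> (bd a b k) (bd a b z)"
    proof -
      have le: "\<bar>\<beta> (bd a b (y (r j))) (bd a b z) - \<beta> (bd a b k) (bd a b z)\<bar> \<le> C * norm (bd a b (y (r j)) - bd a b k) * norm (bd a b z)" for j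
      proof -
        have V1: "bd a b (y (r j)) \<in> V" "bd a b (y (r j)) - bd a b k \<in> V"
          using DD(2)[OF y(1)] kV vec.subspace_diff[OF V] by auto
        have "\<beta> (bd a b (y (r j))) (bd a b z) = \<beta> (bd a b (y (r j)) - bd a b k) (bd a b z) + \<beta> (bd a b k) (bd a b z)"
          using \<beta>_add[OF V1(2) kV DD(2)[OF z]] by simp
        then show ?thesis using \<beta>_bound[OF V1(2) DD(2)[OF z]] by simp
      qed
      have "(\<lambda>j. C * norm (bd a b (y (r j)) - bd a b k) * norm (bd a b z)) \<longlonglongrightarrow> C * norm (bd a b k - bd a b k) * norm (bd a b z)"
        by (intro tendsto_intros bdl)
      then have g0: "(\<lambda>j. C * norm (bd a b (y (r j)) - bd a b k) * norm (bd a b z)) \<longlonglongrightarrow> 0" by simp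
      have "(\<lambda>j. \<beta> (bd a b (y (r j))) (bd a b z) - \<beta> (bd a b k) (bd a b z)) \<longlonglongrightarrow> 0"
        by (rule Lim_null_comparison[OF always_eventually g0]) (use le in simp)
      then show ?thesis by (rule LIM_zero_cancel)
    qed
    have "(\<lambda>j. vw \<rho> (y (r j)) z v) \<longlonglongrightarrow> vw \<rho> k z v"
      unfolding vw_def
      by (intro tendsto_intros pa bl integral_inner_limit ess_vd ess_potential lip_ae_ess_bounded[OF DD(1)[OF z]] v ey ek ul)
    moreover have "(\<lambda>j. vw \<rho> (y (r j)) z v) \<longlonglongrightarrow> 0"
      using LIMSEQ_subseq_LIMSEQ[OF lim[OF z] gr(2)] vw_eq[OF y(1) z v Pz] by (simp add: o_def)
    ultimately show ?thesis by (rule LIMSEQ_unique)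
  qed
  have "eig \<rho> k"
  proof (rule weak_solution_regular[OF kc _ kV weak])
    show "k t = 0" if "t \<notin> {a..b}" for t using that unfolding k_def ext_def by (rule if_not_P)
  qed
  then have k: "k \<in> D" "\<forall>z\<in>D. q k z = \<rho> * w k z" using radical_iff_eig by blast+
  have "\<not> (\<lambda>j. w (y j) k) \<longlonglongrightarrow> 0"
  proof
    assume "(\<lambda>j. w (y j) k) \<longlonglongrightarrow> 0"
    then have l0: "(\<lambda>j. w (y (r j)) k) \<longlonglongrightarrow> 0" using LIMSEQ_subseq_LIMSEQ[OF _ gr(2)] by (simp add: o_def)
    obtain B where B: "\<And>t. t \<in> {a..b} \<Longrightarrow> norm (k t) \<le> B"
      using compact_imp_bounded[OF compact_continuous_image[OF kc compact_Icc]] unfolding bounded_iff by blast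
    define B1 where "B1 = max B 0 + 1"
    \<comment> \<open>At uniform distance \<open>e\<close> from \<open>k\<close>, the number
      \<open>w (y (r n)) k\<close> differs from \<open>1\<close> by at most
      \<open>1 / 2\<close>.\<close>
    define e where "e = min 1 (1 / (2 * ((b - a) * (C * B1) + 1)))"
    have B1: "B1 > 0" by (simp add: B1_def)
    have pos: "(b - a) * (C * B1) \<ge> 0" using ab C B1 by simp
    have e: "e > 0" "e \<le> 1" using pos by (auto simp: e_def)
    have eb: "(b - a) * (C * B1 * e) \<le> 1 / 2"
    proof -
      have "(b - a) * (C * B1 * e) = ((b - a) * (C * B1)) * e" by simp
      also have "\<dots> \<le> ((b - a) * (C * B1)) * (1 / (2 * ((b - a) * (C * B1) + 1)))"
        using pos by (intro mult_left_mono) (auto simp: e_def)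
      also have "\<dots> \<le> 1 / 2" using pos by (simp add: divide_le_eq)
      finally show ?thesis .
    qed
    have "\<forall>\<^sub>F n in sequentially. \<forall>x\<in>{a..b}. dist (y (r n) x) (k x) < e"
      using ul e(1) unfolding uniform_limit_iff by blast
    moreover have "\<forall>\<^sub>F n in sequentially. \<bar>w (y (r n)) k\<bar> < 1 / 2"
      using l0 unfolding tendsto_iff by (auto simp: dist_real_def dest: spec[of _ "1/2"])
    ultimately have "\<forall>\<^sub>F n in sequentially. False"
    proof eventually_elim
      case (elim n)
      interpret Wf: hform fsc D w by (rule hform_w)
      have "norm (y (r n) t) \<le> B1" if "t \<in> {a..b}" for t
        using B[OF that] elim(1) that e(2) norm_triangle_sub[of "y (r n) t" "k t"] by (force simp: B1_def dist_norm)
      moreover have "norm ((y (r n) - k) t) \<le> e" if "t \<in> {a..b}" for t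
        using elim(1) that by (auto simp: dist_norm fun_diff_def intro: less_imp_le)
      moreover have "ess_bounded a b (y (r n) - k)"
        using ess_bounded_diff[OF ey ek] by (simp add: fun_diff_def)
      ultimately have "\<bar>w (y (r n)) (y (r n) - k)\<bar> \<le> (b - a) * (C * B1 * e)"
        using w_bound[OF ey[of "r n"], of "y (r n) - k" B1 e] B1 by simp
      moreover have "w (y (r n)) (y (r n) - k) = 1 - w (y (r n)) k"
        using Wf.diff_right[OF y(1) k(1) y(1), of "r n" "r n"] y(2) by simp
      ultimately show False using eb elim(2) by linarith
    qed
    then show False by simp
  qed
  then show ?thesis using k by blast
qed

sublocale FP: form_pair fsc D q w "cL / \<mu>"
proof -
  interpret Qf: hform fsc D q by (rule hform_q)
  interpret Wf: hform fsc D w by (rule hform_w)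
  show "form_pair fsc D q w (cL / \<mu>)"
  proof unfold_locales
    show "0 < w x x" if "x \<in> D" "x \<noteq> 0" for x using that by (rule w_positive)
    show "- (cL / \<mu>) * w x x \<le> q x x" if "x \<in> D" for x using that by (rule q_bounded_below)
  qed (rule compactness_w attainment_eig; blast)+
qed

end

section \<open>Self-adjoint boundary conditions\<close>

lemma adjm_inner:
  fixes M :: "complex^'n::finite^'m::finite"
  shows "(M *v x) \<bullet> y = x \<bullet> (adjm M *v y)"
proof -
  have c: "(m * x) \<bullet> y = x \<bullet> (cnj m * y)" for m x y :: complex
    by (simp add: inner_complex_def algebra_simps)
  show ?thesis
    unfolding inner_vec_def matrix_vector_mult_def adjm_def vec_lambda_beta inner_sum_left inner_sum_right c
    by (rule sum.swap)
qed

lemma bounded_linear_mv: "bounded_linear (\<lambda>x. (M :: complex^'n::finite^'m::finite) *v x)"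
  unfolding linear_conv_bounded_linear[symmetric]
proof (rule linearI)
  show "M *v (r *\<^sub>R x) = r *\<^sub>R (M *v x)" for r x
    using vector_scalar_commute[of M "complex_of_real r" x] by (simp add: of_real_vector_scalar)
qed (rule matrix_vector_right_distrib)

lemma linear_mv: "linear (\<lambda>x. (M :: complex^'n::finite^'m::finite) *v x)"
  using bounded_linear_mv by (rule bounded_linear.linear)

text \<open>The rank of \<open>(A|B)\<close> equals the number of its rows, so the rows are
  independent; a common zero of \<open>A*\<close> and \<open>B*\<close> is, after conjugation, the
  coefficient vector of a relation between them.\<close>

lemma adm_injective:
  fixes A B :: "'d::finite cmat2"
  assumes adm: "(A, B) \<in> BC_adm" and x: "adjm A *v x = 0" "adjm B *v x = 0"
  shows "x = 0"
proof (rule ccontr)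
  assume "x \<noteq> 0"
  let ?M = "concat_mat A B"
  have rk: "vec.dim (rows ?M) = CARD('d + 'd)"
    using adm by (simp add: BC_adm_def row_rank_def_gen)
  have rows: "rows ?M = range (\<lambda>i. row i ?M)" by (auto simp: rows_def)
  have fin: "finite (rows ?M)" unfolding rows by simp
  have "vec.dim (rows ?M) \<le> card (rows ?M)" by (rule vec.dim_le_card') (rule fin)
  moreover have "card (rows ?M) \<le> CARD('d + 'd)" unfolding rows by (rule card_image_le) simp
  ultimately have card: "card (rows ?M) = CARD('d + 'd)" using rk by simp
  \<comment> \<open>Repeated rows would leave a set of rows too small for this rank.\<close>
  then have inj: "inj (\<lambda>i. row i ?M)" unfolding rows by (intro eq_card_imp_inj_on) auto
  have ind: "vec.independent (rows ?M)"
    using vec.card_eq_dim[of "rows ?M" "rows ?M"] card rk fin vec.span_superset by auto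
  have 0: "(\<Sum>i\<in>UNIV. cnj (x $ i) *s row i ?M) = 0"
  proof (rule vec_eq_iff[THEN iffD2], rule allI)
    fix j
    have a: "(\<Sum>i\<in>UNIV. cnj (x $ i) * N $ i $ k) = 0" if N: "adjm N *v x = 0" for N :: "'d cmat2" and k
    proof -
      have "(adjm N *v x) $ k = 0" using N by simp
      then have "cnj ((adjm N *v x) $ k) = 0" by simp
      then show ?thesis by (simp add: matrix_vector_mult_def adjm_def mult.commute)
    qed
    show "(\<Sum>i\<in>UNIV. cnj (x $ i) *s row i ?M) $ j = 0 $ j"
      using a[OF x(1)] a[OF x(2)] by (cases j) (simp_all add: row_def concat_mat_def)
  qed
  define c where "c = (\<lambda>v. cnj (x $ inv (\<lambda>i. row i ?M) v))"
  have "(\<Sum>v\<in>rows ?M. c v *s v) = 0"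
    unfolding rows by (subst sum.reindex[OF inj]) (simp add: c_def inv_f_f[OF inj] 0)
  then have "c v = 0" if "v \<in> rows ?M" for v
    using vec.independentD[OF ind fin subset_refl _ that] by blast
  then have "cnj (x $ i) = 0" for i
    unfolding rows c_def using inv_f_f[OF inj] by (metis rangeI)
  then show False using \<open>x \<noteq> 0\<close> by (simp add: vec_eq_iff)
qed

lemma adm_commute:
  assumes "(A, B) \<in> BC_adm" shows "A *v (adjm B *v z) = B *v (adjm A *v z)"
  using assms by (simp add: BC_adm_def matrix_vector_mul_assoc)

text \<open>Every solution of \<open>A Y + B U = 0\<close> is of the form \<open>(B* t, - A* t)\<close>: the square system
  \<open>(A Y + B U, B Y - A U)\<close> is solvable for every right-hand side because \<open>A A* + B B*\<close> is
  invertible, hence it is uniquely solvable.\<close>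
lemma adm_kernel:
  fixes A B :: "'d::finite cmat2"
  assumes adm: "(A, B) \<in> BC_adm" and eq: "A *v Y + B *v U = 0"
  obtains t where "Y = adjm B *v t" "U = - (adjm A *v t)"
proof -
  define G where "G = (\<lambda>z. A *v (adjm A *v z) + B *v (adjm B *v z))"
  have lG: "linear G" unfolding G_def by (intro linear_compose_add linear_compose[OF linear_mv linear_mv, unfolded o_def])
  have "z = 0" if z: "G z = 0" for z
  proof -
    have "z \<bullet> G z = (adjm A *v z) \<bullet> (adjm A *v z) + (adjm B *v z) \<bullet> (adjm B *v z)"
      using adjm_inner[of A "adjm A *v z" z] adjm_inner[of B "adjm B *v z" z]
      by (simp add: G_def inner_add_right inner_commute)
    then have "(adjm A *v z) \<bullet> (adjm A *v z) = 0" "(adjm B *v z) \<bullet> (adjm B *v z) = 0"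
      using z inner_ge_zero[of "adjm A *v z"] inner_ge_zero[of "adjm B *v z"] by (auto simp: add_nonneg_eq_0_iff)
    then show "z = 0" using adm_injective[OF adm] by simp
  qed
  then have "inj G" using lG by (simp add: linear_injective_0)
  then have sG: "surj G" using linear_inj_imp_surj[OF lG] by blast
  define f where "f = (\<lambda>p. (A *v fst p + B *v snd p, B *v fst p - A *v snd p))"
  have lf: "linear f"
    unfolding f_def
    by (rule linearI) (simp_all add: linear_add[OF linear_mv] linear_scale[OF linear_mv] algebra_simps)
  have fJ: "f (adjm A *v s + adjm B *v t, adjm B *v s - adjm A *v t) = (G s, G t)" for s t
    by (simp add: f_def G_def linear_add[OF linear_mv] linear_diff[OF linear_mv] adm_commute[OF adm])
  have "surj f"
  proof (rule surjI)
    fix p :: "(complex^('d + 'd)) \<times> (complex^('d + 'd))"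
    show "f (adjm A *v inv G (fst p) + adjm B *v inv G (snd p), adjm B *v inv G (fst p) - adjm A *v inv G (snd p)) = p"
      unfolding fJ using surj_f_inv_f[OF sG] by simp
  qed
  then have "inj f" using linear_surj_imp_inj[OF lf] by blast
  \<comment> \<open>\<open>(Y, U)\<close> and the pair made from \<open>t\<close> both have image
    \<open>(0, G t)\<close> under \<open>f\<close>; the first component is the boundary
    condition.\<close>
  obtain t where t: "G t = B *v Y - A *v U" using sG by (metis surjD)
  have "f (Y, U) = f (adjm A *v 0 + adjm B *v t, adjm B *v 0 - adjm A *v t)"
    unfolding fJ t using eq linear_0[OF lG] by (simp add: f_def)
  then have "(Y, U) = (adjm A *v 0 + adjm B *v t, adjm B *v 0 - adjm A *v t)" by (rule injD[OF \<open>inj f\<close>])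
  then show thesis using that by simp
qed

text \<open>By \<open>A B* = B A*\<close>, the vector \<open>A* z\<close> depends on the choice of \<open>z\<close> in \<open>\<beta>bc\<close> only up to a vector orthogonal
  to the range of \<open>B*\<close>.\<close>
definition Vbc :: "'d::finite cmat2 \<Rightarrow> (complex^('d + 'd)) set" where
  "Vbc B = range (\<lambda>z. adjm B *v z)"

definition \<beta>bc :: "'d::finite cmat2 \<Rightarrow> 'd cmat2 \<Rightarrow> complex^('d + 'd) \<Rightarrow> complex^('d + 'd) \<Rightarrow> real" where
  "\<beta>bc A B Y Z = (adjm A *v (SOME z. adjm B *v z = Y)) \<bullet> Z"

lemma adm_inner_swap:
  assumes "(A, B) \<in> BC_adm" shows "(adjm A *v z) \<bullet> (adjm B *v x) = (adjm B *v z) \<bullet> (adjm A *v x)"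
  using adm_commute[OF assms] adjm_inner[of A "adjm B *v x" z] adjm_inner[of B "adjm A *v x" z]
  by (metis inner_commute)

lemma \<beta>bc_eq:
  assumes "(A, B) \<in> BC_adm" "Z \<in> Vbc B"
  shows "\<beta>bc A B (adjm B *v z) Z = (adjm A *v z) \<bullet> Z"
proof -
  obtain x where x: "Z = adjm B *v x" using assms(2) by (auto simp: Vbc_def)
  have "adjm B *v (SOME z'. adjm B *v z' = adjm B *v z) = adjm B *v z" by (rule someI) simp
  then show ?thesis unfolding \<beta>bc_def x adm_inner_swap[OF assms(1)] by simp
qed

text \<open>From right to left: tested against the whole range of \<open>B*\<close>, the condition
  says \<open>B (U + A* z) = 0\<close>, and \<open>B A* z = A B* z = A Y\<close>.\<close>

lemma adm_boundary_iff:
  assumes adm: "(A, B) \<in> BC_adm"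
  shows "A *v Y + B *v U = 0 \<longleftrightarrow> Y \<in> Vbc B \<and> (\<forall>Z\<in>Vbc B. U \<bullet> Z + \<beta>bc A B Y Z = 0)"
proof
  assume "A *v Y + B *v U = 0"
  then obtain t where t: "Y = adjm B *v t" "U = - (adjm A *v t)" using adm_kernel[OF adm] by blast
  then show "Y \<in> Vbc B \<and> (\<forall>Z\<in>Vbc B. U \<bullet> Z + \<beta>bc A B Y Z = 0)"
    using \<beta>bc_eq[OF adm] by (auto simp: Vbc_def)
next
  assume h: "Y \<in> Vbc B \<and> (\<forall>Z\<in>Vbc B. U \<bullet> Z + \<beta>bc A B Y Z = 0)"
  then obtain z where z: "Y = adjm B *v z" by (auto simp: Vbc_def)
  have "(B *v (U + adjm A *v z)) \<bullet> x = 0" for x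
  proof -
    have xV: "adjm B *v x \<in> Vbc B" by (auto simp: Vbc_def)
    have "U \<bullet> (adjm B *v x) + (adjm A *v z) \<bullet> (adjm B *v x) = 0"
      using h xV \<beta>bc_eq[OF adm xV, of z] unfolding z by fastforce
    then show ?thesis using adjm_inner[of B "U + adjm A *v z" x] by (simp add: inner_add_left)
  qed
  then have "B *v (U + adjm A *v z) = 0" using inner_eq_zero_iff by blast
  then show "A *v Y + B *v U = 0"
    unfolding z adm_commute[OF adm] by (simp add: linear_add[OF linear_mv] add.commute)
qed

text \<open>All properties of \<open>\<beta>bc\<close> are read off from arbitrary preimages by
  \<open>\<beta>bc_eq\<close>. The estimate \<open>bound\<close> is an assumption here because its
  constant has to be the same for a whole neighbourhood of conditions.\<close>

lemma sl_form_bc: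
  fixes P Q W :: "real \<Rightarrow> real^'d::finite^'d" and A B :: "'d cmat2"
  assumes "a < b" "\<mu> > 0" "C > 0"
    and "ess_bounded a b P" "ess_bounded a b Q" "ess_bounded a b W"
    and "AE t in lebesgue_on {a..b}. transpose (P t) = P t \<and> transpose (Q t) = Q t \<and> transpose (W t) = W t"
    and "AE t in lebesgue_on {a..b}. (\<forall>x::real^'d. \<mu> * (x \<bullet> x) \<le> x \<bullet> (P t *v x)) \<and>
      (\<forall>x::real^'d. \<mu> * (x \<bullet> x) \<le> x \<bullet> (W t *v x))"
    and "AE t in lebesgue_on {a..b}. \<forall>x::complex^'d. norm (cm (P t) *v x) \<le> C * norm x \<and>
      norm (cm (Q t) *v x) \<le> C * norm x \<and> norm (cm (W t) *v x) \<le> C * norm x"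
    and adm: "(A, B) \<in> BC_adm"
    and bound: "\<And>Y. Y \<in> Vbc B \<Longrightarrow> \<exists>z. adjm B *v z = Y \<and> norm (adjm A *v z) \<le> C * norm Y"
  shows "sl_form a b P Q W (Vbc B) (\<beta>bc A B) \<mu> C"
proof (intro sl_form.intro assms)
  show "vec.subspace (Vbc B)"
    unfolding Vbc_def
    by (rule vec.subspaceI)
      (auto simp: image_iff linear_add[OF linear_mv, symmetric] vector_scalar_commute[symmetric]
        intro: exI[of _ 0])
  fix X Y Z assume V: "X \<in> Vbc B" "Y \<in> Vbc B" "Z \<in> Vbc B"
  obtain x y z where xyz: "X = adjm B *v x" "Y = adjm B *v y" "Z = adjm B *v z" using V by (auto simp: Vbc_def)
  note e = \<beta>bc_eq[OF adm]
  show "\<beta>bc A B Y Z = \<beta>bc A B Z Y"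
    using e[OF V(3), of y] e[OF V(2), of z] adm_inner_swap[OF adm, of y z] unfolding xyz by (simp add: inner_commute)
  show "\<beta>bc A B (X + Y) Z = \<beta>bc A B X Z + \<beta>bc A B Y Z"
    using e[OF V(3), of x] e[OF V(3), of y] e[OF V(3), of "x + y"] unfolding xyz
    by (simp add: linear_add[OF linear_mv] inner_add_left)
  show "\<beta>bc A B (r *\<^sub>R Y) Z = r * \<beta>bc A B Y Z" for r
    using e[OF V(3), of y] e[OF V(3), of "r *\<^sub>R y"] unfolding xyz
    by (simp add: linear_scale[OF linear_mv])
  have "\<i> *s Z \<in> Vbc B" unfolding xyz Vbc_def by (auto simp: vector_scalar_commute[symmetric])
  then show "\<beta>bc A B (\<i> *s Y) (\<i> *s Z) = \<beta>bc A B Y Z"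
    using e[OF V(3), of y] e[of "\<i> *s Z" "\<i> *s y"] unfolding xyz
    by (simp add: vector_scalar_commute inner_rotate)
  obtain z where z: "adjm B *v z = Y" "norm (adjm A *v z) \<le> C * norm Y" using bound[OF V(2)] by blast
  have "\<bar>\<beta>bc A B Y Z\<bar> \<le> norm (adjm A *v z) * norm Z"
    using e[OF V(3), of z] Cauchy_Schwarz_ineq2[of "adjm A *v z" Z] z(1) by simp
  also have "\<dots> \<le> C * norm Y * norm Z" using z(2) by (rule mult_right_mono) simp
  finally show "\<bar>\<beta>bc A B Y Z\<bar> \<le> C * norm Y * norm Z" .
qed

lemma BC_adm_action:
  fixes A B T :: "'d::finite cmat2"
  assumes "(A, B) \<in> BC_adm" "invertible T"
  shows "A *v Y + B *v U = 0 \<longleftrightarrow> (T ** A) *v Y + (T ** B) *v U = 0"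
proof -
  obtain T' where T': "T' ** T = mat 1" using assms(2) by (auto simp: invertible_def)
  have "(T ** A) *v Y + (T ** B) *v U = T *v (A *v Y + B *v U)"
    by (simp add: matrix_vector_mul_assoc[symmetric] linear_add[OF linear_mv])
  moreover have "T *v x = 0 \<longleftrightarrow> x = 0" for x
    using T' by (metis matrix_vector_mul_assoc matrix_vector_mul_lid vec.zero matrix_vector_mult_0_right)
  ultimately show ?thesis by simp
qed

lemma equiv_BC_rel: "equiv BC_adm (BC_rel :: 'd::finite bcmat rel)"
proof (rule equivI)
  show "BC_rel \<subseteq> BC_adm \<times> (BC_adm :: 'd bcmat set)" by (auto simp: BC_rel_def)
  show "refl_on BC_adm (BC_rel :: 'd bcmat rel)"
    by (auto simp: refl_on_def BC_rel_def intro!: exI[of _ "mat 1"] simp: invertible_def)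
  show "sym (BC_rel :: 'd bcmat rel)"
  proof (rule symI)
    fix x y :: "'d bcmat" assume "(x, y) \<in> BC_rel"
    then obtain A B A' B' and T :: "'d cmat2" where h: "x = (A, B)" "y = (A', B')" "(A, B) \<in> BC_adm" "(A', B') \<in> BC_adm"
      "invertible T" "A' = T ** A" "B' = T ** B" by (auto simp: BC_rel_def)
    obtain T' where T': "T ** T' = mat 1" "T' ** T = mat 1" using h(5) by (auto simp: invertible_def)
    have "invertible T'" using T' by (auto simp: invertible_def)
    moreover have "A = T' ** A'" "B = T' ** B'" using h T' by (simp_all add: matrix_mul_assoc)
    ultimately show "(y, x) \<in> BC_rel" using h by (auto simp: BC_rel_def)
  qed
  show "trans (BC_rel :: 'd bcmat rel)"
  proof (rule transI)
    fix x y z :: "'d bcmat" assume "(x, y) \<in> BC_rel" "(y, z) \<in> BC_rel"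
    then obtain A B A' B' A'' B'' and T T' :: "'d cmat2" where h: "x = (A, B)" "z = (A'', B'')"
      "(A, B) \<in> BC_adm" "(A'', B'') \<in> BC_adm"
      "invertible T" "A' = T ** A" "B' = T ** B" "invertible T'" "A'' = T' ** A'" "B'' = T' ** B'"
      by (auto simp: BC_rel_def)
    have "invertible (T' ** T)" using h by (intro invertible_mult)
    then show "(x, z) \<in> BC_rel" using h by (auto simp: BC_rel_def matrix_mul_assoc)
  qed
qed

text \<open>\<open>is_solution\<close> asks for some representative. An invertible left factor does
  not change the kernel of \<open>(A|B)\<close>, so one fixed representative decides.\<close>

lemma class_boundary_iff:
  assumes c: "c \<in> BC_space" and AB: "(A, B) \<in> c"
  shows "(\<exists>A' B'. (A', B') \<in> c \<and> A' *v Y + B' *v U = 0) \<longleftrightarrow> A *v Y + B *v U = 0"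
proof
  assume "\<exists>A' B'. (A', B') \<in> c \<and> A' *v Y + B' *v U = 0"
  then obtain A' B' where h: "(A', B') \<in> c" "A' *v Y + B' *v U = 0" by blast
  have "((A, B), (A', B')) \<in> BC_rel"
    using in_quotient_imp_in_rel[OF equiv_BC_rel] c AB h(1) unfolding BC_space_def by blast
  then obtain T where "invertible T" "A' = T ** A" "B' = T ** B" "(A, B) \<in> BC_adm" by (auto simp: BC_rel_def)
  then show "A *v Y + B *v U = 0" using BC_adm_action h(2) by blast
qed (use AB in blast)

lemma class_adm: "c \<in> BC_space \<Longrightarrow> (A, B) \<in> c \<Longrightarrow> (A, B) \<in> BC_adm"
  unfolding BC_space_def using in_quotient_imp_subset[OF equiv_BC_rel] by blast

lemma abs_cont_continuous:
  fixes F :: "real \<Rightarrow> 'b::real_normed_vector"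
  assumes "abs_cont_on a b F" shows "continuous_on {a..b} F"
  unfolding continuous_on_iff
proof (intro ballI allI impI)
  fix x \<epsilon> :: real assume x: "x \<in> {a..b}" and \<epsilon>: "0 < \<epsilon>"
  obtain \<delta> where \<delta>: "\<delta> > 0" "\<And>D. finite D \<Longrightarrow> (\<forall>(s,t)\<in>D. a \<le> s \<and> s \<le> t \<and> t \<le> b) \<Longrightarrow>
        (\<forall>(s,t)\<in>D. \<forall>(s',t')\<in>D. (s,t) \<noteq> (s',t') \<longrightarrow> t \<le> s' \<or> t' \<le> s) \<Longrightarrow>
        (\<Sum>(s,t)\<in>D. t - s) < \<delta> \<Longrightarrow> (\<Sum>(s,t)\<in>D. norm (F t - F s)) < \<epsilon>"
    using assms \<epsilon> unfolding abs_cont_on_def by meson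
  have "dist (F y) (F x) < \<epsilon>" if y: "y \<in> {a..b}" "dist y x < \<delta>" for y
  proof -
    have "(\<Sum>(s,t)\<in>{(min x y, max x y)}. norm (F t - F s)) < \<epsilon>"
      by (rule \<delta>(2)) (use x y in \<open>auto simp: dist_real_def abs_if min_def max_def split: if_splits\<close>)
    then show ?thesis by (cases "x \<le> y") (auto simp: dist_norm norm_minus_commute)
  qed
  then show "\<exists>d>0. \<forall>x'\<in>{a..b}. dist x' x < d \<longrightarrow> dist (F x') (F x) < \<epsilon>" using \<delta>(1) by blast
qed

section \<open>Eigenspaces of the form and solutions of the differential equation\<close>

context sl_form begin

lemma ext_self: "y \<in> D \<Longrightarrow> ext y = y"
  using DD(3) by (auto simp: ext_def fun_eq_iff)

text \<open>Lagrange-type polynomials times a fixed vector: each vanishes at both endpoints, hence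
  satisfies every condition \<open>V\<close>, and at all nodes except its own, which gives
  independence.\<close>

lemma infinite_dimensional: "\<exists>B. B \<subseteq> D \<and> fs.independent B \<and> finite B \<and> card B = n"
proof -
  \<comment> \<open>The summand \<open>2\<close> keeps all nodes strictly below \<open>b\<close>,
    also the one for \<open>i = 0\<close>.\<close>
  define \<tau> where "\<tau> = (\<lambda>i::nat. a + (b - a) / (real i + 2))"
  have \<tau>: "a < \<tau> i" "\<tau> i < b" for i
  proof -
    have "(b - a) / (real i + 2) < (b - a) / 1" using ab by (intro divide_strict_left_mono) auto
    then show "\<tau> i < b" by (simp add: \<tau>_def)
  qed (use ab in \<open>simp add: \<tau>_def\<close>)
  have \<tau>inj: "i = j" if "\<tau> i = \<tau> j" for i j
    using that ab by (simp add: \<tau>_def)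
  define p where "p = (\<lambda>j. [:-a, 1:] * [:b, -1:] * (\<Prod>i\<in>{..<n} - {j}. [:- \<tau> i, 1:]))"
  have pv: "poly (p j) t = (t - a) * (b - t) * (\<Prod>i\<in>{..<n} - {j}. t - \<tau> i)" for j t
    unfolding p_def poly_mult poly_prod by simp
  have pab: "poly (p j) a = 0" "poly (p j) b = 0" for j by (simp_all add: pv)
  have p0: "poly (p j) (\<tau> k) = 0" if "k < n" "k \<noteq> j" for j k
    using that unfolding pv by auto
  have p1: "poly (p j) (\<tau> j) \<noteq> 0" for j
  proof -
    have "(\<Prod>i\<in>{..<n} - {j}. \<tau> j - \<tau> i) \<noteq> 0"
      using \<tau>inj by (subst prod_zero_iff) auto
    then show ?thesis using \<tau>[of j] unfolding pv by simp
  qed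
  obtain i0 :: 'd where True by blast
  define e :: "complex^'d" where "e = axis i0 1"
  have e0: "e \<noteq> 0" by (simp add: e_def axis_eq_0_iff)
  define f where "f = (\<lambda>j. ext (\<lambda>t. poly (p j) t *\<^sub>R e))"
  have fD: "f j \<in> D" for j
  proof -
    have d: "((\<lambda>t. poly (p j) t *\<^sub>R e) has_vector_derivative poly (pderiv (p j)) t *\<^sub>R e) (at t)" for t
      using has_vector_derivative_scaleR[OF poly_DERIV[of "p j" t] has_vector_derivative_const[of e]] by simp
    have "lip_ae a b (\<lambda>t. poly (p j) t *\<^sub>R e)"
      by (rule lip_ae_smooth(1)[OF d]) (intro continuous_intros)
    then have "lip_ae a b (f j)"
      by (rule lip_ae_cong(1)[rotated]) (simp add: f_def ext_def)
    moreover have "bd a b (f j) = 0"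
      using ab pab by (simp add: bd_def f_def ext_def bvec_def vec_eq_iff split: sum.split)
    moreover have "f j t = 0" if "t \<notin> {a..b}" for t using that unfolding f_def ext_def by (rule if_not_P)
    ultimately show ?thesis using vec.subspace_0[OF V] by (simp add: D_def)
  qed
  have fv: "f j (\<tau> k) = poly (p j) (\<tau> k) *\<^sub>R e" for j k
    using \<tau>[of k] by (simp add: f_def ext_def)
  have inj: "inj_on f {..<n}"
  proof (rule inj_onI)
    fix j k assume h: "j \<in> {..<n}" "k \<in> {..<n}" "f j = f k"
    then have "poly (p j) (\<tau> j) *\<^sub>R e = poly (p k) (\<tau> j) *\<^sub>R e" by (metis fv)
    then show "j = k" using p0[of j k] p1[of j] e0 h by auto
  qed
  have "fs.independent (f ` {..<n})"
  proof (rule ccontr)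
    assume "\<not> fs.independent (f ` {..<n})"
    then obtain u v where uv: "v \<in> f ` {..<n}" "u v \<noteq> 0" "(\<Sum>v\<in>f ` {..<n}. fsc (u v) v) = 0"
      by (auto simp: fs.dependent_finite)
    then obtain k where k: "k < n" "v = f k" by auto
    have "(\<Sum>j<n. fsc (u (f j)) (f j)) = 0" using uv(3) by (simp add: sum.reindex[OF inj])
    then have "(\<Sum>j<n. fsc (u (f j)) (f j)) (\<tau> k) = 0" by simp
    moreover have "(\<Sum>j\<in>F. fsc (u (f j)) (f j)) (\<tau> k) = (\<Sum>j\<in>F. fsc (u (f j)) (f j) (\<tau> k))" if "finite F" for F
      using that by (induction F rule: finite_induct) auto
    ultimately have "(\<Sum>j<n. u (f j) *s f j (\<tau> k)) = 0" by (simp add: fsc_def)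
    also have "(\<Sum>j<n. u (f j) *s f j (\<tau> k)) = (\<Sum>j<n. if j = k then u (f k) *s f k (\<tau> k) else 0)"
      using p0[OF k(1)] by (intro sum.cong) (auto simp: fv)
    also have "\<dots> = u (f k) *s (poly (p k) (\<tau> k) *\<^sub>R e)" using k(1) by (simp add: fv)
    finally have "u (f k) = 0 \<or> poly (p k) (\<tau> k) *\<^sub>R e = 0" by (simp only: vec.scale_eq_0_iff)
    then show False using uv k p1[of k] e0 by simp
  qed
  then show ?thesis using fD card_image[OF inj] by (intro exI[of _ "f ` {..<n}"]) auto
qed

end

locale sl_bvp = sl_form a b P Q W "Vbc B" "\<beta>bc A B" \<mu> C
  for a b :: real and P Q W :: "real \<Rightarrow> real^'d::finite^'d" and A B :: "'d cmat2" and \<mu> C :: real +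
  fixes c :: "'d bcclass"
  assumes c: "c \<in> BC_space" "(A, B) \<in> c"
begin

lemma adm: "(A, B) \<in> BC_adm" using c by (rule class_adm)

lemma ext_eq: "t \<in> {a..b} \<Longrightarrow> ext y t = y t" by (simp add: ext_def)

lemma bd_ext: "bd a b (ext y) = bvec (- y a) (y b)"
  using ab by (simp add: bd_def ext_def)

text \<open>A solution is at first only absolutely continuous. Since \<open>u\<close> is continuous,
  \<open>y' = P^{-1} u\<close> is essentially bounded, and this puts \<open>y\<close> into the
  Lipschitz form domain.\<close>

lemma solution_imp_eig:
  assumes "is_solution a b (P, Q, W) c \<rho> y" shows "eig \<rho> (ext y)"
proof -
  obtain u where ac: "abs_cont_on a b y" "abs_cont_on a b u"
    and de: "AE t in M. \<exists>y' u'. (y has_vector_derivative y') (at t) \<and> u t = cm (P t) *v y' \<and>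
            (u has_vector_derivative u') (at t) \<and> - u' + cm (Q t) *v y t = of_real \<rho> *s (cm (W t) *v y t)"
    and bc: "A *v bvec (- y a) (y b) + B *v bvec (u a) (u b) = 0"
    using assms class_boundary_iff[OF c] unfolding is_solution_def by auto
  have cy: "continuous_on {a..b} y" and cu: "continuous_on {a..b} u" using ac abs_cont_continuous by auto
  have ey: "ess_bounded a b y" by (rule ess_bounded_continuous[OF cy])
  have de': "AE t in M. (y has_vector_derivative vd y t) (at t) \<and> u t = cm (P t) *v vd y t \<and>
     (u has_vector_derivative (cm (Q t) *v y t - \<rho> *\<^sub>R (cm (W t) *v y t))) (at t)"
    using de
  proof eventually_elim
    case (elim t)
    then obtain y' u' where h: "(y has_vector_derivative y') (at t)" "u t = cm (P t) *v y'"
            "(u has_vector_derivative u') (at t)" "- u' + cm (Q t) *v y t = of_real \<rho> *s (cm (W t) *v y t)" by blast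
    have "vd y t = y'" using vector_derivative_at[OF h(1)] .
    moreover have "u' = cm (Q t) *v y t - \<rho> *\<^sub>R (cm (W t) *v y t)"
      using h(4) by (simp add: of_real_vector_scalar algebra_simps)
    ultimately show ?case using h by simp
  qed
  obtain K where K: "AE t in M. norm (S t (u t)) \<le> K"
    using ess_S[OF ess_bounded_continuous[OF cu]] unfolding ess_bounded_def by blast
  have dy: "AE t in M. (y has_vector_derivative vd y t) (at t)" using de' by eventually_elim simp
  have "AE t in M. norm (vd y t) \<le> K"
    using de' K AE_S by eventually_elim metis
  then have ly: "lip_ae a b y" by (rule lip_aeI(1)[OF ac(1) dy])
  obtain K2 where K2: "AE t in M. norm (cm (Q t) *v y t - \<rho> *\<^sub>R (cm (W t) *v y t)) \<le> K2"
    using ess_potential[OF ey] unfolding ess_bounded_def by blast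
  have du: "AE t in M. (u has_vector_derivative (cm (Q t) *v y t - \<rho> *\<^sub>R (cm (W t) *v y t))) (at t)"
    using de' by eventually_elim simp
  note lu = lip_aeI[OF ac(2) du K2]
  have xe: "\<And>t. t \<in> {a..b} \<Longrightarrow> y t = ext y t" by (simp add: ext_eq)
  have le: "lip_ae a b (ext y)" "AE t in M. vd (ext y) t = vd y t"
    by (rule lip_ae_cong[OF _ ly], rule xe, assumption)+
  have bV: "bd a b (ext y) \<in> Vbc B" "\<forall>Z\<in>Vbc B. bvec (u a) (u b) \<bullet> Z + \<beta>bc A B (bd a b (ext y)) Z = 0"
    using bc adm_boundary_iff[OF adm] unfolding bd_ext by blast+
  have out: "ext y t = 0" if "t \<notin> {a..b}" for t using that unfolding ext_def by (rule if_not_P)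
  have inab: "AE t in M. t \<in> {a..b}" by (intro AE_I2) simp
  have "AE t in M. cm (P t) *v vd (ext y) t = u t" using de' le(2) by eventually_elim simp
  moreover have "AE t in M. vd u t = cm (Q t) *v ext y t - \<rho> *\<^sub>R (cm (W t) *v ext y t)"
    using lu(2) inab by eventually_elim (simp add: ext_eq)
  ultimately show ?thesis unfolding eig_def D_def using le(1) lu(1) bV out by blast
qed

lemma eig_imp_solution:
  assumes "eig \<rho> (ext y)" shows "is_solution a b (P, Q, W) c \<rho> y"
proof -
  obtain u where yD: "ext y \<in> D" and u: "lip_ae a b u" "AE t in M. cm (P t) *v vd (ext y) t = u t"
    "AE t in M. vd u t = cm (Q t) *v ext y t - \<rho> *\<^sub>R (cm (W t) *v ext y t)"
    "\<forall>Z\<in>Vbc B. bvec (u a) (u b) \<bullet> Z + \<beta>bc A B (bd a b (ext y)) Z = 0"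
    using assms unfolding eig_def by blast
  have xe: "\<And>t. t \<in> {a..b} \<Longrightarrow> ext y t = y t" by (simp add: ext_eq)
  have ly: "lip_ae a b y" "AE t in M. vd y t = vd (ext y) t"
    by (rule lip_ae_cong[OF _ DD(1)[OF yD]], rule xe, assumption)+
  have inab: "AE t in M. t \<in> {a..b}" by (intro AE_I2) simp
  have "AE t in M. \<exists>y' u'. (y has_vector_derivative y') (at t) \<and> u t = cm (P t) *v y' \<and>
            (u has_vector_derivative u') (at t) \<and> - u' + cm (Q t) *v y t = of_real \<rho> *s (cm (W t) *v y t)"
    using lip_ae_vd[OF ly(1)] lip_ae_vd[OF u(1)] ly(2) u(2,3) inab
  proof eventually_elim
    case (elim t)
    show ?case
    proof (intro exI conjI)
      show "(y has_vector_derivative vd y t) (at t)" "(u has_vector_derivative vd u t) (at t)" by fact+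
      show "u t = cm (P t) *v vd y t" using elim by simp
      show "- vd u t + cm (Q t) *v y t = of_real \<rho> *s (cm (W t) *v y t)"
        using elim by (simp add: ext_eq of_real_vector_scalar)
    qed
  qed
  moreover have "A *v bvec (- y a) (y b) + B *v bvec (u a) (u b) = 0"
    using adm_boundary_iff[OF adm] DD(2)[OF yD] u(4) unfolding bd_ext by blast
  ultimately show ?thesis
    unfolding is_solution_def using ly(1) u(1) c(2) unfolding lip_ae_def by auto
qed

lemma solution_iff_eig: "is_solution a b (P, Q, W) c \<rho> y \<longleftrightarrow> ext y \<in> FP.eigsp \<rho>"
  using solution_imp_eig eig_imp_solution radical_iff_eig[of "ext y" \<rho>] by (auto simp: FP.eigsp_def)

lemma sum_fun_apply: "(\<Sum>y\<in>F. fsc (cf y) (g y)) t = (\<Sum>y\<in>F. cf y *s g y t)"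
  by (induction F rule: infinite_finite_induct) (auto simp: fsc_def)

text \<open>Solutions are functions on the whole line, while their independence refers to
  \<open>[a, b]\<close> only. On a set independent in this sense \<open>ext\<close> is injective,
  and its image is independent among functions vanishing outside, so both dimensions agree.\<close>

lemma multiplicity_eq_dim: "multiplicity_ev a b (P, Q, W) c \<rho> = fs.dim (FP.eigsp \<rho>)"
proof -
  obtain E where E: "E \<subseteq> FP.eigsp \<rho>" "finite E" "fs.independent E" "fs.span E = FP.eigsp \<rho>"
    "card E = fs.dim (FP.eigsp \<rho>)" by (rule FP.eigsp_basis)
  have ED: "ext y = y" if "y \<in> E" for y using that E(1) FP.eigsp_subset ext_self by blast
  have sol: "is_solution a b (P, Q, W) c \<rho> y" if "y \<in> E" for y
    using that E(1) ED[OF that] unfolding solution_iff_eig by auto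
  have ind: "lin_indep_on a b E"
    unfolding lin_indep_on_def
  proof (intro allI impI ballI)
    fix cf y assume h: "\<forall>t\<in>{a..b}. (\<Sum>y\<in>E. cf y *s y t) = 0" "y \<in> E"
    have "(\<Sum>y\<in>E. fsc (cf y) y) t = 0" for t
    proof (cases "t \<in> {a..b}")
      case False
      then have "y t = 0" if "y \<in> E" for y using that E(1) FP.eigsp_subset DD(3) by blast
      then show ?thesis unfolding sum_fun_apply by (intro sum.neutral) auto
    qed (use h in \<open>simp add: sum_fun_apply\<close>)
    then have "(\<Sum>y\<in>E. fsc (cf y) y) = 0" by (simp add: fun_eq_iff)
    then show "cf y = 0" using fs.independentD[OF E(3,2) subset_refl _ h(2)] by blast
  qed
  have le: "card S \<le> card E" if S: "finite S" "lin_indep_on a b S" "\<forall>y\<in>S. is_solution a b (P, Q, W) c \<rho> y" for S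
  proof -
    have inj: "inj_on ext S"
    proof (rule inj_onI, rule ccontr)
      fix y z assume yz: "y \<in> S" "z \<in> S" "ext y = ext z" "y \<noteq> z"
      \<comment> \<open>Two members with the same restriction to \<open>[a, b]\<close> would satisfy
        the relation with coefficients \<open>1\<close> and \<open>-1\<close>.\<close>
      define cf :: "(real \<Rightarrow> complex^'d) \<Rightarrow> complex" where "cf = (\<lambda>x. if x = y then 1 else if x = z then -1 else 0)"
      have "(\<Sum>x\<in>S. cf x *s x t) = 0" if t: "t \<in> {a..b}" for t
      proof -
        have "(\<Sum>x\<in>S. cf x *s x t) = (\<Sum>x\<in>{y, z}. cf x *s x t)"
          using yz S(1) by (intro sum.mono_neutral_right) (auto simp: cf_def)
        also have "\<dots> = y t - z t" using yz(4) by (simp add: cf_def)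
        also have "\<dots> = 0" using yz(3) t ext_eq[OF t, of y] ext_eq[OF t, of z] by simp
        finally show ?thesis .
      qed
      then have "cf y = 0" using S(2) yz(1) unfolding lin_indep_on_def by blast
      then show False by (simp add: cf_def)
    qed
    have "fs.independent (ext ` S)"
    proof (rule ccontr)
      assume "\<not> fs.independent (ext ` S)"
      then obtain u v where uv: "v \<in> ext ` S" "u v \<noteq> 0" "(\<Sum>v\<in>ext ` S. fsc (u v) v) = 0"
        using S(1) by (auto simp: fs.dependent_finite)
      then obtain y where y: "y \<in> S" "v = ext y" by auto
      have s: "(\<Sum>y\<in>S. fsc (u (ext y)) (ext y)) = 0" using uv(3) by (simp add: sum.reindex[OF inj])
      have "(\<Sum>y\<in>S. u (ext y) *s y t) = 0" if t: "t \<in> {a..b}" for t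
      proof -
        have "(\<Sum>y\<in>S. u (ext y) *s y t) = (\<Sum>y\<in>S. fsc (u (ext y)) (ext y)) t"
          unfolding sum_fun_apply using ext_eq[OF t] by simp
        then show ?thesis using s by simp
      qed
      then have "u (ext y) = 0" using S(2) y(1) unfolding lin_indep_on_def by (auto dest: spec[of _ "\<lambda>y. u (ext y)"])
      then show False using uv y by simp
    qed
    moreover have "ext ` S \<subseteq> fs.span E" using S(3) unfolding E(4) solution_iff_eig by blast
    ultimately have "card (ext ` S) \<le> card E" using fs.independent_span_bound[OF E(2)] by blast
    then show ?thesis by (simp add: card_image[OF inj])
  qed
  have "multiplicity_ev a b (P, Q, W) c \<rho> = card E"
    unfolding multiplicity_ev_def
    by (rule cSup_eq_maximum) (use E(2) ind sol le in blast)+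
  then show ?thesis using E(5) by simp
qed

theorem count_iff: "n \<le> count_ev a b (P, Q, W) c lam \<longleftrightarrow> (\<exists>B. FP.below lam B \<and> card B = n)"
  unfolding count_ev_def multiplicity_eq_dim by (rule FP.count_eq_below)

end

section \<open>Transferring test spaces between nearby problems\<close>

text \<open>Linearity and injectivity are asked on \<open>span B\<close> only, because the map to be
  used depends on boundary vectors in a subspace and is linear just for admissible
  functions.\<close>

lemma (in vector_space) independent_image_on_span:
  fixes T :: "'b \<Rightarrow> 'b"
  assumes B: "finite B" "independent B"
    and add: "\<And>x y. x \<in> span B \<Longrightarrow> y \<in> span B \<Longrightarrow> T (x + y) = T x + T y"
    and sc: "\<And>c x. x \<in> span B \<Longrightarrow> T (scale c x) = scale c (T x)"
    and inj: "\<And>x. x \<in> span B \<Longrightarrow> T x = 0 \<Longrightarrow> x = 0"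
  shows "independent (T ` B)" "card (T ` B) = card B" "span (T ` B) \<subseteq> T ` span B"
proof -
  have T0: "T 0 = 0" using sc[OF span_zero, of 0] by simp
  have sum: "T (\<Sum>b\<in>F. scale (u b) b) = (\<Sum>b\<in>F. scale (u b) (T b))" if "finite F" "F \<subseteq> B" for u F
    using that
  proof (induction F rule: finite_induct)
    case (insert x F)
    then have x: "scale (u x) x \<in> span B" "x \<in> span B" by (auto intro: span_base span_scale)
    have "(\<Sum>b\<in>F. scale (u b) b) \<in> span B" using insert.prems by (intro span_sum span_scale span_base) auto
    then show ?case using insert x by (simp add: add sc)
  qed (simp add: T0)
  have injB: "inj_on T B"
  proof (rule inj_onI)
    fix x y assume h: "x \<in> B" "y \<in> B" "T x = T y"
    have s: "x \<in> span B" "y \<in> span B" "scale (-1) y \<in> span B" using h by (auto intro: span_base span_neg)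
    have "T (x + scale (-1) y) = T x + scale (-1) (T y)" by (simp only: add[OF s(1,3)] sc[OF s(2)])
    then have "T (x + scale (-1) y) = 0" using h(3) by simp
    then have "x + scale (-1) y = 0" using inj[OF span_add[OF s(1,3)]] by blast
    then show "x = y" by simp
  qed
  then show "card (T ` B) = card B" by (rule card_image)
  show "independent (T ` B)"
  proof (rule ccontr)
    assume "\<not> independent (T ` B)"
    then obtain u v where uv: "v \<in> T ` B" "u v \<noteq> 0" "(\<Sum>v\<in>T ` B. scale (u v) v) = 0"
      using B(1) by (auto simp: dependent_finite)
    then obtain y where y: "y \<in> B" "v = T y" by auto
    have T1: "T (\<Sum>b\<in>B. scale (u (T b)) b) = 0"
      using uv(3) by (simp add: sum[OF B(1)] sum.reindex[OF injB])
    have "(\<Sum>b\<in>B. scale (u (T b)) b) \<in> span B" by (intro span_sum span_scale span_base)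
    from inj[OF this T1] have "(\<Sum>b\<in>B. scale (u (T b)) b) = 0" .
    then have "u (T y) = 0" using independentD[OF B(2,1) subset_refl _ y(1), of "\<lambda>b. u (T b)"] by blast
    then show False using uv y by simp
  qed
  show "span (T ` B) \<subseteq> T ` span B"
  proof
    fix x assume "x \<in> span (T ` B)"
    then show "x \<in> T ` span B"
    proof (induction rule: span_induct_alt)
      case base then show ?case using T0 span_zero by (metis imageI)
    next
      case (step c x y)
      then obtain x' y' where h: "x' \<in> B" "x = T x'" "y' \<in> span B" "y = T y'" by auto
      have s: "x' \<in> span B" "scale c x' \<in> span B" using h by (auto intro: span_base span_scale)
      have "scale c x + y = T (scale c x' + y')" using h by (simp only: add[OF s(2) h(3)] sc[OF s(1)])
      then show ?case using span_add[OF s(2) h(3)] by blast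
    qed
  qed
qed

text \<open>The affine function whose boundary vector \<open>bd\<close> is \<open>\<delta>\<close>.\<close>
definition corr :: "real \<Rightarrow> real \<Rightarrow> complex^('d + 'd) \<Rightarrow> real \<Rightarrow> complex^'d::finite" where
  "corr a b \<delta> = (\<lambda>t. if t \<in> {a..b} then
     (\<chi> i. ((t - a) / (b - a)) *\<^sub>R (\<delta> $ Inr i) - ((b - t) / (b - a)) *\<^sub>R (\<delta> $ Inl i)) else 0)"

text \<open>The constant derivative of \<open>corr a b \<delta>\<close>. Both parts are added
  because \<open>Inl\<close> carries the value at \<open>a\<close> with a minus sign.\<close>

definition corr' :: "real \<Rightarrow> real \<Rightarrow> complex^('d + 'd) \<Rightarrow> complex^'d::finite" where
  "corr' a b \<delta> = (1 / (b - a)) *\<^sub>R (\<chi> i. \<delta> $ Inr i + \<delta> $ Inl i)"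

lemma corr_out: "t \<notin> {a..b} \<Longrightarrow> corr a b \<delta> t = 0"
  unfolding corr_def by (rule if_not_P)

lemma corr_add: "corr a b (\<delta> + \<delta>') = corr a b \<delta> + corr a b \<delta>'"
  by (auto simp: corr_def fun_eq_iff vec_eq_iff algebra_simps)

lemma corr_scale: "corr a b (c *s \<delta>) = fsc c (corr a b \<delta>)"
  by (auto simp: corr_def fsc_def fun_eq_iff vec_eq_iff scaleR_conv_of_real[where 'a=complex] algebra_simps)

lemma corr_lip:
  assumes ab: "a < b"
  shows "lip_ae a b (corr a b \<delta>)" "AE t in lebesgue_on {a..b}. vd (corr a b \<delta>) t = corr' a b \<delta>"
proof -
  define p q where "p = (\<chi> i. \<delta> $ Inr i)" and "q = (\<chi> i. \<delta> $ Inl i)"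
  define f where "f = (\<lambda>t. ((t - a) / (b - a)) *\<^sub>R p - ((b - t) / (b - a)) *\<^sub>R q)"
  have "(f has_vector_derivative (1 / (b - a)) *\<^sub>R p - (- 1 / (b - a)) *\<^sub>R q) (at t)" for t
  proof -
    have 1: "((\<lambda>t. (t - a) / (b - a)) has_real_derivative 1 / (b - a)) (at t)"
      "((\<lambda>t. (b - t) / (b - a)) has_real_derivative - 1 / (b - a)) (at t)"
    proof -
      have d: "((\<lambda>t. t - a) has_real_derivative 1) (at t)" "((\<lambda>t. b - t) has_real_derivative - 1) (at t)"
        by (auto intro!: derivative_eq_intros)
      show "((\<lambda>t. (t - a) / (b - a)) has_real_derivative 1 / (b - a)) (at t)" by (rule DERIV_cdivide[OF d(1)])
      show "((\<lambda>t. (b - t) / (b - a)) has_real_derivative - 1 / (b - a)) (at t)" by (rule DERIV_cdivide[OF d(2)])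
    qed
    show ?thesis
      unfolding f_def
      using has_vector_derivative_diff[OF has_vector_derivative_scaleR[OF 1(1) has_vector_derivative_const[of p]]
        has_vector_derivative_scaleR[OF 1(2) has_vector_derivative_const[of q]]] by simp
  qed
  moreover have "(1 / (b - a)) *\<^sub>R p - (- 1 / (b - a)) *\<^sub>R q = corr' a b \<delta>"
    by (simp add: corr'_def p_def q_def vec_eq_iff scaleR_add_right)
  ultimately have d: "(f has_vector_derivative corr' a b \<delta>) (at t)" for t by simp
  have e: "f t = corr a b \<delta> t" if "t \<in> {a..b}" for t
    using that by (simp add: f_def corr_def p_def q_def vec_eq_iff)
  note s = lip_ae_smooth[OF d continuous_on_const]
  have "lip_ae a b (corr a b \<delta>)" "AE t in lebesgue_on {a..b}. vd (corr a b \<delta>) t = vd f t"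
    by (rule lip_ae_cong[OF _ s(1)], rule e, assumption)+
  then show "lip_ae a b (corr a b \<delta>)" by simp
  show "AE t in lebesgue_on {a..b}. vd (corr a b \<delta>) t = corr' a b \<delta>"
    using \<open>AE t in lebesgue_on {a..b}. vd (corr a b \<delta>) t = vd f t\<close> s(2) by eventually_elim simp
qed

lemma bd_corr:
  assumes "a < b" shows "bd a b (corr a b \<delta>) = \<delta>"
proof -
  have "bd a b (corr a b \<delta>) $ i = \<delta> $ i" for i
    using assms by (cases i) (simp_all add: bd_def bvec_def corr_def)
  then show ?thesis by (simp add: vec_eq_iff)
qed

text \<open>The weights cover two uses: those of an affine function at a point of
  \<open>[a, b]\<close>, and \<open>r = 1\<close>, \<open>s = -1\<close> for its derivative.\<close>

lemma parts_bound:
  fixes \<delta> :: "complex^('d::finite + 'd)"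
  assumes "\<bar>r\<bar> \<le> 1" "\<bar>s\<bar> \<le> 1"
  shows "norm (\<chi> i. r *\<^sub>R (\<delta> $ Inr i) - s *\<^sub>R (\<delta> $ Inl i)) \<le> 2 * norm \<delta>"
proof -
  define p q where "p = (\<chi> i. \<delta> $ Inr i)" and "q = (\<chi> i. \<delta> $ Inl i)"
  have "\<delta> = bvec q p" by (auto simp: bvec_def vec_eq_iff p_def q_def split: sum.split)
  then have "(norm \<delta>)\<^sup>2 = (norm q)\<^sup>2 + (norm p)\<^sup>2" by (simp add: power2_norm_eq_inner bvec_inner)
  then have "(norm p)\<^sup>2 \<le> (norm \<delta>)\<^sup>2" "(norm q)\<^sup>2 \<le> (norm \<delta>)\<^sup>2" by simp_all
  then have "norm p \<le> norm \<delta>" "norm q \<le> norm \<delta>" by (simp_all only: power2_le_imp_le norm_ge_zero)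
  moreover have "(\<chi> i. r *\<^sub>R (\<delta> $ Inr i) - s *\<^sub>R (\<delta> $ Inl i)) = r *\<^sub>R p - s *\<^sub>R q"
    by (simp add: vec_eq_iff p_def q_def)
  moreover have "norm (r *\<^sub>R p - s *\<^sub>R q) \<le> \<bar>r\<bar> * norm p + \<bar>s\<bar> * norm q"
    using norm_triangle_ineq4[of "r *\<^sub>R p" "s *\<^sub>R q"] by simp
  moreover have "\<bar>r\<bar> * norm p \<le> norm p" "\<bar>s\<bar> * norm q \<le> norm q"
    using assms by (auto intro!: mult_left_le_one_le)
  ultimately show ?thesis by simp
qed

lemma corr_bound:
  assumes "a < b" shows "norm (corr a b \<delta> t) \<le> 2 * norm \<delta>"
proof (cases "t \<in> {a..b}")
  case True
  then show ?thesis
    using assms parts_bound[of "(t - a) / (b - a)" "(b - t) / (b - a)" \<delta>] by (simp add: corr_def)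
qed (use assms in \<open>simp add: corr_out\<close>)

lemma corr'_bound:
  assumes "a < b" shows "norm (corr' a b \<delta>) \<le> 2 * norm \<delta> / (b - a)"
  using assms parts_bound[of 1 "-1" \<delta>] by (simp add: corr'_def divide_right_mono)

text \<open>The mixed terms are split by \<open>2 x y \<le> \<eta> x^2 + y^2 / \<eta>\<close>. The
  factor \<open>1 / \<eta>\<close> is harmless in the application, where
  \<open>e \<bullet> e\<close> is of order \<open>\<eta>^2\<close>.\<close>

lemma perturbed_form_bound:
  fixes N N' :: "complex^'d::finite \<Rightarrow> complex^'d"
  assumes add: "\<And>x y. N (x + y) = N x + N y"
    and N: "\<And>x. norm (N x) \<le> C * norm x" and d: "\<And>x. norm (N x - N' x) \<le> \<eta> * norm x"
    and \<eta>: "0 < \<eta>" "\<eta> \<le> 1" and C: "C > 0"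
  shows "\<bar>N (u + e) \<bullet> (u + e) - N' u \<bullet> u\<bar> \<le> \<eta> * (1 + C) * (u \<bullet> u) + 2 * C / \<eta> * (e \<bullet> e)"
proof -
  have "N (u + e) \<bullet> (u + e) - N' u \<bullet> u = (N u - N' u) \<bullet> u + N u \<bullet> e + N e \<bullet> u + N e \<bullet> e"
    by (simp add: add inner_add_left inner_add_right inner_diff_left)
  moreover have "\<bar>(N u - N' u) \<bullet> u\<bar> \<le> \<eta> * (u \<bullet> u)"
    using Cauchy_Schwarz_ineq2[of "N u - N' u" u] mult_right_mono[OF d[of u], of "norm u"]
    by (simp add: power2_norm_eq_inner[symmetric] power2_eq_square)
  moreover have "\<bar>N x \<bullet> y\<bar> \<le> C * (norm x * norm y)" for x y
    using Cauchy_Schwarz_ineq2[of "N x" y] mult_right_mono[OF N[of x], of "norm y"] by simp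
  then have "\<bar>N u \<bullet> e\<bar> \<le> C * (norm u * norm e)" "\<bar>N e \<bullet> u\<bar> \<le> C * (norm u * norm e)" "\<bar>N e \<bullet> e\<bar> \<le> C * (e \<bullet> e)"
    by (metis mult.commute, metis mult.commute, metis power2_norm_eq_inner power2_eq_square)
  moreover have "2 * (C * (norm u * norm e)) \<le> \<eta> * C * (u \<bullet> u) + C / \<eta> * (e \<bullet> e)"
  proof -
    have "0 \<le> (\<eta> * norm u - norm e)\<^sup>2" by simp
    then have "2 * \<eta> * (norm u * norm e) \<le> \<eta>\<^sup>2 * (norm u)\<^sup>2 + (norm e)\<^sup>2"
      by (simp add: power2_eq_square algebra_simps)
    then have "C / \<eta> * (2 * \<eta> * (norm u * norm e)) \<le> C / \<eta> * (\<eta>\<^sup>2 * (norm u)\<^sup>2 + (norm e)\<^sup>2)"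
      using C \<eta> by (intro mult_left_mono) auto
    then have "C / \<eta> * (2 * \<eta> * (norm u * norm e)) \<le> C / \<eta> * (\<eta>\<^sup>2 * (u \<bullet> u) + e \<bullet> e)"
      unfolding power2_norm_eq_inner .
    moreover have "C / \<eta> * (2 * \<eta> * (norm u * norm e)) = 2 * (C * (norm u * norm e))" using \<eta> by simp
    moreover have "C / \<eta> * (\<eta>\<^sup>2 * (u \<bullet> u) + e \<bullet> e) = \<eta> * C * (u \<bullet> u) + C / \<eta> * (e \<bullet> e)"
      using \<eta> by (simp add: power2_eq_square distrib_left)
    ultimately show ?thesis by simp
  qed
  moreover have "C * (e \<bullet> e) \<le> C / \<eta> * (e \<bullet> e)"
    using C \<eta> by (intro mult_right_mono) (auto simp: field_simps)
  moreover have "\<eta> * (1 + C) * (u \<bullet> u) = \<eta> * (u \<bullet> u) + \<eta> * C * (u \<bullet> u)" by (simp add: algebra_simps)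
  moreover have "2 * C / \<eta> * (e \<bullet> e) = C / \<eta> * (e \<bullet> e) + C / \<eta> * (e \<bullet> e)" by simp
  ultimately show ?thesis by linarith
qed

text \<open>\<open>K1\<close> is \<open>sobolev\<close> with parameter \<open>1\<close> at both
  endpoints; \<open>K2\<close> is the resulting constant for the affine correction and its
  derivative. In \<open>K3\<close>, \<open>1 + C\<close> and \<open>4 * C * K2 a b * (b - a)\<close>
  stem from \<open>perturbed_form_bound\<close>, and \<open>K1\<close> from the closeness of the
  boundary forms.\<close>

definition K1 :: "real \<Rightarrow> real \<Rightarrow> real" where "K1 a b = 2 * (2 + 1 / (b - a))"
definition K2 :: "real \<Rightarrow> real \<Rightarrow> real" where "K2 a b = 4 * K1 a b * (1 + 1 / (b - a)\<^sup>2)"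
definition K3 :: "real \<Rightarrow> real \<Rightarrow> real \<Rightarrow> real" where
  "K3 a b C = 1 + C + 4 * C * K2 a b * (b - a) + K1 a b"

text \<open>One direction of the comparison: \<open>\<tau>\<close> carries boundary vectors of the
  primed problem to those of the unprimed one, and test spaces will follow. The converse comparison
  is an instance with the two problems exchanged.\<close>

locale sl_pair = X: sl_form a b P Q W V \<beta> \<mu> C + Y: sl_form a b P' Q' W' V' \<beta>' \<mu> C
  for a b :: real and P Q W :: "real \<Rightarrow> real^'d::finite^'d" and V \<beta>
    and P' Q' W' :: "real \<Rightarrow> real^'d^'d" and V' \<beta>' and \<mu> C :: real +
  fixes \<eta> :: real and \<tau> :: "complex^('d + 'd) \<Rightarrow> complex^('d + 'd)"
  assumes \<eta>: "0 < \<eta>" "\<eta> \<le> 1"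
    and close: "AE t in lebesgue_on {a..b}. \<forall>x::complex^'d. norm (cm (P t) *v x - cm (P' t) *v x) \<le> \<eta> * norm x \<and>
      norm (cm (Q t) *v x - cm (Q' t) *v x) \<le> \<eta> * norm x \<and> norm (cm (W t) *v x - cm (W' t) *v x) \<le> \<eta> * norm x"
    and \<tau>V: "Z \<in> V' \<Longrightarrow> \<tau> Z \<in> V"
    and \<tau>_add: "Y \<in> V' \<Longrightarrow> Z \<in> V' \<Longrightarrow> \<tau> (Y + Z) = \<tau> Y + \<tau> Z"
    and \<tau>_scale: "Z \<in> V' \<Longrightarrow> \<tau> (c *s Z) = c *s \<tau> Z"
    and \<tau>_close: "Z \<in> V' \<Longrightarrow> norm (\<tau> Z - Z) \<le> \<eta> * norm Z"
    and \<beta>_close: "Z \<in> V' \<Longrightarrow> \<bar>\<beta> (\<tau> Z) (\<tau> Z) - \<beta>' Z Z\<bar> \<le> \<eta> * (norm Z)\<^sup>2"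
begin

definition dl :: "(real \<Rightarrow> complex^'d) \<Rightarrow> complex^('d + 'd)" where
  "dl y = \<tau> (bd a b y) - bd a b y"

definition T :: "(real \<Rightarrow> complex^'d) \<Rightarrow> real \<Rightarrow> complex^'d" where
  "T y = y + corr a b (dl y)"

text \<open>The squared Sobolev norm. It contains no coefficients and so measures error terms for
  both problems.\<close>

definition H :: "(real \<Rightarrow> complex^'d) \<Rightarrow> real" where "H y = X.deriv_sq y + X.fun_sq y"

lemma bd_T: "bd a b (T y) = \<tau> (bd a b y)"
  by (simp add: T_def bd_add bd_corr[OF X.ab] dl_def)

lemma T_D:
  assumes y: "y \<in> Y.D" shows "T y \<in> X.D"
proof -
  have "T y t = 0" if "t \<notin> {a..b}" for t
    using Y.DD(3)[OF y that] corr_out[OF that, of "dl y"] by (simp add: T_def)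
  moreover have "lip_ae a b (T y)"
    unfolding T_def by (rule X.lip_plus(1)[OF Y.DD(1)[OF y] corr_lip(1)[OF X.ab]])
  ultimately show ?thesis using \<tau>V[OF Y.DD(2)[OF y]] unfolding X.D_def bd_T[symmetric] by blast
qed

lemma T_add: "x \<in> Y.D \<Longrightarrow> y \<in> Y.D \<Longrightarrow> T (x + y) = T x + T y"
proof -
  assume "x \<in> Y.D" "y \<in> Y.D"
  then have "dl (x + y) = dl x + dl y" using Y.DD(2) by (simp add: dl_def bd_add \<tau>_add)
  then show ?thesis by (simp add: T_def corr_add)
qed

lemma T_scale: "x \<in> Y.D \<Longrightarrow> T (fsc c x) = fsc c (T x)"
proof -
  assume "x \<in> Y.D"
  then have "dl (fsc c x) = c *s dl x" using Y.DD(2) by (simp add: dl_def bd_scale \<tau>_scale vec.scale_right_diff_distrib)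
  then show ?thesis by (simp add: T_def corr_scale fs.scale_right_distrib)
qed

lemma H_nonneg: "H y \<ge> 0" using X.deriv_sq_nonneg[of y] X.fun_sq_nonneg[of y] by (simp add: H_def)

lemma K_pos: "K1 a b > 0" "K2 a b > 0" "K3 a b C > 0"
proof -
  show 1: "K1 a b > 0" using X.ab by (simp add: K1_def add_pos_pos)
  then show 2: "K2 a b > 0" using X.ab by (simp add: K2_def add_pos_pos)
  then show "K3 a b C > 0" using 1 X.ab X.C by (simp add: K3_def add_pos_pos)
qed

lemma bd_bound:
  assumes y: "lip_ae a b y" shows "(norm (bd a b y))\<^sup>2 \<le> K1 a b * H y"
proof -
  have t: "(norm (y t))\<^sup>2 \<le> (2 + 1 / (b - a)) * H y" if "t \<in> {a..b}" for t
  proof -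
    have "(norm (y t))\<^sup>2 \<le> 1 * X.deriv_sq y + (1 / 1 + 1 / (b - a)) * X.fun_sq y"
      by (rule X.sobolev[OF y zero_less_one that])
    also have "\<dots> \<le> (2 + 1 / (b - a)) * X.deriv_sq y + (2 + 1 / (b - a)) * X.fun_sq y"
      using X.ab X.deriv_sq_nonneg X.fun_sq_nonneg by (intro add_mono mult_right_mono) auto
    finally show ?thesis by (simp add: H_def distrib_left)
  qed
  have "K1 a b * H y = 2 * ((2 + 1 / (b - a)) * H y)" by (simp add: K1_def)
  moreover have "a \<in> {a..b}" "b \<in> {a..b}" using X.ab by auto
  note t[OF this(1)] t[OF this(2)]
  ultimately show ?thesis unfolding norm_bd by linarith
qed

lemma dl_bound:
  assumes "y \<in> Y.D" shows "(norm (dl y))\<^sup>2 \<le> \<eta>\<^sup>2 * (K1 a b * H y)"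
proof -
  have "(norm (dl y))\<^sup>2 \<le> (\<eta> * norm (bd a b y))\<^sup>2"
    using \<tau>_close[OF Y.DD(2)[OF assms]] unfolding dl_def by (intro power_mono) auto
  also have "\<dots> = \<eta>\<^sup>2 * (norm (bd a b y))\<^sup>2" by (simp add: power_mult_distrib)
  also have "\<dots> \<le> \<eta>\<^sup>2 * (K1 a b * H y)" using bd_bound[OF Y.DD(1)[OF assms]] by (intro mult_left_mono) auto
  finally show ?thesis .
qed

lemma corr_square:
  assumes "y \<in> Y.D"
  shows "corr a b (dl y) t \<bullet> corr a b (dl y) t \<le> \<eta>\<^sup>2 * (K2 a b * H y)"
    "corr' a b (dl y) \<bullet> corr' a b (dl y) \<le> \<eta>\<^sup>2 * (K2 a b * H y)"
proof -
  define N where "N = \<eta>\<^sup>2 * (K1 a b * H y)"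
  have N: "(norm (dl y))\<^sup>2 \<le> N" unfolding N_def by (rule dl_bound[OF assms])
  have N0: "N \<ge> 0" using N zero_le_power2[of "norm (dl y)"] by linarith
  have K: "\<eta>\<^sup>2 * (K2 a b * H y) = 4 * N + 4 * N / (b - a)\<^sup>2" by (simp add: N_def K2_def algebra_simps)
  have p: "4 * N / (b - a)\<^sup>2 \<ge> 0" using N0 by simp
  have "corr a b (dl y) t \<bullet> corr a b (dl y) t \<le> (2 * norm (dl y))\<^sup>2"
    unfolding power2_norm_eq_inner[symmetric] using corr_bound[OF X.ab] by (intro power_mono) auto
  also have "\<dots> \<le> 4 * N" using N by (simp add: power_mult_distrib)
  finally show "corr a b (dl y) t \<bullet> corr a b (dl y) t \<le> \<eta>\<^sup>2 * (K2 a b * H y)" using p unfolding K by linarith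
  have "corr' a b (dl y) \<bullet> corr' a b (dl y) \<le> (2 * norm (dl y) / (b - a))\<^sup>2"
    unfolding power2_norm_eq_inner[symmetric] using corr'_bound[OF X.ab] by (intro power_mono) auto
  also have "\<dots> = 4 * (norm (dl y))\<^sup>2 / (b - a)\<^sup>2" by (simp add: power_mult_distrib power_divide)
  also have "\<dots> \<le> 4 * N / (b - a)\<^sup>2" using N by (intro divide_right_mono) auto
  finally show "corr' a b (dl y) \<bullet> corr' a b (dl y) \<le> \<eta>\<^sup>2 * (K2 a b * H y)" using N0 unfolding K by linarith
qed

text \<open>The mismatch of the coefficients costs \<open>\<eta>\<close>, and so does the affine correction: its square is
  of order \<open>\<eta>\<^sup>2\<close>, and the cross terms are absorbed with weight \<open>\<eta>\<close>.\<close>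
lemma form_difference:
  assumes y: "y \<in> Y.D"
  shows "\<bar>X.q (T y) (T y) - Y.q y y\<bar> \<le> \<eta> * K3 a b C * H y" "\<bar>X.w (T y) (T y) - Y.w y y\<bar> \<le> \<eta> * K3 a b C * H y"
proof -
  let ?M = "lebesgue_on {a..b}"
  define h where "h = corr a b (dl y)"
  \<comment> \<open>Common bound for the two correction terms
    \<open>2 * C / \<eta> * (e \<bullet> e)\<close> of \<open>perturbed_form_bound\<close>: by
    \<open>corr_square\<close>, \<open>e \<bullet> e\<close> is at most
    \<open>\<eta>^2 * (K2 a b * H y)\<close>.\<close>
  define E where "E = 2 * C * \<eta> * (K2 a b * H y)"
  have E0: "E \<ge> 0" using X.C \<eta> K_pos H_nonneg by (simp add: E_def)
  have Eb: "2 * C / \<eta> * s \<le> E" if "s \<le> \<eta>\<^sup>2 * (K2 a b * H y)" for s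
  proof -
    have "2 * C / \<eta> * s \<le> 2 * C / \<eta> * (\<eta>\<^sup>2 * (K2 a b * H y))" using that X.C \<eta> by (intro mult_left_mono) auto
    also have "\<dots> = E" using \<eta> by (simp add: E_def power2_eq_square)
    finally show ?thesis .
  qed
  have l: "lip_ae a b y" "lip_ae a b (T y)" using Y.DD(1)[OF y] X.DD(1)[OF T_D[OF y]] by auto
  have ey: "ess_bounded a b (\<lambda>t. y t \<bullet> y t)" "ess_bounded a b (\<lambda>t. vd y t \<bullet> vd y t)"
    by (intro ess_bounded_inner X.ess_vd lip_ae_ess_bounded l)+
  have vdT: "AE t in ?M. vd (T y) t = vd y t + corr' a b (dl y)"
    using X.lip_plus(2)[OF l(1) corr_lip(1)[OF X.ab, of "dl y"]] corr_lip(2)[OF X.ab, of "dl y"]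
    unfolding T_def by eventually_elim simp
  have Tt: "T y t = y t + h t" for t by (simp add: T_def h_def)
  have pq: "AE t in ?M. \<bar>X.iq (T y) (T y) t - Y.iq y y t\<bar> \<le>
      \<eta> * (1 + C) * (vd y t \<bullet> vd y t) + \<eta> * (1 + C) * (y t \<bullet> y t) + 2 * E"
    using vdT X.AE_bound close
  proof eventually_elim
    case (elim t)
    have 1: "\<bar>(cm (P t) *v (vd y t + corr' a b (dl y))) \<bullet> (vd y t + corr' a b (dl y)) - (cm (P' t) *v vd y t) \<bullet> vd y t\<bar>
        \<le> \<eta> * (1 + C) * (vd y t \<bullet> vd y t) + 2 * C / \<eta> * (corr' a b (dl y) \<bullet> corr' a b (dl y))"
      by (rule perturbed_form_bound[OF _ _ _ \<eta> X.C]) (use elim in \<open>auto simp: cm.add_right\<close>)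
    have 2: "\<bar>(cm (Q t) *v (y t + h t)) \<bullet> (y t + h t) - (cm (Q' t) *v y t) \<bullet> y t\<bar>
        \<le> \<eta> * (1 + C) * (y t \<bullet> y t) + 2 * C / \<eta> * (h t \<bullet> h t)"
      by (rule perturbed_form_bound[OF _ _ _ \<eta> X.C]) (use elim in \<open>auto simp: cm.add_right\<close>)
    show ?case
      using 1 2 Eb[OF corr_square(1)[OF y, of t]] Eb[OF corr_square(2)[OF y]]
      unfolding X.iq_def Y.iq_def elim(1) Tt h_def by linarith
  qed
  have pw: "AE t in ?M. \<bar>X.iw (T y) (T y) t - Y.iw y y t\<bar> \<le> 0 * (vd y t \<bullet> vd y t) + \<eta> * (1 + C) * (y t \<bullet> y t) + 2 * E"
    using X.AE_bound close
  proof eventually_elim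
    case (elim t)
    have 2: "\<bar>(cm (W t) *v (y t + h t)) \<bullet> (y t + h t) - (cm (W' t) *v y t) \<bullet> y t\<bar>
        \<le> \<eta> * (1 + C) * (y t \<bullet> y t) + 2 * C / \<eta> * (h t \<bullet> h t)"
      by (rule perturbed_form_bound[OF _ _ _ \<eta> X.C]) (use elim in \<open>auto simp: cm.add_right\<close>)
    show ?case
      using 2 Eb[OF corr_square(1)[OF y, of t]] E0
      unfolding X.iw_def Y.iw_def Tt h_def by linarith
  qed
  \<comment> \<open>One integration serves both forms; for \<open>w\<close> the weight
    \<open>r\<close> of the derivative is \<open>0\<close>.\<close>
  have int: "\<bar>integral\<^sup>L ?M f - integral\<^sup>L ?M g\<bar> \<le> r * X.deriv_sq y + s * X.fun_sq y + 2 * E * (b - a)"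
    if f: "ess_bounded a b f" and g: "ess_bounded a b g"
      and le: "AE t in ?M. \<bar>f t - g t\<bar> \<le> r * (vd y t \<bullet> vd y t) + s * (y t \<bullet> y t) + 2 * E" for f g :: "real \<Rightarrow> real" and r s
  proof -
    let ?h = "\<lambda>t. r * (vd y t \<bullet> vd y t) + s * (y t \<bullet> y t) + 2 * E"
    have eh: "ess_bounded a b ?h" by (intro ess_bounded_add ess_bounded_cmult ess_bounded_const ey)
    have "AE t in ?M. f t \<le> g t + ?h t" "AE t in ?M. g t \<le> f t + ?h t"
      using le by (eventually_elim, linarith)+
    then have "integral\<^sup>L ?M f \<le> (\<integral>t. g t + ?h t \<partial>?M)" "integral\<^sup>L ?M g \<le> (\<integral>t. f t + ?h t \<partial>?M)"
      by (intro ess_integral_mono ess_bounded_add f g eh; simp)+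
    moreover have "(\<integral>t. g t + ?h t \<partial>?M) = integral\<^sup>L ?M g + integral\<^sup>L ?M ?h"
      "(\<integral>t. f t + ?h t \<partial>?M) = integral\<^sup>L ?M f + integral\<^sup>L ?M ?h"
      using ess_bounded_integrable[OF f] ess_bounded_integrable[OF g] ess_bounded_integrable[OF eh]
      by (auto intro!: Bochner_Integration.integral_add)
    moreover have "integral\<^sup>L ?M ?h = r * X.deriv_sq y + s * X.fun_sq y + 2 * E * (b - a)"
    proof -
      have "integral\<^sup>L ?M ?h = (\<integral>t. r * (vd y t \<bullet> vd y t) + s * (y t \<bullet> y t) \<partial>?M) + (\<integral>t. 2 * E \<partial>?M)"
        by (intro Bochner_Integration.integral_add ess_bounded_integrable ess_bounded_add ess_bounded_cmult ess_bounded_const ey)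
      also have "(\<integral>t. r * (vd y t \<bullet> vd y t) + s * (y t \<bullet> y t) \<partial>?M) = r * X.deriv_sq y + s * X.fun_sq y"
        using ess_bounded_integrable[OF ey(1)] ess_bounded_integrable[OF ey(2)] by (simp add: X.deriv_sq_def X.fun_sq_def)
      finally show ?thesis unfolding X.integral_const by simp
    qed
    ultimately show ?thesis by linarith
  qed
  have EK: "2 * E * (b - a) = \<eta> * (4 * C * K2 a b * (b - a)) * H y" by (simp add: E_def)
  have KH: "\<eta> * K3 a b C * H y = \<eta> * (1 + C) * H y + \<eta> * (4 * C * K2 a b * (b - a)) * H y + \<eta> * (K1 a b * H y)"
    by (simp add: K3_def algebra_simps)
  have KH1: "\<eta> * (1 + C) * H y = \<eta> * (1 + C) * X.deriv_sq y + \<eta> * (1 + C) * X.fun_sq y"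
    by (simp add: H_def algebra_simps)
  have q1: "\<bar>integral\<^sup>L ?M (X.iq (T y) (T y)) - integral\<^sup>L ?M (Y.iq y y)\<bar> \<le>
      \<eta> * (1 + C) * X.deriv_sq y + \<eta> * (1 + C) * X.fun_sq y + 2 * E * (b - a)"
    by (rule int[OF X.ess_iq[OF l(2,2)] Y.ess_iq[OF l(1,1)] pq])
  have "\<bar>\<beta> (\<tau> (bd a b y)) (\<tau> (bd a b y)) - \<beta>' (bd a b y) (bd a b y)\<bar> \<le> \<eta> * (norm (bd a b y))\<^sup>2"
    by (rule \<beta>_close[OF Y.DD(2)[OF y]])
  also have "\<dots> \<le> \<eta> * (K1 a b * H y)" using bd_bound[OF l(1)] \<eta> by (intro mult_left_mono) auto
  finally show "\<bar>X.q (T y) (T y) - Y.q y y\<bar> \<le> \<eta> * K3 a b C * H y"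
    using q1 unfolding X.q_def Y.q_def bd_T KH KH1 EK by linarith
  have w1: "\<bar>integral\<^sup>L ?M (X.iw (T y) (T y)) - integral\<^sup>L ?M (Y.iw y y)\<bar> \<le>
      0 * X.deriv_sq y + \<eta> * (1 + C) * X.fun_sq y + 2 * E * (b - a)"
    by (rule int[OF X.ess_iw Y.ess_iw pw]) (intro lip_ae_ess_bounded l)+
  have "\<eta> * (1 + C) * X.deriv_sq y \<ge> 0" "\<eta> * (K1 a b * H y) \<ge> 0"
    using \<eta> X.C X.deriv_sq_nonneg K_pos H_nonneg by simp_all
  then show "\<bar>X.w (T y) (T y) - Y.w y y\<bar> \<le> \<eta> * K3 a b C * H y"
    using w1 unfolding X.w_def Y.w_def KH KH1 EK by linarith
qed

text \<open>On the test space the energy is at most \<open>\<kappa> * w\<close>, so passing to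
  \<open>T y\<close> changes both forms by at most \<open>\<theta> * w\<close>. By
  \<open>small\<close>, raising \<open>lam\<close> by \<open>\<epsilon>\<close> makes up for this,
  and \<open>\<theta> < 1\<close> keeps \<open>w\<close> positive at \<open>T y\<close>, so
  \<open>T\<close> is injective there. \<open>\<Lambda>\<close> replaces \<open>lam\<close> in the
  smallness condition, which therefore holds for all \<open>lam\<close> up to
  \<open>\<Lambda>\<close> at once.\<close>

theorem below_transfer:
  assumes \<Lambda>: "lam \<le> \<Lambda>" "0 \<le> \<Lambda>" and \<epsilon>: "\<epsilon> > 0"
    and small: "\<eta> * K3 a b C * (Y.c1 * \<Lambda> + Y.c2) * (1 + \<Lambda> + Y.cL / \<mu> + \<epsilon>) < min \<epsilon> 1"
    and Bs: "Y.FP.below lam Bs"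
  shows "\<exists>Bs'. X.FP.below (lam + \<epsilon>) Bs' \<and> card Bs' = card Bs"
proof -
  have B: "Bs \<subseteq> Y.D" "finite Bs" "fs.independent Bs" "\<And>y. y \<in> fs.span Bs \<Longrightarrow> Y.q y y \<le> lam * Y.w y y"
    using Bs unfolding Y.FP.below_def by auto
  have sD: "fs.span Bs \<subseteq> Y.D" using B(1) Y.subspace_D fs.span_minimal by blast
  define \<kappa> where "\<kappa> = Y.c1 * \<Lambda> + Y.c2"
  define \<theta> where "\<theta> = \<eta> * K3 a b C * \<kappa>"
  \<comment> \<open>Bounds \<open>|lam|\<close> once a nonzero test function exists:
    \<open>lam \<le> \<Lambda>\<close>, and the Rayleigh quotient is at least
    \<open>- (cL / \<mu>)\<close>.\<close>
  define L where "L = \<Lambda> + Y.cL / \<mu>"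
  have L0: "L \<ge> 0" using \<Lambda> Y.cL_pos Y.\<mu> by (simp add: L_def)
  have \<kappa>0: "\<kappa> \<ge> 0"
    using \<Lambda> Y.c1_pos Y.cL_pos Y.\<mu> by (simp add: \<kappa>_def Y.c2_def)
  have \<theta>0: "\<theta> \<ge> 0" using \<kappa>0 \<eta> K_pos by (simp add: \<theta>_def)
  have sm: "\<theta> * (1 + L + \<epsilon>) < \<epsilon>" "\<theta> * (1 + L + \<epsilon>) < 1"
    using small by (simp_all add: \<theta>_def \<kappa>_def L_def add_ac)
  have \<theta>1: "\<theta> < 1"
  proof -
    have "\<theta> * 1 \<le> \<theta> * (1 + L + \<epsilon>)" using L0 \<epsilon> \<theta>0 by (intro mult_left_mono) auto
    then show ?thesis using sm by simp
  qed
  have main: "X.q (T y) (T y) \<le> (lam + \<epsilon>) * X.w (T y) (T y) \<and> (T y = 0 \<longrightarrow> y = 0)" if y: "y \<in> fs.span Bs" for y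
  proof (cases "y = 0")
    case True
    have "T 0 = 0" using T_scale[of 0 0] Y.FP.Q.D_simps(1) by simp
    then show ?thesis using True X.FP.Q.zero(1)[OF X.FP.Q.D_simps(1)] X.FP.W.zero(1)[OF X.FP.W.D_simps(1)] by simp
  next
    case False
    have yD: "y \<in> Y.D" using y sD by auto
    have w0: "Y.w y y > 0" by (rule Y.w_positive[OF yD False])
    have qy: "Y.q y y \<le> lam * Y.w y y" by (rule B(4)[OF y])
    have "- (Y.cL / \<mu>) * Y.w y y \<le> lam * Y.w y y" using Y.q_bounded_below[OF yD] qy by linarith
    then have "- (Y.cL / \<mu>) \<le> lam" using w0 by (simp only: mult_le_cancel_right_pos)
    then have laml: "\<bar>lam\<bar> \<le> L" using \<Lambda> Y.cL_pos Y.\<mu> unfolding L_def by (smt (verit) divide_nonneg_pos)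
    have "H y \<le> Y.c1 * Y.q y y + Y.c2 * Y.w y y" using Y.energy_bound[OF yD] by (simp add: H_def)
    also have "Y.c1 * Y.q y y \<le> Y.c1 * (\<Lambda> * Y.w y y)"
      using qy \<Lambda> w0 Y.c1_pos by (intro mult_left_mono) (auto intro: order_trans mult_right_mono)
    finally have "H y \<le> \<kappa> * Y.w y y" by (simp add: \<kappa>_def algebra_simps)
    then have "\<eta> * K3 a b C * H y \<le> \<eta> * K3 a b C * (\<kappa> * Y.w y y)"
      using \<eta> K_pos by (intro mult_left_mono) auto
    then have Hb: "\<eta> * K3 a b C * H y \<le> \<theta> * Y.w y y" by (simp add: \<theta>_def)
    define d where "d = X.w (T y) (T y) - Y.w y y"
    have d: "\<bar>d\<bar> \<le> \<theta> * Y.w y y" using form_difference(2)[OF yD] Hb unfolding d_def by linarith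
    have dw: "X.w (T y) (T y) = Y.w y y + d" by (simp add: d_def)
    have q1: "X.q (T y) (T y) \<le> lam * Y.w y y + \<theta> * Y.w y y"
      using form_difference(1)[OF yD] Hb qy by linarith
    have "\<theta> * Y.w y y < 1 * Y.w y y" using \<theta>1 w0 by (intro mult_strict_right_mono)
    then have wpos: "X.w (T y) (T y) > 0" using d unfolding dw by linarith
    have "(lam + \<epsilon>) * d \<ge> - ((L + \<epsilon>) * (\<theta> * Y.w y y))"
    proof -
      have "\<bar>(lam + \<epsilon>) * d\<bar> \<le> (L + \<epsilon>) * (\<theta> * Y.w y y)"
        unfolding abs_mult using laml d \<epsilon> L0 by (intro mult_mono) auto
      then show ?thesis by linarith
    qed
    moreover have "\<theta> * (1 + L + \<epsilon>) * Y.w y y \<le> \<epsilon> * Y.w y y" using sm(1) w0 by (intro mult_right_mono) auto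
    moreover have "\<theta> * (1 + L + \<epsilon>) * Y.w y y = \<theta> * Y.w y y + (L + \<epsilon>) * (\<theta> * Y.w y y)" by (simp add: algebra_simps)
    moreover have "(lam + \<epsilon>) * X.w (T y) (T y) = lam * Y.w y y + \<epsilon> * Y.w y y + (lam + \<epsilon>) * d"
      unfolding dw by (simp add: algebra_simps)
    ultimately have "X.q (T y) (T y) \<le> (lam + \<epsilon>) * X.w (T y) (T y)" using q1 by linarith
    moreover have "T y \<noteq> 0"
    proof
      assume "T y = 0"
      then show False using wpos X.FP.W.zero(1)[OF X.FP.W.D_simps(1)] by simp
    qed
    ultimately show ?thesis by simp
  qed
  have im: "fs.independent (T ` Bs)" "card (T ` Bs) = card Bs" "fs.span (T ` Bs) \<subseteq> T ` fs.span Bs"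
    by (rule fs.independent_image_on_span[OF B(2,3)]; use sD T_add T_scale main in blast)+
  have "X.FP.below (lam + \<epsilon>) (T ` Bs)"
    unfolding X.FP.below_def
  proof (intro conjI ballI)
    show "T ` Bs \<subseteq> X.D" using T_D B(1) by blast
    show "finite (T ` Bs)" using B(2) by simp
    show "fs.independent (T ` Bs)" by (rule im)
    show "X.q x x \<le> (lam + \<epsilon>) * X.w x x" if "x \<in> fs.span (T ` Bs)" for x
      using that im(3) main by blast
  qed
  then show ?thesis using im(2) by blast
qed

end

section \<open>Boundary data of nearby conditions in one layer\<close>

lemma bilinear_adjm: "bounded_bilinear (\<lambda>(M::complex^'n::finite^'m::finite) z. adjm M *v z)"
  unfolding bilinear_conv_bounded_bilinear[symmetric] bilinear_def
proof (intro conjI allI)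
  show "linear (\<lambda>z. adjm M *v z)" for M :: "complex^'n^'m" by (rule linear_mv)
  show "linear (\<lambda>M :: complex^'n^'m. adjm M *v z)" for z
  proof (rule linearI)
    have c: "cnj (r *\<^sub>R x) = r *\<^sub>R cnj x" for r x by (simp add: scaleR_conv_of_real)
    show "adjm (M + N) *v z = adjm M *v z + adjm N *v z" for M N :: "complex^'n^'m"
      by (simp add: vec_eq_iff matrix_vector_mult_def adjm_def distrib_right sum.distrib)
    show "adjm (r *\<^sub>R M) *v z = r *\<^sub>R (adjm M *v z)" for r and M :: "complex^'n^'m"
      by (simp add: vec_eq_iff matrix_vector_mult_def adjm_def c scaleR_sum_right)
  qed
qed

interpretation adj: bounded_bilinear "\<lambda>(M::complex^'n::finite^'m::finite) z. adjm M *v z"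
  by (rule bilinear_adjm)

text \<open>\<open>n0\<close> is a complex dimension, but the orthogonality arguments for ranges are
  real; a complex isomorphism is also a real one.\<close>

lemma real_dim_eq:
  fixes S T :: "(complex^'n::finite) set"
  assumes "vec.subspace S" "vec.subspace T" "vec.dim S = vec.dim T"
  shows "dim S = dim T"
proof -
  obtain f where f: "Vector_Spaces.linear (*s) (*s) f" "f ` S = T" "inj_on f S"
    using vec.subspace_isomorphism[OF assms] by blast
  interpret f: Vector_Spaces.linear "(*s)" "(*s)" f by (rule f(1))
  have lf: "linear f"
  proof (rule linearI)
    show "f (x + y) = f x + f y" for x y by (rule f.add)
    show "f (r *\<^sub>R x) = r *\<^sub>R f x" for r x
      using f.scale[of "complex_of_real r" x] by (simp add: of_real_vector_scalar)
  qed
  have "subspace S"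
    using assms(1) vec.subspace_scale[OF assms(1), of _ "complex_of_real _"]
    by (auto simp: subspace_def of_real_vector_scalar intro: vec.subspace_0 vec.subspace_add)
  then have "span S = S" by (rule span_eq_iff[THEN iffD2])
  then have "inj_on f (span S)" using f(3) by (simp only:)
  then have "dim (f ` S) = dim S" by (rule dim_image_eq[OF lf])
  then show ?thesis using f(2) by simp
qed

lemma subspace_Vbc: "subspace (Vbc B)"
  unfolding Vbc_def by (rule linear_subspace_image[OF linear_mv subspace_UNIV])

text \<open>The kernel of \<open>B\<close> is the orthogonal complement of the range of
  \<open>B*\<close>.\<close>

lemma dim_Vbc: "dim (Vbc (B :: 'd::finite cmat2)) + dim {x. B *v x = 0} = DIM(complex^('d + 'd))"
proof -
  have "{y \<in> UNIV. \<forall>x\<in>Vbc B. orthogonal x y} = {y. B *v y = 0}"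
  proof -
    have "(\<forall>x\<in>Vbc B. orthogonal x y) \<longleftrightarrow> (\<forall>z. (B *v y) \<bullet> z = 0)" for y
      unfolding Vbc_def orthogonal_def adjm_inner by (auto simp: inner_commute)
    also have "\<dots> y \<longleftrightarrow> B *v y = 0" for y using inner_eq_zero_iff by auto
    finally show ?thesis by auto
  qed
  then show ?thesis
    using dim_subspace_orthogonal_to_vectors[OF subspace_Vbc subspace_UNIV, of B] by simp
qed

lemma dim_Vbc_eq:
  fixes B B0 :: "'d::finite cmat2"
  assumes "n0 B = n0 B0" shows "dim (Vbc B) = dim (Vbc B0)"
proof -
  have s: "vec.subspace {x. M *v x = 0}" for M :: "'d cmat2"
    by (auto simp: vec.subspace_def matrix_vector_right_distrib vector_scalar_commute)
  have "dim {x. B *v x = 0} = dim {x. B0 *v x = 0}"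
    using assms unfolding n0_def by (rule real_dim_eq[OF s s])
  then show ?thesis using dim_Vbc[of B] dim_Vbc[of B0] by linarith
qed

text \<open>On a layer the rank of \<open>B\<close> is constant, so a complement of the kernel of \<open>B0*\<close> is mapped onto
  the range of \<open>B*\<close> for all nearby \<open>B\<close> in the layer, with uniformly bounded inverse.\<close>
lemma uniform_section:
  fixes B0 :: "'d::finite cmat2"
  obtains Z0 \<delta> s where "vec.subspace Z0" "\<delta> > 0" "s > 0"
    "\<And>B Y. norm (B - B0) < \<delta> \<Longrightarrow> n0 B = n0 B0 \<Longrightarrow> Y \<in> Vbc B \<Longrightarrow> \<exists>z\<in>Z0. adjm B *v z = Y \<and> norm z \<le> s * norm Y"
    "\<And>B z. norm (B - B0) < \<delta> \<Longrightarrow> z \<in> Z0 \<Longrightarrow> adjm B *v z = 0 \<Longrightarrow> z = 0"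
proof -
  \<comment> \<open>The orthogonal complement of the kernel of \<open>B0*\<close>. It depends on the
    centre only and serves every nearby \<open>B\<close>.\<close>
  define Z0 where "Z0 = {z. \<forall>x. adjm B0 *v x = 0 \<longrightarrow> z \<bullet> x = 0}"
  have sub: "subspace Z0" by (auto simp: Z0_def subspace_def inner_add_left)
  have vsub: "vec.subspace Z0"
  proof (rule vec.subspaceI)
    fix c z assume z: "z \<in> Z0"
    have iz: "(\<i> *s z) \<bullet> x = 0" if x: "adjm B0 *v x = 0" for x
    proof -
      have "adjm B0 *v (\<i> *s x) = 0" using x by (simp add: vector_scalar_commute)
      then have "z \<bullet> (\<i> *s x) = 0" using z unfolding Z0_def by blast
      moreover have "(\<i> *s z) \<bullet> x = - (z \<bullet> (\<i> *s x))"
        using inner_rotate[of "\<i> *s z" x] by simp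
      ultimately show ?thesis by simp
    qed
    have "c *s z = Re c *\<^sub>R z + Im c *\<^sub>R (\<i> *s z)"
      by (simp add: vec_eq_iff complex_eq_iff scaleR_conv_of_real[where 'a=complex])
    then show "c *s z \<in> Z0" using z iz by (auto simp: Z0_def inner_add_left)
  qed (auto simp: Z0_def inner_add_left)
  have inj0: "z = 0" if "z \<in> Z0" "adjm B0 *v z = 0" for z
  proof -
    have "z \<bullet> z = 0" using that unfolding Z0_def by blast
    then show ?thesis by simp
  qed
  have span0: "span Z0 = Z0" using sub by (rule span_eq_iff[THEN iffD2])
  have "dim (Vbc B0) = dim Z0"
  proof -
    have "Vbc B0 = (\<lambda>z. adjm B0 *v z) ` Z0"
    proof
      show "Vbc B0 \<subseteq> (\<lambda>z. adjm B0 *v z) ` Z0"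
      proof
        fix Y assume "Y \<in> Vbc B0"
        then obtain x where x: "Y = adjm B0 *v x" by (auto simp: Vbc_def)
        have "subspace {x. adjm B0 *v x = 0}"
          by (auto simp: subspace_def linear_add[OF linear_mv] linear_scale[OF linear_mv])
        then have sp: "span {x. adjm B0 *v x = 0} = {x. adjm B0 *v x = 0}" by (rule span_eq_iff[THEN iffD2])
        obtain y z where yz: "y \<in> span {x. adjm B0 *v x = 0}"
          "\<And>w. w \<in> span {x. adjm B0 *v x = 0} \<Longrightarrow> orthogonal z w" "x = y + z"
          using orthogonal_subspace_decomp_exists[of "{x. adjm B0 *v x = 0}" x] by metis
        have "z \<in> Z0" using yz(2) unfolding sp Z0_def orthogonal_def by blast
        moreover have "Y = adjm B0 *v z" using yz(1) unfolding sp x yz(3) by (simp add: linear_add[OF linear_mv])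
        ultimately show "Y \<in> (\<lambda>z. adjm B0 *v z) ` Z0" by blast
      qed
    qed (auto simp: Vbc_def)
    moreover have "inj_on (\<lambda>z. adjm B0 *v z) (span Z0)"
      unfolding span0
      by (rule inj_onI) (metis inj0 sub subspace_diff linear_diff[OF linear_mv] right_minus_eq)
    ultimately show ?thesis using dim_image_eq[OF linear_mv] by metis
  qed
  obtain e where e: "e > 0" "\<And>z. z \<in> Z0 \<Longrightarrow> norm (adjm B0 *v z) \<ge> e * norm z"
    using injective_imp_isometric[OF closed_subspace[OF sub] sub bounded_linear_mv[of "adjm B0"]] inj0 by blast
  obtain K where K: "K > 0" "\<And>(M :: 'd cmat2) z. norm (adjm M *v z) \<le> norm M * norm z * K"
    using adj.pos_bounded by blast
  \<comment> \<open>Within this distance the perturbation of \<open>B0*\<close> uses up at most half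
    of its lower bound \<open>e\<close> on \<open>Z0\<close>.\<close>
  define \<delta> where "\<delta> = e / (2 * K)"
  have \<delta>: "\<delta> > 0" using e K by (simp add: \<delta>_def)
  have low: "norm z \<le> 2 / e * norm (adjm B *v z)" if B: "norm (B - B0) < \<delta>" and z: "z \<in> Z0" for B z
  proof -
    have "adjm B0 *v z = adjm B *v z - adjm (B - B0) *v z" by (simp add: adj.diff_left)
    then have "norm (adjm B0 *v z) \<le> norm (adjm B *v z) + norm (adjm (B - B0) *v z)"
      using norm_triangle_ineq4 by metis
    also have "norm (adjm (B - B0) *v z) \<le> norm (B - B0) * norm z * K" by (rule K)
    also have "\<dots> \<le> \<delta> * norm z * K" using B K by (intro mult_right_mono) auto
    also have "\<delta> * norm z * K = e / 2 * norm z" using K by (simp add: \<delta>_def)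
    finally have "e / 2 * norm z \<le> norm (adjm B *v z)" using e(2)[OF z] by simp
    then show ?thesis using e(1) by (simp add: field_simps)
  qed
  show thesis
  proof (rule that[OF vsub \<delta>])
    show "2 / e > 0" using e by simp
    show "z = 0" if "norm (B - B0) < \<delta>" "z \<in> Z0" "adjm B *v z = 0" for B z
      using low[OF that(1,2)] that(3) by simp
    fix B :: "'d cmat2" and Y assume B: "norm (B - B0) < \<delta>" "n0 B = n0 B0" and Y: "Y \<in> Vbc B"
    have "inj_on (\<lambda>z. adjm B *v z) (span Z0)"
      unfolding span0
    proof (rule inj_onI)
      fix x y assume h: "x \<in> Z0" "y \<in> Z0" "adjm B *v x = adjm B *v y"
      have "norm (x - y) \<le> 2 / e * norm (adjm B *v (x - y))" using low[OF B(1) subspace_diff[OF sub h(1,2)]] .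
      also have "adjm B *v (x - y) = 0" using h(3) by (simp add: linear_diff[OF linear_mv])
      finally show "x = y" by simp
    qed
    \<comment> \<open>Here the layer enters: the image of \<open>Z0\<close> has the dimension of the
      range of \<open>B0*\<close>, which equals that of the range of \<open>B*\<close>, so the
      inclusion of the image in the range is an equality.\<close>
    then have dd: "dim ((\<lambda>z. adjm B *v z) ` Z0) = dim (Vbc B)"
      using dim_image_eq[OF linear_mv] dim_Vbc_eq[OF B(2)] \<open>dim (Vbc B0) = dim Z0\<close> by metis
    have s1: "subspace ((\<lambda>z. adjm B *v z) ` Z0)" by (rule linear_subspace_image[OF linear_mv sub])
    have s2: "(\<lambda>z. adjm B *v z) ` Z0 \<subseteq> Vbc B" by (auto simp: Vbc_def)
    have im: "(\<lambda>z. adjm B *v z) ` Z0 = Vbc B"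
      by (rule subspace_dim_equal[OF s1 subspace_Vbc s2 eq_refl[OF dd[symmetric]]])
    have "Y \<in> (\<lambda>z. adjm B *v z) ` Z0" using Y by (simp only: im)
    then obtain z where z: "Y = adjm B *v z" "z \<in> Z0" by (rule imageE)
    show "\<exists>z\<in>Z0. adjm B *v z = Y \<and> norm z \<le> 2 / e * norm Y"
      using low[OF B(1) z(2)] z by (intro bexI[of _ z]) simp_all
  qed
qed

text \<open>One preimage \<open>z\<close> in \<open>Z0\<close> serves both conditions:
  \<open>\<tau>\<close> maps \<open>B'* z\<close> to \<open>B* z\<close>. The forms become the inner
  products of \<open>A* z\<close> with \<open>B* z\<close> and of \<open>A'* z\<close> with
  \<open>B'* z\<close>, whose difference is linear in \<open>A - A'\<close> and
  \<open>B - B'\<close>.\<close>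

lemma boundary_uniform:
  fixes A0 B0 :: "'d::finite cmat2"
  obtains \<delta> Cb Kb where "\<delta> > 0" "Cb > 0" "Kb > 0"
    "\<And>A B Y. norm (A - A0) < \<delta> \<Longrightarrow> norm (B - B0) < \<delta> \<Longrightarrow> n0 B = n0 B0 \<Longrightarrow> Y \<in> Vbc B \<Longrightarrow>
      \<exists>z. adjm B *v z = Y \<and> norm (adjm A *v z) \<le> Cb * norm Y"
    "\<And>A B A' B' d. norm (A - A0) < \<delta> \<Longrightarrow> norm (B - B0) < \<delta> \<Longrightarrow> n0 B = n0 B0 \<Longrightarrow> (A, B) \<in> BC_adm \<Longrightarrow>
      norm (A' - A0) < \<delta> \<Longrightarrow> norm (B' - B0) < \<delta> \<Longrightarrow> n0 B' = n0 B0 \<Longrightarrow> (A', B') \<in> BC_adm \<Longrightarrow>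
      norm (A - A') \<le> d \<Longrightarrow> norm (B - B') \<le> d \<Longrightarrow>
      \<exists>\<tau>. (\<forall>Z\<in>Vbc B'. \<tau> Z \<in> Vbc B) \<and> (\<forall>Y\<in>Vbc B'. \<forall>Z\<in>Vbc B'. \<tau> (Y + Z) = \<tau> Y + \<tau> Z) \<and>
        (\<forall>c. \<forall>Z\<in>Vbc B'. \<tau> (c *s Z) = c *s \<tau> Z) \<and> (\<forall>Z\<in>Vbc B'. norm (\<tau> Z - Z) \<le> Kb * d * norm Z) \<and>
        (\<forall>Z\<in>Vbc B'. \<bar>\<beta>bc A B (\<tau> Z) (\<tau> Z) - \<beta>bc A' B' Z Z\<bar> \<le> Kb * d * (norm Z)\<^sup>2)"
proof -
  obtain Z0 \<delta>0 s where Z0: "vec.subspace Z0" and \<delta>0: "\<delta>0 > 0" and s: "s > 0"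
    and sec: "\<And>B Y. norm (B - B0) < \<delta>0 \<Longrightarrow> n0 B = n0 B0 \<Longrightarrow> Y \<in> Vbc B \<Longrightarrow> \<exists>z\<in>Z0. adjm B *v z = Y \<and> norm z \<le> s * norm Y"
    and inj: "\<And>B z. norm (B - B0) < \<delta>0 \<Longrightarrow> z \<in> Z0 \<Longrightarrow> adjm B *v z = 0 \<Longrightarrow> z = 0"
    using uniform_section by metis
  obtain K where K: "K > 0" "\<And>(M :: 'd cmat2) z. norm (adjm M *v z) \<le> norm M * norm z * K"
    using adj.pos_bounded by blast
  define N where "N = norm A0 + norm B0 + 1"
  have N0: "N > 0" by (simp add: N_def add_nonneg_pos)
  define \<delta> where "\<delta> = min \<delta>0 1"
  have \<delta>: "\<delta> > 0" "\<delta> \<le> \<delta>0" "\<delta> \<le> 1" using \<delta>0 by (auto simp: \<delta>_def)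
  \<comment> \<open>Per unit of \<open>d\<close>, the first summand bounds
    \<open>\<tau> Z - Z\<close>, the second the two products that make up the difference of the
    forms.\<close>
  define Kb where "Kb = s * K + 2 * N * (s * K)\<^sup>2"
  have sK: "s * K > 0" using s K by simp
  have mv: "norm (adjm M *v z) \<le> m * (s * K) * norm Z" if "norm M \<le> m" "norm z \<le> s * norm Z" for M :: "'d cmat2" and z Z :: "complex^('d+'d)" and m
  proof -
    have "norm (adjm M *v z) \<le> norm M * norm z * K" by (rule K)
    also have "\<dots> \<le> m * (s * norm Z) * K"
      using that K s order_trans[OF norm_ge_zero that(1)] by (intro mult_right_mono mult_mono) auto
    finally show ?thesis by (simp add: mult_ac)
  qed
  show thesis
  proof (rule that[OF \<delta>(1)])
    show "N * (s * K) > 0" using N0 sK by simp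
    show "Kb > 0" unfolding Kb_def using N0 sK by (intro add_pos_nonneg mult_nonneg_nonneg) simp_all
    show "\<exists>z. adjm B *v z = Y \<and> norm (adjm A *v z) \<le> N * (s * K) * norm Y"
      if h: "norm (A - A0) < \<delta>" "norm (B - B0) < \<delta>" "n0 B = n0 B0" "Y \<in> Vbc B" for A B Y
    proof -
      obtain z where z: "adjm B *v z = Y" "norm z \<le> s * norm Y" using sec[OF _ h(3,4)] h(2) \<delta>(2) by auto
      have "norm A \<le> N" using norm_triangle_sub[of A A0] h(1) \<delta>(3) norm_ge_zero[of B0] unfolding N_def by linarith
      then show ?thesis using mv[OF _ z(2)] z(1) by blast
    qed
    fix A B A' B' :: "'d cmat2" and d
    assume h: "norm (A - A0) < \<delta>" "norm (B - B0) < \<delta>" "n0 B = n0 B0" and adm: "(A, B) \<in> BC_adm"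
      and h': "norm (A' - A0) < \<delta>" "norm (B' - B0) < \<delta>" "n0 B' = n0 B0" and adm': "(A', B') \<in> BC_adm"
      and d: "norm (A - A') \<le> d" "norm (B - B') \<le> d"
    have b': "norm (B' - B0) < \<delta>0" using h'(2) \<delta>(2) by simp
    have d0: "d \<ge> 0" using d(1) norm_ge_zero order_trans by blast
    have "\<forall>Z\<in>Vbc B'. \<exists>z. z \<in> Z0 \<and> adjm B' *v z = Z \<and> norm z \<le> s * norm Z" using sec[OF b' h'(3)] by blast
    then obtain \<zeta> where \<zeta>: "\<And>Z. Z \<in> Vbc B' \<Longrightarrow> \<zeta> Z \<in> Z0 \<and> adjm B' *v \<zeta> Z = Z \<and> norm (\<zeta> Z) \<le> s * norm Z"
      by metis
    \<comment> \<open>Preimages in \<open>Z0\<close> are unique, so the chosen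
      \<open>\<zeta>\<close> is linear.\<close>
    have uniq: "\<zeta> Z = z" if "Z \<in> Vbc B'" "z \<in> Z0" "adjm B' *v z = Z" for z Z
    proof -
      have "adjm B' *v (\<zeta> Z - z) = 0" using \<zeta>[OF that(1)] that(3) by (simp add: linear_diff[OF linear_mv])
      then have "\<zeta> Z - z = 0" using inj[OF b'] vec.subspace_diff[OF Z0] \<zeta>[OF that(1)] that(2) by blast
      then show ?thesis by simp
    qed
    define \<tau> where "\<tau> = (\<lambda>Z. adjm B *v \<zeta> Z)"
    have V': "Y + Z \<in> Vbc B'" "c *s Y \<in> Vbc B'" if YZ: "Y \<in> Vbc B'" "Z \<in> Vbc B'" for Y Z c
    proof -
      obtain y z where "Y = adjm B' *v y" "Z = adjm B' *v z" using YZ by (auto simp: Vbc_def)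
      then have "Y + Z = adjm B' *v (y + z)" "c *s Y = adjm B' *v (c *s y)"
        by (simp_all add: linear_add[OF linear_mv] vector_scalar_commute)
      then show "Y + Z \<in> Vbc B'" "c *s Y \<in> Vbc B'" by (auto simp: Vbc_def)
    qed
    have N: "norm A' \<le> N" "norm B \<le> N"
      using norm_triangle_sub[of A' A0] norm_triangle_sub[of B B0] h'(1) h(2) \<delta>(3)
        norm_ge_zero[of B0] norm_ge_zero[of A0] unfolding N_def by linarith+
    show "\<exists>\<tau>. (\<forall>Z\<in>Vbc B'. \<tau> Z \<in> Vbc B) \<and> (\<forall>Y\<in>Vbc B'. \<forall>Z\<in>Vbc B'. \<tau> (Y + Z) = \<tau> Y + \<tau> Z) \<and>
        (\<forall>c. \<forall>Z\<in>Vbc B'. \<tau> (c *s Z) = c *s \<tau> Z) \<and> (\<forall>Z\<in>Vbc B'. norm (\<tau> Z - Z) \<le> Kb * d * norm Z) \<and>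
        (\<forall>Z\<in>Vbc B'. \<bar>\<beta>bc A B (\<tau> Z) (\<tau> Z) - \<beta>bc A' B' Z Z\<bar> \<le> Kb * d * (norm Z)\<^sup>2)"
    proof (intro exI[of _ \<tau>] conjI ballI allI)
      fix Z assume Z: "Z \<in> Vbc B'"
      show \<tau>V: "\<tau> Z \<in> Vbc B" by (auto simp: \<tau>_def Vbc_def)
      have dB: "norm (adjm (B - B') *v \<zeta> Z) \<le> d * (s * K) * norm Z" using mv[OF d(2)] \<zeta>[OF Z] by blast
      have dA: "norm (adjm (A - A') *v \<zeta> Z) \<le> d * (s * K) * norm Z" using mv[OF d(1)] \<zeta>[OF Z] by blast
      have nB: "norm (adjm B *v \<zeta> Z) \<le> N * (s * K) * norm Z" using mv[OF N(2)] \<zeta>[OF Z] by blast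
      have nA: "norm (adjm A' *v \<zeta> Z) \<le> N * (s * K) * norm Z" using mv[OF N(1)] \<zeta>[OF Z] by blast
      have "\<tau> Z - Z = adjm (B - B') *v \<zeta> Z" using \<zeta>[OF Z] by (simp add: \<tau>_def adj.diff_left)
      then have "norm (\<tau> Z - Z) \<le> d * (s * K) * norm Z" using dB by simp
      also have "\<dots> \<le> Kb * d * norm Z"
      proof -
        have "d * (s * K) \<le> d * Kb" using d0 N0 by (intro mult_left_mono) (auto simp: Kb_def)
        then show ?thesis by (intro mult_right_mono) (simp_all add: mult.commute)
      qed
      finally show "norm (\<tau> Z - Z) \<le> Kb * d * norm Z" .
      have e1: "\<beta>bc A B (\<tau> Z) (\<tau> Z) = (adjm A *v \<zeta> Z) \<bullet> (adjm B *v \<zeta> Z)"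
        using \<beta>bc_eq[OF adm \<tau>V, of "\<zeta> Z"] by (simp add: \<tau>_def)
      have e2: "\<beta>bc A' B' Z Z = (adjm A' *v \<zeta> Z) \<bullet> (adjm B' *v \<zeta> Z)"
        using \<beta>bc_eq[OF adm' Z, of "\<zeta> Z"] \<zeta>[OF Z] by simp
      define x1 x2 p where "x1 = (adjm (A - A') *v \<zeta> Z) \<bullet> (adjm B *v \<zeta> Z)"
        and "x2 = (adjm A' *v \<zeta> Z) \<bullet> (adjm (B - B') *v \<zeta> Z)" and "p = (d * (s * K) * norm Z) * (N * (s * K) * norm Z)"
      have b1: "\<bar>x1\<bar> \<le> p"
        unfolding x1_def p_def
        by (rule order_trans[OF Cauchy_Schwarz_ineq2 mult_mono[OF dA nB]]) (use d0 sK in simp_all)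
      have b2: "\<bar>x2\<bar> \<le> p"
        unfolding x2_def p_def mult.commute[of "d * (s * K) * norm Z"]
        by (rule order_trans[OF Cauchy_Schwarz_ineq2 mult_mono[OF nA dB]]) (use N0 sK in simp_all)
      have "\<beta>bc A B (\<tau> Z) (\<tau> Z) - \<beta>bc A' B' Z Z = x1 + x2"
        unfolding e1 e2 x1_def x2_def by (simp add: adj.diff_left inner_diff_left inner_diff_right)
      then have "\<bar>\<beta>bc A B (\<tau> Z) (\<tau> Z) - \<beta>bc A' B' Z Z\<bar> \<le> p + p"
        using b1 b2 abs_triangle_ineq[of x1 x2] by simp
      also have "p + p = 2 * N * (s * K)\<^sup>2 * (d * (norm Z)\<^sup>2)"
        by (simp add: p_def power2_eq_square)
      also have "\<dots> \<le> Kb * (d * (norm Z)\<^sup>2)"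
        using d0 sK by (intro mult_right_mono) (auto simp: Kb_def)
      finally show "\<bar>\<beta>bc A B (\<tau> Z) (\<tau> Z) - \<beta>bc A' B' Z Z\<bar> \<le> Kb * d * (norm Z)\<^sup>2"
        by (simp only: mult.assoc)
      show "\<tau> (c *s Z) = c *s \<tau> Z" for c
      proof -
        have "\<zeta> (c *s Z) = c *s \<zeta> Z"
          using \<zeta>[OF Z] vec.subspace_scale[OF Z0] by (intro uniq V'(2)[OF Z Z]) (auto simp: vector_scalar_commute)
        then show ?thesis by (simp add: \<tau>_def vector_scalar_commute)
      qed
      fix Y assume Y: "Y \<in> Vbc B'"
      have "\<zeta> (Y + Z) = \<zeta> Y + \<zeta> Z"
        using \<zeta>[OF Z] \<zeta>[OF Y] vec.subspace_add[OF Z0]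
        by (intro uniq V'(1)[OF Y Z]) (auto simp: linear_add[OF linear_mv])
      then show "\<tau> (Y + Z) = \<tau> Y + \<tau> Z" by (simp add: \<tau>_def linear_add[OF linear_mv])
    qed
  qed
qed

section \<open>Representatives and the quotient topology\<close>

lemma n0_class:
  assumes c: "c \<in> Sigma_layer k" and AB: "(A, B) \<in> c" shows "n0 B = k"
proof -
  obtain A' B' where h: "(A', B') \<in> c" "n0 B' = k" and cs: "c \<in> BC_space" using c by (auto simp: Sigma_layer_def)
  have "((A, B), (A', B')) \<in> BC_rel"
    using in_quotient_imp_in_rel[OF equiv_BC_rel] cs AB h(1) unfolding BC_space_def by blast
  then obtain T where T: "invertible T" "B' = T ** B" by (auto simp: BC_rel_def)
  obtain T' where T': "T' ** T = mat 1" using T(1) by (auto simp: invertible_def)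
  have "B' *v x = 0 \<longleftrightarrow> B *v x = 0" for x
  proof
    assume "B' *v x = 0"
    then have "T' *v (T *v (B *v x)) = 0" unfolding T(2) by (simp add: matrix_vector_mul_assoc)
    then show "B *v x = 0" by (simp only: matrix_vector_mul_assoc[of T' T] T' matrix_vector_mul_lid)
  qed (simp add: T(2) matrix_vector_mul_assoc[symmetric])
  then show ?thesis using h(2) by (simp add: n0_def)
qed

text \<open>Left multiplication cannot raise the rank of the concatenation; used for
  \<open>T\<close> and for its inverse, this gives equality.\<close>

lemma BC_adm_mult:
  fixes A B T :: "'d::finite cmat2"
  assumes adm: "(A, B) \<in> BC_adm" and T: "invertible T"
  shows "(T ** A, T ** B) \<in> BC_adm"
proof -
  have cc: "concat_mat (X ** A) (X ** B) = X ** concat_mat A B" for X A B :: "'d cmat2"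
    by (simp add: vec_eq_iff concat_mat_def matrix_matrix_mult_def split: sum.split)
  have le: "rank (X ** N) \<le> rank N" for X :: "'d cmat2" and N :: "complex^(('d + 'd) + ('d + 'd))^('d + 'd)"
    unfolding row_rank_def_gen
  proof (rule vec.dim_mono)
    show "rows (X ** N) \<subseteq> vec.span (rows N)"
    proof
      fix v assume "v \<in> rows (X ** N)"
      then obtain i where i: "v = row i (X ** N)" by (auto simp: rows_def)
      have "v = (\<Sum>k\<in>UNIV. X $ i $ k *s row k N)"
        by (simp add: i row_def matrix_matrix_mult_def vec_eq_iff)
      also have "\<dots> \<in> vec.span (rows N)"
        by (intro vec.span_sum vec.span_scale vec.span_base) (auto simp: rows_def)
      finally show "v \<in> vec.span (rows N)" .
    qed
  qed
  obtain T' where T': "T' ** T = mat 1" using T by (auto simp: invertible_def)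
  have "concat_mat A B = T' ** concat_mat (T ** A) (T ** B)"
    unfolding cc matrix_mul_assoc T' by simp
  then have "rank (concat_mat (T ** A) (T ** B)) = rank (concat_mat A B)"
    using le[of T "concat_mat A B"] le[of T' "concat_mat (T ** A) (T ** B)"] unfolding cc by simp
  moreover have adj: "adjm (X ** Y) = adjm Y ** adjm X" for X Y :: "'d cmat2"
    by (simp add: vec_eq_iff adjm_def matrix_matrix_mult_def mult.commute)
  have "(T ** A) ** adjm (T ** B) = T ** (A ** adjm B) ** adjm T" "(T ** B) ** adjm (T ** A) = T ** (B ** adjm A) ** adjm T"
    by (simp_all add: adj matrix_mul_assoc)
  ultimately show ?thesis using adm by (simp add: BC_adm_def)
qed

text \<open>\<open>BC_top\<close> is built from a predicate on sets, so the axioms of a topology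
  have to be verified before the predicate can be used. For intersections it matters that different
  classes are disjoint.\<close>

lemma openin_BC_top:
  fixes U :: "'d::finite bcclass set"
  shows "openin BC_top U \<longleftrightarrow> U \<subseteq> BC_space \<and> openin (subtopology euclidean BC_adm) (\<Union>U)"
proof -
  let ?L = "\<lambda>U. U \<subseteq> BC_space \<and> openin (subtopology euclidean (BC_adm :: 'd bcmat set)) (\<Union>U)"
  have "istopology ?L"
    unfolding istopology_def
  proof (intro conjI allI impI)
    fix S T :: "'d bcclass set" assume S: "?L S" and T: "?L T"
    show "S \<inter> T \<subseteq> BC_space" using S by blast
    have "\<Union>(S \<inter> T) = \<Union>S \<inter> \<Union>T"
    proof
      show "\<Union>S \<inter> \<Union>T \<subseteq> \<Union>(S \<inter> T)"
      proof
        fix x assume "x \<in> \<Union>S \<inter> \<Union>T"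
        then obtain c c' where h: "c \<in> S" "c' \<in> T" "x \<in> c" "x \<in> c'" by auto
        then have "c = c'" using S T quotient_disj[OF equiv_BC_rel, of c c'] unfolding BC_space_def by blast
        then show "x \<in> \<Union>(S \<inter> T)" using h by blast
      qed
    qed auto
    then show "openin (subtopology euclidean BC_adm) (\<Union>(S \<inter> T))" using S T by (simp add: openin_Int)
  next
    fix K :: "'d bcclass set set" assume K: "\<forall>S\<in>K. ?L S"
    then show "\<Union>K \<subseteq> BC_space" by blast
    have "\<Union>(\<Union>K) = (\<Union>S\<in>K. \<Union>S)" by auto
    also have "openin (subtopology euclidean BC_adm) \<dots>" using K by (intro openin_Union) auto
    finally show "openin (subtopology euclidean BC_adm) (\<Union>(\<Union>K))" .
  qed
  then show ?thesis unfolding BC_top_def by (simp add: topology_inverse')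
qed

text \<open>The projection to the quotient is open: the union of these classes is, within
  \<open>BC_adm\<close>, the union over invertible \<open>T\<close> of the preimages of one open set
  under left multiplication by \<open>T\<close>.\<close>

lemma openin_near_class:
  fixes A0 B0 :: "'d::finite cmat2"
  shows "openin BC_top {c \<in> BC_space. \<exists>A B. (A, B) \<in> c \<and> norm (A - A0) < \<delta> \<and> norm (B - B0) < \<delta>}" (is "openin BC_top ?U")
proof -
  let ?G = "\<lambda>T :: 'd cmat2. {(A :: 'd cmat2, B :: 'd cmat2). norm (T ** A - A0) < \<delta> \<and> norm (T ** B - B0) < \<delta>}"
  have op: "open (?G T)" for T :: "'d cmat2"
  proof -
    have lin: "linear (\<lambda>A :: 'd cmat2. T ** A)"
    proof (rule linearI)
      show "T ** (A + B) = T ** A + T ** B" for A B :: "'d cmat2" by (rule matrix_add_ldistrib)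
      show "T ** (r *\<^sub>R A) = r *\<^sub>R (T ** A)" for r and A :: "'d cmat2"
        by (simp add: vec_eq_iff matrix_matrix_mult_def scaleR_sum_right)
    qed
    have c: "continuous_on UNIV (\<lambda>x. T ** f x)" if "continuous_on UNIV f" for f :: "'d bcmat \<Rightarrow> 'd cmat2"
      by (rule bounded_linear.continuous_on[OF _ that]) (use lin in \<open>simp add: linear_conv_bounded_linear\<close>)
    have "open ({x. norm (T ** fst x - A0) < \<delta>} \<inter> {x. norm (T ** snd x - B0) < \<delta>})"
      by (intro open_Int open_Collect_less continuous_intros c)
    moreover have "?G T = {x. norm (T ** fst x - A0) < \<delta>} \<inter> {x. norm (T ** snd x - B0) < \<delta>}" by auto
    ultimately show ?thesis by simp
  qed
  have "\<Union>?U = BC_adm \<inter> (\<Union>T\<in>{T. invertible T}. ?G T)"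
  proof (intro equalityI subsetI)
    fix x assume "x \<in> \<Union>?U"
    then obtain c A B where h: "c \<in> BC_space" "x \<in> c" "(A, B) \<in> c" "norm (A - A0) < \<delta>" "norm (B - B0) < \<delta>" by auto
    obtain A1 B1 where x: "x = (A1, B1)" by (cases x)
    have "((A1, B1), (A, B)) \<in> BC_rel"
      using in_quotient_imp_in_rel[OF equiv_BC_rel] h x unfolding BC_space_def by blast
    then show "x \<in> BC_adm \<inter> (\<Union>T\<in>{T. invertible T}. ?G T)" using h x by (auto simp: BC_rel_def)
  next
    fix x assume x: "x \<in> BC_adm \<inter> (\<Union>T\<in>{T. invertible T}. ?G T)"
    obtain A1 B1 where AB: "x = (A1, B1)" by (cases x)
    obtain T where T: "invertible T" "norm (T ** A1 - A0) < \<delta>" "norm (T ** B1 - B0) < \<delta>" "(A1, B1) \<in> BC_adm"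
      using x AB by auto
    define c where "c = BC_rel `` {(A1, B1)}"
    have "c \<in> BC_space" unfolding c_def BC_space_def using T(4) by (rule quotientI)
    moreover have "(T ** A1, T ** B1) \<in> c"
      using T BC_adm_mult[OF T(4,1)] by (auto simp: c_def BC_rel_def)
    moreover have "x \<in> c" unfolding c_def AB using equiv_class_self[OF equiv_BC_rel T(4)] .
    ultimately show "x \<in> \<Union>?U" using T by blast
  qed
  moreover have "open (\<Union>T\<in>{T. invertible T}. ?G T)" by (rule open_UN) (rule ballI, rule op)
  ultimately have "openin (subtopology euclidean BC_adm) (\<Union>?U)"
    unfolding openin_open by (intro exI[of _ "\<Union>T\<in>{T. invertible T}. ?G T"]) simp
  then show ?thesis unfolding openin_BC_top by blast
qed

section \<open>Continuity on the layers\<close>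

lemma bounded_bilinear_mv: "bounded_bilinear (\<lambda>(M::real^'n::finite^'m::finite) (x::real^'n). M *v x)"
  unfolding bilinear_conv_bounded_bilinear[symmetric] bilinear_def
proof (intro conjI allI linearI)
  fix M N :: "real^'n^'m" and x y :: "real^'n" and r :: real
  show "(M + N) *v x = M *v x + N *v x" "M *v (x + y) = M *v x + M *v y"
    by (simp_all add: vec_eq_iff matrix_vector_mult_def distrib_right distrib_left sum.distrib)
  show "(r *\<^sub>R M) *v x = r *\<^sub>R (M *v x)" "M *v (r *\<^sub>R x) = r *\<^sub>R (M *v x)"
    by (simp_all add: vec_eq_iff matrix_vector_mult_def sum_distrib_left mult_ac)
qed

interpretation mv: bounded_bilinear "\<lambda>(M::real^'n::finite^'m::finite) (x::real^'n). M *v x"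
  by (rule bounded_bilinear_mv)

lemma Linf_ess_bounded:
  assumes "f \<in> Linf a b" shows "ess_bounded a b f"
proof -
  have f: "f \<in> borel_measurable (lebesgue_on {a..b})" "esssup (lebesgue_on {a..b}) (\<lambda>t. ereal (norm (f t))) < \<infinity>"
    using assms by (auto simp: Linf_def)
  obtain n :: nat where n: "esssup (lebesgue_on {a..b}) (\<lambda>t. ereal (norm (f t))) < ereal (real n)"
    using less_PInf_Ex_of_nat[THEN iffD1] f(2) by fastforce
  have "AE t in lebesgue_on {a..b}. norm (f t) \<le> real n"
    using esssup_AE[of "\<lambda>t. ereal (norm (f t))" "lebesgue_on {a..b}"]
  proof eventually_elim
    case (elim t)
    then have "ereal (norm (f t)) \<le> ereal (real n)" using n by (meson less_imp_le order_trans)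
    then show ?case by simp
  qed
  then show ?thesis by (rule ess_boundedI[OF f(1)])
qed

lemma Linf_dist_less_AE:
  assumes "Linf_dist a b f g < ereal e" shows "AE t in lebesgue_on {a..b}. norm (g t - f t) \<le> e"
  using esssup_AE[of "\<lambda>t. ereal (norm (f t - g t))" "lebesgue_on {a..b}"]
proof eventually_elim
  case (elim t)
  then have "ereal (norm (f t - g t)) \<le> ereal e"
    using assms unfolding Linf_dist_def by (meson less_imp_le order_trans)
  then show ?case by (simp add: norm_minus_commute)
qed

lemma Linf_dist_self: "e > 0 \<Longrightarrow> Linf_dist a b f f < ereal e"
  unfolding Linf_dist_def
  by (rule le_less_trans[of _ 0]) (auto intro!: esssup_I simp: zero_ereal_def)

lemma openin_Linf_ball:
  "f \<in> Linf a b \<Longrightarrow> e > 0 \<Longrightarrow> openin (Linf_top a b) {g \<in> Linf a b. Linf_dist a b f g < ereal e}"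
  unfolding Linf_top_def by (rule topology_generated_by_Basis) blast

text \<open>A representative belongs to the data because the matrices of a class are determined only
  up to a left factor; norms make sense only after one is chosen near
  \<open>(A0, B0)\<close>.\<close>

definition near_bvp where
  "near_bvp a b k P0 Q0 W0 A0 B0 h P Q W c A B \<longleftrightarrow> (P, Q, W) \<in> Omega a b \<and>
     (AE t in lebesgue_on {a..b}. norm (P t - P0 t) \<le> h \<and> norm (Q t - Q0 t) \<le> h \<and> norm (W t - W0 t) \<le> h) \<and>
     c \<in> Sigma_layer k \<and> (A, B) \<in> c \<and> norm (A - A0) < h \<and> norm (B - B0) < h"

lemma norm_triangle_via:
  fixes x y z :: "'x::real_normed_vector"
  assumes "norm (x - z) \<le> h" "norm (y - z) \<le> h" shows "norm (x - y) \<le> 2 * h"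
  using norm_triangle_ineq4[of "x - z" "y - z"] assms by simp

text \<open>The constants are taken from the centre with some slack: half of its coercivity, its
  coefficient bounds enlarged by \<open>1\<close>, and the bounds of
  \<open>boundary_uniform\<close>.\<close>

lemma near_bvp_uniform:
  fixes P0 Q0 W0 :: "real \<Rightarrow> real^'d::finite^'d" and A0 B0 :: "'d cmat2"
  assumes ab: "a < b" and om: "(P0, Q0, W0) \<in> Omega a b" and n0: "n0 B0 = k"
  obtains h0 \<mu> C \<kappa> where "h0 > 0" "\<kappa> > 0"
    "\<And>h P Q W c A B. h \<le> h0 \<Longrightarrow> near_bvp a b k P0 Q0 W0 A0 B0 h P Q W c A B \<Longrightarrow> sl_bvp a b P Q W A B \<mu> C c"
    "\<And>h P Q W c A B P' Q' W' c' A' B'. 0 < h \<Longrightarrow> h \<le> h0 \<Longrightarrow> near_bvp a b k P0 Q0 W0 A0 B0 h P Q W c A B \<Longrightarrow>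
      near_bvp a b k P0 Q0 W0 A0 B0 h P' Q' W' c' A' B' \<Longrightarrow>
      \<exists>\<tau>. sl_pair a b P Q W (Vbc B) (\<beta>bc A B) P' Q' W' (Vbc B') (\<beta>bc A' B') \<mu> C (\<kappa> * h) \<tau>"
proof -
  obtain \<delta> Cb Kb where \<delta>: "\<delta> > 0" and Cb: "Cb > 0" and Kb: "Kb > 0"
    and sec: "\<And>A B Y. norm (A - A0) < \<delta> \<Longrightarrow> norm (B - B0) < \<delta> \<Longrightarrow> n0 B = n0 B0 \<Longrightarrow> Y \<in> Vbc B \<Longrightarrow>
      \<exists>z. adjm B *v z = Y \<and> norm (adjm A *v z) \<le> Cb * norm Y"
    and tr: "\<And>A B A' B' d. norm (A - A0) < \<delta> \<Longrightarrow> norm (B - B0) < \<delta> \<Longrightarrow> n0 B = n0 B0 \<Longrightarrow> (A, B) \<in> BC_adm \<Longrightarrow>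
      norm (A' - A0) < \<delta> \<Longrightarrow> norm (B' - B0) < \<delta> \<Longrightarrow> n0 B' = n0 B0 \<Longrightarrow> (A', B') \<in> BC_adm \<Longrightarrow>
      norm (A - A') \<le> d \<Longrightarrow> norm (B - B') \<le> d \<Longrightarrow>
      \<exists>\<tau>. (\<forall>Z\<in>Vbc B'. \<tau> Z \<in> Vbc B) \<and> (\<forall>Y\<in>Vbc B'. \<forall>Z\<in>Vbc B'. \<tau> (Y + Z) = \<tau> Y + \<tau> Z) \<and>
        (\<forall>c. \<forall>Z\<in>Vbc B'. \<tau> (c *s Z) = c *s \<tau> Z) \<and> (\<forall>Z\<in>Vbc B'. norm (\<tau> Z - Z) \<le> Kb * d * norm Z) \<and>
        (\<forall>Z\<in>Vbc B'. \<bar>\<beta>bc A B (\<tau> Z) (\<tau> Z) - \<beta>bc A' B' Z Z\<bar> \<le> Kb * d * (norm Z)\<^sup>2)"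
    by (rule boundary_uniform[of A0 B0]) (rule that; assumption)
  obtain Kc where Kc: "Kc > 0" "\<And>(M :: real^'d^'d) x. norm (cm M *v x) \<le> norm M * norm x * Kc"
    using cm.pos_bounded by blast
  obtain Kr where Kr: "Kr > 0" "\<And>(M :: real^'d^'d) x. norm (M *v x) \<le> norm M * norm x * Kr"
    using mv.pos_bounded by blast
  have L0: "P0 \<in> Linf a b" "Q0 \<in> Linf a b" "W0 \<in> Linf a b" using om by (auto simp: Omega_def)
  obtain C1 C2 C3 where C0: "AE t in lebesgue_on {a..b}. norm (P0 t) \<le> C1"
    "AE t in lebesgue_on {a..b}. norm (Q0 t) \<le> C2" "AE t in lebesgue_on {a..b}. norm (W0 t) \<le> C3"
    using L0[THEN Linf_ess_bounded] unfolding ess_bounded_def by blast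
  obtain \<mu>1 \<mu>2 where \<mu>12: "\<mu>1 > 0" "\<mu>2 > 0"
    "AE t in lebesgue_on {a..b}. \<forall>x::real^'d. \<mu>1 * (x \<bullet> x) \<le> x \<bullet> (P0 t *v x)"
    "AE t in lebesgue_on {a..b}. \<forall>x::real^'d. \<mu>2 * (x \<bullet> x) \<le> x \<bullet> (W0 t *v x)"
    using om by (auto simp: Omega_def)
  define \<mu> where "\<mu> = min \<mu>1 \<mu>2 / 2"
  define N where "N = \<bar>C1\<bar> + \<bar>C2\<bar> + \<bar>C3\<bar> + 1"
  define C where "C = Kc * N + Cb"
  \<comment> \<open>Two problems within \<open>h\<close> of the centre are within
    \<open>2 * h\<close> of each other, hence the factors \<open>2\<close>.\<close>
  define \<kappa> where "\<kappa> = 2 * Kc + 2 * Kb"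
  \<comment> \<open>The four bounds secure, in this order, \<open>boundary_uniform\<close>,
    coefficient norms at most \<open>1\<close> larger, half of the coercivity, and
    \<open>\<kappa> * h \<le> 1\<close>.\<close>
  define h0 where "h0 = min (min \<delta> 1) (min (\<mu> / Kr) (1 / \<kappa>))"
  have N: "N > 0" by (simp add: N_def add_nonneg_pos)
  have pos: "\<mu> > 0" "C > 0" "\<kappa> > 0" using \<mu>12 Kc Cb Kb N by (auto simp: \<mu>_def C_def \<kappa>_def intro!: add_pos_pos)
  have h0: "h0 > 0" "h0 \<le> \<delta>" "h0 \<le> 1" "Kr * h0 \<le> \<mu>" "\<kappa> * h0 \<le> 1"
  proof -
    have "h0 \<le> \<mu> / Kr" "h0 \<le> 1 / \<kappa>" unfolding h0_def by linarith+
    then show "Kr * h0 \<le> \<mu>" "\<kappa> * h0 \<le> 1" using Kr pos by (simp_all add: field_simps)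
  qed (use \<delta> Kr pos in \<open>auto simp: h0_def\<close>)
  have coer: "\<mu> * (x \<bullet> x) \<le> x \<bullet> (M *v x)"
    if m: "\<mu>' * (x \<bullet> x) \<le> x \<bullet> (M0 *v x)" "2 * \<mu> \<le> \<mu>'" "norm (M - M0) \<le> h0" for M M0 :: "real^'d^'d" and x \<mu>'
  proof -
    have "norm ((M - M0) *v x) \<le> norm (M - M0) * norm x * Kr" by (rule Kr(2))
    also have "\<dots> \<le> h0 * norm x * Kr" using m(3) Kr(1) by (intro mult_right_mono) auto
    also have "\<dots> = Kr * h0 * norm x" by simp
    also have "\<dots> \<le> \<mu> * norm x" using h0(4) by (rule mult_right_mono) simp
    finally have "norm x * norm ((M - M0) *v x) \<le> norm x * (\<mu> * norm x)" by (rule mult_left_mono) simp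
    then have "norm x * norm ((M - M0) *v x) \<le> \<mu> * (x \<bullet> x)"
      by (simp add: power2_norm_eq_inner[symmetric] power2_eq_square mult_ac)
    moreover have "\<bar>x \<bullet> ((M - M0) *v x)\<bar> \<le> norm x * norm ((M - M0) *v x)" by (rule Cauchy_Schwarz_ineq2)
    moreover have "x \<bullet> ((M - M0) *v x) = x \<bullet> (M *v x) - x \<bullet> (M0 *v x)" by (simp add: mv.diff_left inner_diff_right)
    moreover have "2 * \<mu> * (x \<bullet> x) \<le> \<mu>' * (x \<bullet> x)" using m(2) by (intro mult_right_mono) auto
    ultimately show ?thesis using m(1) by linarith
  qed
  have bnd: "norm (cm M *v x) \<le> C * norm x"
    if m: "norm M0 \<le> N - 1" "norm (M - M0) \<le> h0" for M M0 :: "real^'d^'d" and x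
  proof -
    have "norm M \<le> N" using norm_triangle_ineq2[of M M0] m h0(3) by linarith
    then have "norm M * (norm x * Kc) \<le> N * (norm x * Kc)" using Kc(1) by (intro mult_right_mono) auto
    moreover have "Kc * N * norm x \<le> C * norm x" using Cb by (intro mult_right_mono) (auto simp: C_def)
    ultimately show ?thesis using Kc(2)[of M x] by (simp add: mult_ac)
  qed
  have 1: "sl_bvp a b P Q W A B \<mu> C c" if h: "h \<le> h0" and nr: "near_bvp a b k P0 Q0 W0 A0 B0 h P Q W c A B" for h P Q W c A B
  proof -
    have o: "P \<in> Linf a b" "Q \<in> Linf a b" "W \<in> Linf a b"
      and sym: "AE t in lebesgue_on {a..b}. transpose (P t) = P t \<and> transpose (Q t) = Q t \<and> transpose (W t) = W t"
      using nr by (auto simp: near_bvp_def Omega_def)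
    have cl: "AE t in lebesgue_on {a..b}. norm (P t - P0 t) \<le> h0 \<and> norm (Q t - Q0 t) \<le> h0 \<and> norm (W t - W0 t) \<le> h0"
    proof -
      have "AE t in lebesgue_on {a..b}. norm (P t - P0 t) \<le> h \<and> norm (Q t - Q0 t) \<le> h \<and> norm (W t - W0 t) \<le> h"
        using nr by (simp add: near_bvp_def)
      then show ?thesis by eventually_elim (use h in auto)
    qed
    have cs: "c \<in> Sigma_layer k" "(A, B) \<in> c" "norm (A - A0) < \<delta>" "norm (B - B0) < \<delta>"
      using nr h h0(2) by (auto simp: near_bvp_def)
    have cb: "c \<in> BC_space" using cs(1) by (simp add: Sigma_layer_def)
    have pos': "AE t in lebesgue_on {a..b}. (\<forall>x::real^'d. \<mu> * (x \<bullet> x) \<le> x \<bullet> (P t *v x)) \<and>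
      (\<forall>x::real^'d. \<mu> * (x \<bullet> x) \<le> x \<bullet> (W t *v x))"
      using \<mu>12(3,4) cl
    proof eventually_elim
      case (elim t)
      show ?case
      proof (intro conjI allI)
        fix x :: "real^'d"
        show "\<mu> * (x \<bullet> x) \<le> x \<bullet> (P t *v x)" by (rule coer[where \<mu>' = \<mu>1 and ?M0.0 = "P0 t"]) (use elim in \<open>auto simp: \<mu>_def\<close>)
        show "\<mu> * (x \<bullet> x) \<le> x \<bullet> (W t *v x)" by (rule coer[where \<mu>' = \<mu>2 and ?M0.0 = "W0 t"]) (use elim in \<open>auto simp: \<mu>_def\<close>)
      qed
    qed
    have bnd': "AE t in lebesgue_on {a..b}. \<forall>x::complex^'d. norm (cm (P t) *v x) \<le> C * norm x \<and>
      norm (cm (Q t) *v x) \<le> C * norm x \<and> norm (cm (W t) *v x) \<le> C * norm x"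
      using C0 cl
    proof eventually_elim
      case (elim t)
      have "norm (P0 t) \<le> N - 1" "norm (Q0 t) \<le> N - 1" "norm (W0 t) \<le> N - 1" using elim by (auto simp: N_def)
      then show ?case using elim by (intro allI conjI bnd; blast)
    qed
    have "\<exists>z. adjm B *v z = Y \<and> norm (adjm A *v z) \<le> C * norm Y" if Y: "Y \<in> Vbc B" for Y
    proof -
      obtain z where z: "adjm B *v z = Y" "norm (adjm A *v z) \<le> Cb * norm Y"
        using sec[OF cs(3,4) _ Y] n0_class[OF cs(1,2)] n0 by auto
      have "Cb * norm Y \<le> C * norm Y" using Kc(1) N by (intro mult_right_mono) (auto simp: C_def)
      then show ?thesis using z by force
    qed
    note * = sl_form_bc[OF ab pos(1,2) o[THEN Linf_ess_bounded] sym pos' bnd' class_adm[OF cb cs(2)] this]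
    show ?thesis by (intro sl_bvp.intro * sl_bvp_axioms.intro cb cs(2))
  qed
  have 2: "\<exists>\<tau>. sl_pair a b P Q W (Vbc B) (\<beta>bc A B) P' Q' W' (Vbc B') (\<beta>bc A' B') \<mu> C (\<kappa> * h) \<tau>"
    if hp: "0 < h" and h: "h \<le> h0" and nr: "near_bvp a b k P0 Q0 W0 A0 B0 h P Q W c A B"
      and nr': "near_bvp a b k P0 Q0 W0 A0 B0 h P' Q' W' c' A' B'" for h P Q W c A B P' Q' W' c' A' B'
  proof -
    interpret X: sl_bvp a b P Q W A B \<mu> C c by (rule 1[OF h nr])
    interpret Y: sl_bvp a b P' Q' W' A' B' \<mu> C c' by (rule 1[OF h nr'])
    have cs: "c \<in> Sigma_layer k" "(A, B) \<in> c" "norm (A - A0) < h" "norm (B - B0) < h"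
      "c' \<in> Sigma_layer k" "(A', B') \<in> c'" "norm (A' - A0) < h" "norm (B' - B0) < h"
      using nr nr' by (auto simp: near_bvp_def)
    have dl: "norm (A - A0) < \<delta>" "norm (B - B0) < \<delta>" "norm (A' - A0) < \<delta>" "norm (B' - B0) < \<delta>"
      using cs h h0(2) by auto
    have nn: "n0 B = n0 B0" "n0 B' = n0 B0" using n0_class[OF cs(1,2)] n0_class[OF cs(5,6)] n0 by auto
    have dd: "norm (A - A') \<le> 2 * h" "norm (B - B') \<le> 2 * h"
      by (rule norm_triangle_via[of _ A0] norm_triangle_via[of _ B0]; use cs in simp)+
    obtain \<tau> where \<tau>: "\<forall>Z\<in>Vbc B'. \<tau> Z \<in> Vbc B" "\<forall>Y\<in>Vbc B'. \<forall>Z\<in>Vbc B'. \<tau> (Y + Z) = \<tau> Y + \<tau> Z"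
        "\<forall>c. \<forall>Z\<in>Vbc B'. \<tau> (c *s Z) = c *s \<tau> Z" "\<forall>Z\<in>Vbc B'. norm (\<tau> Z - Z) \<le> Kb * (2 * h) * norm Z"
        "\<forall>Z\<in>Vbc B'. \<bar>\<beta>bc A B (\<tau> Z) (\<tau> Z) - \<beta>bc A' B' Z Z\<bar> \<le> Kb * (2 * h) * (norm Z)\<^sup>2"
      using tr[OF dl(1,2) nn(1) X.adm dl(3,4) nn(2) Y.adm dd] by blast
    have kb: "Kb * (2 * h) \<le> \<kappa> * h" "2 * Kc * h \<le> \<kappa> * h"
      using Kb Kc(1) hp by (auto simp: \<kappa>_def algebra_simps)
    have \<kappa>h: "0 < \<kappa> * h" "\<kappa> * h \<le> 1"
      using mult_pos_pos[OF pos(3) hp] h0(5) mult_left_mono[OF h less_imp_le[OF pos(3)]] by linarith+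
    have cd: "norm (cm M *v x - cm M' *v x) \<le> \<kappa> * h * norm x"
      if "norm (M - M0) \<le> h" "norm (M' - M0) \<le> h" for M M' M0 :: "real^'d^'d" and x
    proof -
      have "norm (cm M *v x - cm M' *v x) = norm (cm (M - M') *v x)" by (simp add: cm.diff_left)
      also have "\<dots> \<le> norm (M - M') * (norm x * Kc)" using Kc(2) by (simp add: mult_ac)
      also have "\<dots> \<le> 2 * h * (norm x * Kc)"
        using norm_triangle_via[OF that] Kc(1) by (intro mult_right_mono) auto
      also have "\<dots> = 2 * Kc * h * norm x" by simp
      also have "\<dots> \<le> \<kappa> * h * norm x" using kb(2) by (rule mult_right_mono) simp
      finally show ?thesis .
    qed
    have cl: "AE t in lebesgue_on {a..b}. norm (P t - P0 t) \<le> h \<and> norm (Q t - Q0 t) \<le> h \<and> norm (W t - W0 t) \<le> h"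
      "AE t in lebesgue_on {a..b}. norm (P' t - P0 t) \<le> h \<and> norm (Q' t - Q0 t) \<le> h \<and> norm (W' t - W0 t) \<le> h"
      using nr nr' by (simp_all add: near_bvp_def)
    have close: "AE t in lebesgue_on {a..b}. \<forall>x::complex^'d. norm (cm (P t) *v x - cm (P' t) *v x) \<le> \<kappa> * h * norm x \<and>
      norm (cm (Q t) *v x - cm (Q' t) *v x) \<le> \<kappa> * h * norm x \<and> norm (cm (W t) *v x - cm (W' t) *v x) \<le> \<kappa> * h * norm x"
      using cl
    proof eventually_elim
      case (elim t)
      then show ?case by (intro allI conjI cd; blast)
    qed
    have "norm (\<tau> Z - Z) \<le> \<kappa> * h * norm Z" "\<bar>\<beta>bc A B (\<tau> Z) (\<tau> Z) - \<beta>bc A' B' Z Z\<bar> \<le> \<kappa> * h * (norm Z)\<^sup>2"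
      if "Z \<in> Vbc B'" for Z
      using \<tau>(4,5) that mult_right_mono[OF kb(1), of "norm Z"] mult_right_mono[OF kb(1), of "(norm Z)\<^sup>2"]
      by (meson norm_ge_zero zero_le_power2 order_trans)+
    note b = this
    have "sl_pair a b P Q W (Vbc B) (\<beta>bc A B) P' Q' W' (Vbc B') (\<beta>bc A' B') \<mu> C (\<kappa> * h) \<tau>"
      apply (intro sl_pair.intro sl_pair_axioms.intro X.sl_form_axioms Y.sl_form_axioms \<kappa>h close b)
      using \<tau>(1,2,3) by blast+
    then show ?thesis by blast
  qed
  show ?thesis by (rule that[OF h0(1) pos(3) 1 2])
qed

section \<open>The eigenvalue as an infimum\<close>

context sl_bvp
begin

text \<open>As \<open>n \<ge> 1\<close>, the test space contains a nonzero function, whose Rayleigh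
  quotient is at least \<open>- (cL / \<mu>)\<close>.\<close>

lemma count_bounded:
  assumes n: "n \<ge> 1" and lam: "n \<le> count_ev a b (P, Q, W) c lam" shows "- (cL / \<mu>) \<le> lam"
proof -
  obtain Bs where Bs: "FP.below lam Bs" "card Bs = n" using lam unfolding count_iff by blast
  then have "Bs \<noteq> {}" using n by auto
  then obtain y where y: "y \<in> Bs" by blast
  have h: "Bs \<subseteq> D" "fs.independent Bs" "\<forall>y\<in>fs.span Bs. q y y \<le> lam * w y y" using Bs(1) unfolding FP.below_def by auto
  have yD: "y \<in> D" using y h(1) by blast
  have "y \<noteq> 0" using y h(2) fs.dependent_zero by blast
  then have w: "w y y > 0" using w_positive[OF yD] by blast
  have "- (cL / \<mu>) * w y y \<le> lam * w y y"
    using q_bounded_below[OF yD] h(3) fs.span_base[OF y] by (meson order_trans)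
  then show ?thesis using w mult_right_le_imp_le by blast
qed

text \<open>These two facts give the real \<open>Inf\<close> in \<open>eig_n\<close> its usual
  meaning.\<close>

lemma count_set:
  assumes "n \<ge> 1"
  shows "{lam. n \<le> count_ev a b (P, Q, W) c lam} \<noteq> {}" "bdd_below {lam. n \<le> count_ev a b (P, Q, W) c lam}"
proof -
  obtain Bs where "Bs \<subseteq> D" "fs.independent Bs" "finite Bs" "card Bs = n" using infinite_dimensional by blast
  then show "{lam. n \<le> count_ev a b (P, Q, W) c lam} \<noteq> {}" using FP.finite_dim_below unfolding count_iff by blast
  show "bdd_below {lam. n \<le> count_ev a b (P, Q, W) c lam}"
    using count_bounded[OF assms] by (intro bdd_belowI) blast
qed

end

text \<open>Some \<open>lam\<close> within \<open>\<epsilon>\<close> of the infimum of the primed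
  problem is admissible there, and its transfer costs another \<open>\<epsilon>\<close>. It is
  chosen below \<open>\<Lambda>\<close>, the range in which \<open>small\<close> controls the
  loss.\<close>

lemma eig_n_transfer:
  fixes P Q W P' Q' W' :: "real \<Rightarrow> real^'d::finite^'d"
  assumes X: "sl_bvp a b P Q W A B \<mu> C c" and Y: "sl_bvp a b P' Q' W' A' B' \<mu> C c'"
    and XY: "sl_pair a b P Q W (Vbc B) (\<beta>bc A B) P' Q' W' (Vbc B') (\<beta>bc A' B') \<mu> C \<eta> \<tau>"
    and n: "n \<ge> 1" and less: "eig_n a b n (P', Q', W') c' < \<Lambda>" and \<Lambda>: "0 \<le> \<Lambda>" and \<epsilon>: "\<epsilon> > 0"
    and small: "\<eta> * (K3 a b C * (sl_form.c1 \<mu> * \<Lambda> + sl_form.c2 a b \<mu> C) * (1 + \<Lambda> + sl_form.cL a b \<mu> C / \<mu> + \<epsilon>)) < min \<epsilon> 1"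
  shows "eig_n a b n (P, Q, W) c \<le> eig_n a b n (P', Q', W') c' + 2 * \<epsilon>"
proof -
  interpret X: sl_bvp a b P Q W A B \<mu> C c by (rule X)
  interpret Y: sl_bvp a b P' Q' W' A' B' \<mu> C c' by (rule Y)
  interpret XY: sl_pair a b P Q W "Vbc B" "\<beta>bc A B" P' Q' W' "Vbc B'" "\<beta>bc A' B'" \<mu> C \<eta> \<tau> by (rule XY)
  have "eig_n a b n (P', Q', W') c' < min \<Lambda> (eig_n a b n (P', Q', W') c' + \<epsilon>)" using less \<epsilon> by simp
  from cInf_lessD[OF Y.count_set(1)[OF n] this[unfolded eig_n_def]]
  obtain lam where lam: "n \<le> count_ev a b (P', Q', W') c' lam" "lam < \<Lambda>" "lam < eig_n a b n (P', Q', W') c' + \<epsilon>"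
    by (auto simp: eig_n_def)
  obtain Bs where Bs: "Y.FP.below lam Bs" "card Bs = n" using lam(1) unfolding Y.count_iff by blast
  obtain Bs' where "X.FP.below (lam + \<epsilon>) Bs'" "card Bs' = card Bs"
    using XY.below_transfer[OF less_imp_le[OF lam(2)] \<Lambda> \<epsilon> small[folded mult.assoc] Bs(1)] by blast
  then have "n \<le> count_ev a b (P, Q, W) c (lam + \<epsilon>)" using Bs(2) unfolding X.count_iff by blast
  then have "eig_n a b n (P, Q, W) c \<le> lam + \<epsilon>"
    unfolding eig_n_def using X.count_set(2)[OF n] by (intro cInf_lower) auto
  then show ?thesis using lam(3) by simp
qed

lemma eig_n_near:
  fixes P0 Q0 W0 :: "real \<Rightarrow> real^'d::finite^'d" and A0 B0 :: "'d cmat2"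
  assumes ab: "a < b" and n: "n \<ge> 1" and om: "(P0, Q0, W0) \<in> Omega a b"
    and c0: "c0 \<in> Sigma_layer k" "(A0, B0) \<in> c0" and \<epsilon>: "\<epsilon> > 0"
  obtains h where "h > 0" "\<And>P Q W c A B. near_bvp a b k P0 Q0 W0 A0 B0 h P Q W c A B \<Longrightarrow>
    \<bar>eig_n a b n (P, Q, W) c - eig_n a b n (P0, Q0, W0) c0\<bar> < \<epsilon>"
proof -
  obtain h0 \<mu> C \<kappa> where h0: "h0 > 0" and \<kappa>: "\<kappa> > 0"
    and bvp: "\<And>h P Q W c A B. h \<le> h0 \<Longrightarrow> near_bvp a b k P0 Q0 W0 A0 B0 h P Q W c A B \<Longrightarrow> sl_bvp a b P Q W A B \<mu> C c"
    and pair: "\<And>h P Q W c A B P' Q' W' c' A' B'. 0 < h \<Longrightarrow> h \<le> h0 \<Longrightarrow> near_bvp a b k P0 Q0 W0 A0 B0 h P Q W c A B \<Longrightarrow>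
      near_bvp a b k P0 Q0 W0 A0 B0 h P' Q' W' c' A' B' \<Longrightarrow>
      \<exists>\<tau>. sl_pair a b P Q W (Vbc B) (\<beta>bc A B) P' Q' W' (Vbc B') (\<beta>bc A' B') \<mu> C (\<kappa> * h) \<tau>"
    by (rule near_bvp_uniform[OF ab om n0_class[OF c0], of A0]) (rule that; assumption)
  define e0 where "e0 = eig_n a b n (P0, Q0, W0) c0"
  \<comment> \<open>Large enough for both directions, because the nearby eigenvalue turns out to be
    less than \<open>e0 + 1\<close>.\<close>
  define \<Lambda> where "\<Lambda> = \<bar>e0\<bar> + 2"
  define \<epsilon>' where "\<epsilon>' = min \<epsilon> 1 / 4"
  define K where "K = K3 a b C * (sl_form.c1 \<mu> * \<Lambda> + sl_form.c2 a b \<mu> C) * (1 + \<Lambda> + sl_form.cL a b \<mu> C / \<mu> + \<epsilon>')"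
  \<comment> \<open>Designed for \<open>\<kappa> * h * K < min \<epsilon>' 1\<close>;
    \<open>|K|\<close> and the summand \<open>1\<close> avoid any discussion of the sign of
    \<open>K\<close>.\<close>
  define h where "h = min h0 (min \<epsilon>' 1 / (2 * (\<kappa> * \<bar>K\<bar> + 1)))"
  have \<epsilon>': "\<epsilon>' > 0" "2 * \<epsilon>' < \<epsilon>" "2 * \<epsilon>' < 1" using \<epsilon> by (auto simp: \<epsilon>'_def)
  have d: "\<kappa> * \<bar>K\<bar> + 1 > 0" using \<kappa> by (simp add: add_nonneg_pos)
  then have h: "h > 0" "h \<le> h0" using h0 \<epsilon>' by (auto simp: h_def)
  have small: "\<kappa> * h * K < min \<epsilon>' 1"
  proof -
    have "\<kappa> * h * K \<le> \<kappa> * h * \<bar>K\<bar>" using \<kappa> h by (intro mult_left_mono) auto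
    also have "\<dots> \<le> h * (\<kappa> * \<bar>K\<bar> + 1)" using h by (simp add: algebra_simps)
    also have "\<dots> \<le> min \<epsilon>' 1 / (2 * (\<kappa> * \<bar>K\<bar> + 1)) * (\<kappa> * \<bar>K\<bar> + 1)"
      using d by (intro mult_right_mono) (auto simp: h_def)
    also have "\<dots> = min \<epsilon>' 1 / 2" using d by (simp add: field_simps)
    also have "\<dots> < min \<epsilon>' 1" using \<epsilon>' by simp
    finally show ?thesis .
  qed
  have nr0: "near_bvp a b k P0 Q0 W0 A0 B0 h P0 Q0 W0 c0 A0 B0"
    using om c0 h by (simp add: near_bvp_def)
  show thesis
  proof (rule that[OF h(1)])
    fix P Q W c A B assume nr: "near_bvp a b k P0 Q0 W0 A0 B0 h P Q W c A B"
    obtain \<tau> where \<tau>: "sl_pair a b P Q W (Vbc B) (\<beta>bc A B) P0 Q0 W0 (Vbc B0) (\<beta>bc A0 B0) \<mu> C (\<kappa> * h) \<tau>"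
      using pair[OF h nr nr0] by blast
    obtain \<tau>' where \<tau>': "sl_pair a b P0 Q0 W0 (Vbc B0) (\<beta>bc A0 B0) P Q W (Vbc B) (\<beta>bc A B) \<mu> C (\<kappa> * h) \<tau>'"
      using pair[OF h nr0 nr] by blast
    have \<Lambda>0: "0 \<le> \<Lambda>" "e0 < \<Lambda>" by (auto simp: \<Lambda>_def)
    have 1: "eig_n a b n (P, Q, W) c \<le> e0 + 2 * \<epsilon>'"
      unfolding e0_def
      by (rule eig_n_transfer[OF bvp[OF h(2) nr] bvp[OF h(2) nr0] \<tau> n \<Lambda>0(2)[unfolded e0_def] \<Lambda>0(1) \<epsilon>'(1) small[unfolded K_def]])
    then have less: "eig_n a b n (P, Q, W) c < \<Lambda>" using \<epsilon>' by (simp add: \<Lambda>_def)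
    \<comment> \<open>The opposite direction needs the nearby eigenvalue below
      \<open>\<Lambda>\<close>, which the first direction has provided.\<close>
    have 2: "e0 \<le> eig_n a b n (P, Q, W) c + 2 * \<epsilon>'"
      unfolding e0_def
      by (rule eig_n_transfer[OF bvp[OF h(2) nr0] bvp[OF h(2) nr] \<tau>' n less \<Lambda>0(1) \<epsilon>'(1) small[unfolded K_def]])
    show "\<bar>eig_n a b n (P, Q, W) c - eig_n a b n (P0, Q0, W0) c0\<bar> < \<epsilon>"
      using 1 2 \<epsilon>' unfolding e0_def[symmetric] by linarith
  qed
qed

theorem theorem6p1:
  fixes a b :: real and n k :: nat
  assumes "a < b" and "CARD('d::finite) \<ge> 2" and "n \<ge> 1" and "k \<le> 2 * CARD('d)"
  shows "continuous_map
           (prod_topology (Omega_top a b :: 'd coef topology) (subtopology BC_top (Sigma_layer k)))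
           euclideanreal (\<lambda>(\<omega>, c). eig_n a b n \<omega> c)"
  unfolding Met_TC.continuous_map_to_metric[where 'a = real, simplified]
proof (intro ballI allI impI)
  fix x :: "'d coef \<times> 'd bcclass" and \<epsilon> :: real
  assume x: "x \<in> topspace (prod_topology (Omega_top a b) (subtopology BC_top (Sigma_layer k)))" and \<epsilon>: "\<epsilon> > 0"
  obtain P0 Q0 W0 c0 where xe: "x = ((P0, Q0, W0), c0)" by (metis prod.exhaust)
  have om: "(P0, Q0, W0) \<in> Omega a b" and c0: "c0 \<in> Sigma_layer k"
    using x by (auto simp: xe Omega_top_def topspace_subtopology)
  have L: "P0 \<in> Linf a b" "Q0 \<in> Linf a b" "W0 \<in> Linf a b" using om by (auto simp: Omega_def)
  obtain A0 B0 where AB: "(A0, B0) \<in> c0" using c0 by (auto simp: Sigma_layer_def)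
  obtain h where h: "h > 0" and eig: "\<And>P Q W c A B. near_bvp a b k P0 Q0 W0 A0 B0 h P Q W c A B \<Longrightarrow>
    \<bar>eig_n a b n (P, Q, W) c - eig_n a b n (P0, Q0, W0) c0\<bar> < \<epsilon>"
    using eig_n_near[OF assms(1,3) om c0 AB \<epsilon>] by metis
  define nb where "nb = (\<lambda>f. {g \<in> Linf a b. Linf_dist a b (f :: real \<Rightarrow> 'd rmat) g < ereal h})"
  define N where "N = {c \<in> BC_space. \<exists>A B. (A, B) \<in> c \<and> norm (A - A0) < h \<and> norm (B - B0) < h}"
  \<comment> \<open>A basic neighbourhood on which \<open>near_bvp\<close> holds:
    \<open>L^\<infinity>\<close> balls for the coefficients, and classes in the layer with a
    representative near \<open>(A0, B0)\<close>.\<close>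
  define U where "U = (Omega a b \<inter> (nb P0 \<times> nb Q0 \<times> nb W0)) \<times> (Sigma_layer k \<inter> N)"
  have ob: "openin (Linf_top a b) (nb f)" if "f \<in> Linf a b" for f
    unfolding nb_def by (rule openin_Linf_ball[OF that h])
  have "openin (prod_topology (Omega_top a b) (subtopology BC_top (Sigma_layer k))) U"
    unfolding U_def Omega_top_def N_def
    by (intro openin_prod_Times_iff[THEN iffD2] disjI2 conjI openin_subtopology_Int2 ob L openin_near_class)
  moreover have "x \<in> U"
  proof -
    have "f \<in> nb f" if "f \<in> Linf a b" for f
      unfolding nb_def using that Linf_dist_self[OF h] by simp
    moreover have "c0 \<in> N" unfolding N_def using c0 AB h by (simp add: Sigma_layer_def) (metis norm_zero right_minus_eq)
    ultimately show ?thesis using L om c0 by (simp add: U_def xe)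
  qed
  moreover have "dist (eig_n a b n (P0, Q0, W0) c0) (eig_n a b n (P, Q, W) c) < \<epsilon>" if y: "((P, Q, W), c) \<in> U" for P Q W c
  proof -
    obtain A B where AB: "(A, B) \<in> c" "norm (A - A0) < h" "norm (B - B0) < h"
      using y by (auto simp: U_def N_def)
    have "AE t in lebesgue_on {a..b}. norm (P t - P0 t) \<le> h" "AE t in lebesgue_on {a..b}. norm (Q t - Q0 t) \<le> h"
      "AE t in lebesgue_on {a..b}. norm (W t - W0 t) \<le> h"
      by (rule Linf_dist_less_AE; use y in \<open>simp add: U_def nb_def\<close>)+
    then have "AE t in lebesgue_on {a..b}. norm (P t - P0 t) \<le> h \<and> norm (Q t - Q0 t) \<le> h \<and> norm (W t - W0 t) \<le> h"
      by eventually_elim blast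
    then have "near_bvp a b k P0 Q0 W0 A0 B0 h P Q W c A B"
      using y AB by (simp add: near_bvp_def U_def)
    then show ?thesis using eig[of P Q W c A B] unfolding dist_real_def by linarith
  qed
  ultimately show "\<exists>U. openin (prod_topology (Omega_top a b) (subtopology BC_top (Sigma_layer k))) U \<and> x \<in> U \<and>
      (\<forall>y\<in>U. dist (case x of (\<omega>, c) \<Rightarrow> eig_n a b n \<omega> c) (case y of (\<omega>, c) \<Rightarrow> eig_n a b n \<omega> c) < \<epsilon>)"
    by (intro exI[of _ U]) (auto simp: xe)
qed

end
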